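(* Let $R$ be an associative ring with unit and let $\mathbb M$ be an $\mathcal R$-module. Then $\mathbb M$ preserves direct limits if and only if $\mathbb M$ is a direct limit of FP modules.
   Context: "$R$-module" means left $R$-module. An $\mathcal R$-module is a covariant additive functor from the category of left $R$-modules to abelian groups; morphisms are natural transformations. Direct limits of $\mathcal R$-modules are taken over upward directed sets and computed objectwise. $\mathbb M$ preserves direct limits if the natural map $\varinjlim_i\mathbb M(S_i)\to\mathbb M(\varinjlim_i S_i)$ is an isomorphism for every direct system of $R$-modules over an upward directed set. An FP module is an $\mathcal R$-module that preserves direct limits and for which the natural map $\mathbb M(\prod_i S_i)\to\prod_i\mathbb M(S_i)$ is an isomorphism for every set $\{S_i\}$ of $R$-modules. *)

theory Defs
  imports "HOL-Algebra.Module" "HOL-Algebra.Product_Groups"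
begin

unbundle cardinal_syntax

text \<open>
  Size conventions. HOL has no type that is closed under products of arbitrary families, so the
  words "set" and "all modules" are read relative to a type \<open>'u\<close>: a small set is a
  set with fewer elements than \<open>'u\<close>, and the categories of modules and of abelian
  groups consist of the structures with small carrier in \<open>'u\<close>. The cardinality
  of \<open>'u\<close> has to be regular and uncountable. If it is also a strong limit, the
  small sets form a Grothendieck universe and every small family has a small product. The strong
  limit property is not demanded, since HOL cannot provide such a type; the notions below
  make sense without it, and they refer to those products that exist in the category.
\<close>

definition universe_type :: "'u itself \<Rightarrow> bool" where
  "universe_type _ \<longleftrightarrow> regularCard |UNIV :: 'u set| \<and> natLeq <o |UNIV :: 'u set|"

definition small :: "'u itself \<Rightarrow> 'a set \<Rightarrow> bool" where
  "small _ A \<longleftrightarrow> |A| <o |UNIV :: 'u set|"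

section \<open>Left modules\<close>

text \<open>The locale \<^locale>\<open>module\<close> requires a commutative ring. The record type
  \<open>('r, 'u) module\<close> is reused; its multiplicative fields carry no information.\<close>

locale left_module = R?: ring R + M?: abelian_group M for R (structure) and M (structure) +
  assumes smult_closed:
      "\<lbrakk>a \<in> carrier R; x \<in> carrier M\<rbrakk> \<Longrightarrow> a \<odot>\<^bsub>M\<^esub> x \<in> carrier M"
    and smult_l_distr:
      "\<lbrakk>a \<in> carrier R; b \<in> carrier R; x \<in> carrier M\<rbrakk> \<Longrightarrow>
        (a \<oplus>\<^bsub>R\<^esub> b) \<odot>\<^bsub>M\<^esub> x = a \<odot>\<^bsub>M\<^esub> x \<oplus>\<^bsub>M\<^esub> b \<odot>\<^bsub>M\<^esub> x"
    and smult_r_distr: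
      "\<lbrakk>a \<in> carrier R; x \<in> carrier M; y \<in> carrier M\<rbrakk> \<Longrightarrow>
        a \<odot>\<^bsub>M\<^esub> (x \<oplus>\<^bsub>M\<^esub> y) = a \<odot>\<^bsub>M\<^esub> x \<oplus>\<^bsub>M\<^esub> a \<odot>\<^bsub>M\<^esub> y"
    and smult_assoc:
      "\<lbrakk>a \<in> carrier R; b \<in> carrier R; x \<in> carrier M\<rbrakk> \<Longrightarrow>
        (a \<otimes>\<^bsub>R\<^esub> b) \<odot>\<^bsub>M\<^esub> x = a \<odot>\<^bsub>M\<^esub> (b \<odot>\<^bsub>M\<^esub> x)"
    and smult_one:
      "x \<in> carrier M \<Longrightarrow> \<one>\<^bsub>R\<^esub> \<odot>\<^bsub>M\<^esub> x = x"

definition lmod_hom ::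
    "('r, 's) ring_scheme \<Rightarrow> ('r, 'a) module \<Rightarrow> ('r, 'b) module \<Rightarrow> ('a \<Rightarrow> 'b) set" where
  "lmod_hom R S T = {f \<in> carrier S \<rightarrow> carrier T.
     (\<forall>x\<in>carrier S. \<forall>y\<in>carrier S. f (x \<oplus>\<^bsub>S\<^esub> y) = f x \<oplus>\<^bsub>T\<^esub> f y) \<and>
     (\<forall>a\<in>carrier R. \<forall>x\<in>carrier S. f (a \<odot>\<^bsub>S\<^esub> x) = a \<odot>\<^bsub>T\<^esub> f x)}"

definition lmod_iso ::
    "('r, 's) ring_scheme \<Rightarrow> ('r, 'a) module \<Rightarrow> ('r, 'b) module \<Rightarrow> ('a \<Rightarrow> 'b) set" where
  "lmod_iso R S T = {f \<in> lmod_hom R S T. bij_betw f (carrier S) (carrier T)}"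

section \<open>The two categories\<close>

text \<open>Morphisms are \<^const>\<open>extensional\<close> on the carrier of the domain, so that
  equality of functions is equality of morphisms.\<close>

definition lmod_ob :: "('r, 's) ring_scheme \<Rightarrow> ('r, 'u) module set" where
  "lmod_ob R = {S. left_module R S \<and> small TYPE('u) (carrier S)}"

definition lmod_mor ::
    "('r, 's) ring_scheme \<Rightarrow> ('r, 'u) module \<Rightarrow> ('r, 'u) module \<Rightarrow> ('u \<Rightarrow> 'u) set" where
  "lmod_mor R S T = lmod_hom R S T \<inter> extensional (carrier S)"

definition ab_ob :: "'u monoid set" where
  "ab_ob = {G. comm_group G \<and> small TYPE('u) (carrier G)}"

definition ab_mor :: "'u monoid \<Rightarrow> 'u monoid \<Rightarrow> ('u \<Rightarrow> 'u) set" where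
  "ab_mor G H = hom G H \<inter> extensional (carrier G)"

section \<open>Additive functors and natural transformations\<close>

record ('r, 'u) lmod_functor =
  fobj :: "('r, 'u) module \<Rightarrow> 'u monoid"
  fmor :: "('r, 'u) module \<Rightarrow> ('r, 'u) module \<Rightarrow> ('u \<Rightarrow> 'u) \<Rightarrow> 'u \<Rightarrow> 'u"

definition additive_functor ::
    "('r, 's) ring_scheme \<Rightarrow> ('r, 'u) lmod_functor \<Rightarrow> bool" where
  "additive_functor R M \<longleftrightarrow>
     (\<forall>S\<in>lmod_ob R. fobj M S \<in> ab_ob) \<and>
     (\<forall>S\<in>lmod_ob R. \<forall>T\<in>lmod_ob R. \<forall>f\<in>lmod_mor R S T.
        fmor M S T f \<in> ab_mor (fobj M S) (fobj M T)) \<and>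
     (\<forall>S\<in>lmod_ob R.
        fmor M S S (\<lambda>x\<in>carrier S. x) = (\<lambda>x\<in>carrier (fobj M S). x)) \<and>
     (\<forall>S\<in>lmod_ob R. \<forall>T\<in>lmod_ob R. \<forall>U\<in>lmod_ob R.
        \<forall>f\<in>lmod_mor R S T. \<forall>g\<in>lmod_mor R T U.
        fmor M S U (compose (carrier S) g f) =
          compose (carrier (fobj M S)) (fmor M T U g) (fmor M S T f)) \<and>
     (\<forall>S\<in>lmod_ob R. \<forall>T\<in>lmod_ob R. \<forall>f\<in>lmod_mor R S T. \<forall>g\<in>lmod_mor R S T.
        fmor M S T (\<lambda>x\<in>carrier S. f x \<oplus>\<^bsub>T\<^esub> g x) =
          (\<lambda>x\<in>carrier (fobj M S). fmor M S T f x \<otimes>\<^bsub>fobj M T\<^esub> fmor M S T g x))"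

definition nat_trans ::
    "('r, 's) ring_scheme \<Rightarrow> ('r, 'u) lmod_functor \<Rightarrow> ('r, 'u) lmod_functor \<Rightarrow>
     (('r, 'u) module \<Rightarrow> 'u \<Rightarrow> 'u) set" where
  "nat_trans R F G = {\<tau>.
     (\<forall>S\<in>lmod_ob R. \<tau> S \<in> ab_mor (fobj F S) (fobj G S)) \<and>
     (\<forall>S\<in>lmod_ob R. \<forall>T\<in>lmod_ob R. \<forall>f\<in>lmod_mor R S T.
        compose (carrier (fobj F S)) (\<tau> T) (fmor F S T f) =
        compose (carrier (fobj F S)) (fmor G S T f) (\<tau> S))}"

section \<open>Direct limits\<close>

definition directed_set :: "'i set \<Rightarrow> 'i rel \<Rightarrow> bool" where
  "directed_set I r \<longleftrightarrow> I \<noteq> {} \<and> partial_order_on I r \<and>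
     (\<forall>i\<in>I. \<forall>j\<in>I. \<exists>k\<in>I. (i, k) \<in> r \<and> (j, k) \<in> r)"

text \<open>The direct limit of a system of sets \<open>X i\<close> with maps \<open>f i j\<close> is the quotient
  of the disjoint union by the relation of becoming equal at a later index.\<close>

definition dl_rel ::
    "'i set \<Rightarrow> 'i rel \<Rightarrow> ('i \<Rightarrow> 'a set) \<Rightarrow> ('i \<Rightarrow> 'i \<Rightarrow> 'a \<Rightarrow> 'a) \<Rightarrow> ('i \<times> 'a) rel" where
  "dl_rel I r X f = {((i, x), (j, y)). i \<in> I \<and> x \<in> X i \<and> j \<in> I \<and> y \<in> X j \<and>
     (\<exists>k\<in>I. (i, k) \<in> r \<and> (j, k) \<in> r \<and> f i k x = f j k y)}"

text \<open>An operation on classes is computed on representatives after moving them to a common later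
  index. All members of the union are the same class, whence the union is that class.\<close>

definition dl_op ::
    "'i set \<Rightarrow> 'i rel \<Rightarrow> ('i \<Rightarrow> 'a set) \<Rightarrow> ('i \<Rightarrow> 'i \<Rightarrow> 'a \<Rightarrow> 'a) \<Rightarrow>
     ('i \<Rightarrow> 'a \<Rightarrow> 'a \<Rightarrow> 'a) \<Rightarrow> ('i \<times> 'a) set \<Rightarrow> ('i \<times> 'a) set \<Rightarrow> ('i \<times> 'a) set" where
  "dl_op I r X f op c d =
     (\<Union>(i, x)\<in>c. \<Union>(j, y)\<in>d. \<Union>k\<in>{k\<in>I. (i, k) \<in> r \<and> (j, k) \<in> r}.
        dl_rel I r X f `` {(k, op k (f i k x) (f j k y))})"

definition dl_group ::
    "'i set \<Rightarrow> 'i rel \<Rightarrow> ('i \<Rightarrow> 'a monoid) \<Rightarrow> ('i \<Rightarrow> 'i \<Rightarrow> 'a \<Rightarrow> 'a) \<Rightarrow>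
     ('i \<times> 'a) set monoid" where
  "dl_group I r G f =
     (let X = (\<lambda>i. carrier (G i)); E = dl_rel I r X f in
      \<lparr>carrier = (SIGMA i:I. X i) // E,
       mult = dl_op I r X f (\<lambda>k. mult (G k)),
       one = (\<Union>i\<in>I. E `` {(i, \<one>\<^bsub>G i\<^esub>)})\<rparr>)"

definition dl_module ::
    "'i set \<Rightarrow> 'i rel \<Rightarrow> ('i \<Rightarrow> ('r, 'a) module) \<Rightarrow> ('i \<Rightarrow> 'i \<Rightarrow> 'a \<Rightarrow> 'a) \<Rightarrow>
     ('r, ('i \<times> 'a) set) module" where
  "dl_module I r S f =
     (let X = (\<lambda>i. carrier (S i)); E = dl_rel I r X f in
      \<lparr>carrier = (SIGMA i:I. X i) // E,
       mult = undefined,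
       one = undefined,
       zero = (\<Union>i\<in>I. E `` {(i, \<zero>\<^bsub>S i\<^esub>)}),
       add = dl_op I r X f (\<lambda>k. add (S k)),
       smult = (\<lambda>a c. \<Union>(i, x)\<in>c. E `` {(i, a \<odot>\<^bsub>S i\<^esub> x)})\<rparr>)"

text \<open>The natural map induced by a cocone \<open>l\<close> sends the class of \<open>(i, x)\<close> to
  \<open>l i x\<close>.\<close>

definition dl_map :: "('i \<Rightarrow> 'a \<Rightarrow> 'b) \<Rightarrow> ('i \<times> 'a) set \<Rightarrow> 'b" where
  "dl_map l c = the_elem ((\<lambda>(i, x). l i x) ` c)"

definition direct_system_lmod ::
    "('r, 's) ring_scheme \<Rightarrow> 'i set \<Rightarrow> 'i rel \<Rightarrow> ('i \<Rightarrow> ('r, 'u) module) \<Rightarrow>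
     ('i \<Rightarrow> 'i \<Rightarrow> 'u \<Rightarrow> 'u) \<Rightarrow> bool" where
  "direct_system_lmod R I r S f \<longleftrightarrow>
     (\<forall>i\<in>I. S i \<in> lmod_ob R) \<and>
     (\<forall>(i, j)\<in>r. f i j \<in> lmod_mor R (S i) (S j)) \<and>
     (\<forall>i\<in>I. f i i = (\<lambda>x\<in>carrier (S i). x)) \<and>
     (\<forall>i j k. (i, j) \<in> r \<longrightarrow> (j, k) \<in> r \<longrightarrow>
        f i k = compose (carrier (S i)) (f j k) (f i j))"

definition direct_limit_lmod ::
    "('r, 's) ring_scheme \<Rightarrow> 'i set \<Rightarrow> 'i rel \<Rightarrow> ('i \<Rightarrow> ('r, 'u) module) \<Rightarrow>
     ('i \<Rightarrow> 'i \<Rightarrow> 'u \<Rightarrow> 'u) \<Rightarrow> ('r, 'u) module \<Rightarrow> ('i \<Rightarrow> 'u \<Rightarrow> 'u) \<Rightarrow> bool" where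
  "direct_limit_lmod R I r S f L l \<longleftrightarrow>
     L \<in> lmod_ob R \<and>
     (\<forall>i\<in>I. l i \<in> lmod_mor R (S i) L) \<and>
     (\<forall>(i, j)\<in>r. l i = compose (carrier (S i)) (l j) (f i j)) \<and>
     dl_map l \<in> lmod_iso R (dl_module I r S f) L"

text \<open>Index sets are subsets of \<open>'u\<close>, which up to bijection are all small sets. The limit
  module \<open>L\<close> ranges over all objects isomorphic to the standard construction, because the
  latter does not have its carrier in \<open>'u\<close>.\<close>

definition preserves_direct_limits ::
    "('r, 's) ring_scheme \<Rightarrow> ('r, 'u) lmod_functor \<Rightarrow> bool" where
  "preserves_direct_limits R M \<longleftrightarrow>
     (\<forall>(I :: 'u set) r S f L l.
        small TYPE('u) I \<longrightarrow> directed_set I r \<longrightarrow> direct_system_lmod R I r S f \<longrightarrow>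
        direct_limit_lmod R I r S f L l \<longrightarrow>
        dl_map (\<lambda>i. fmor M (S i) L (l i)) \<in>
          iso (dl_group I r (\<lambda>i. fobj M (S i)) (\<lambda>i j. fmor M (S i) (S j) (f i j))) (fobj M L))"

section \<open>Products and FP modules\<close>

definition product_module ::
    "'i set \<Rightarrow> ('i \<Rightarrow> ('r, 'a) module) \<Rightarrow> ('r, 'i \<Rightarrow> 'a) module" where
  "product_module I S =
     \<lparr>carrier = (\<Pi>\<^sub>E i\<in>I. carrier (S i)),
      mult = undefined,
      one = undefined,
      zero = (\<lambda>i\<in>I. \<zero>\<^bsub>S i\<^esub>),
      add = (\<lambda>x y. \<lambda>i\<in>I. x i \<oplus>\<^bsub>S i\<^esub> y i),
      smult = (\<lambda>a x. \<lambda>i\<in>I. a \<odot>\<^bsub>S i\<^esub> x i)\<rparr>"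

definition product_lmod ::
    "('r, 's) ring_scheme \<Rightarrow> 'i set \<Rightarrow> ('i \<Rightarrow> ('r, 'u) module) \<Rightarrow> ('r, 'u) module \<Rightarrow>
     ('i \<Rightarrow> 'u \<Rightarrow> 'u) \<Rightarrow> bool" where
  "product_lmod R I S P p \<longleftrightarrow>
     P \<in> lmod_ob R \<and>
     (\<forall>i\<in>I. p i \<in> lmod_mor R P (S i)) \<and>
     (\<lambda>x. \<lambda>i\<in>I. p i x) \<in> lmod_iso R P (product_module I S)"

definition preserves_products ::
    "('r, 's) ring_scheme \<Rightarrow> ('r, 'u) lmod_functor \<Rightarrow> bool" where
  "preserves_products R M \<longleftrightarrow>
     (\<forall>(I :: 'u set) S P p.
        small TYPE('u) I \<longrightarrow> (\<forall>i\<in>I. S i \<in> lmod_ob R) \<longrightarrow> product_lmod R I S P p \<longrightarrow>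
        (\<lambda>x. \<lambda>i\<in>I. fmor M P (S i) (p i) x) \<in>
          iso (fobj M P) (product_group I (\<lambda>i. fobj M (S i))))"

definition FP_module :: "('r, 's) ring_scheme \<Rightarrow> ('r, 'u) lmod_functor \<Rightarrow> bool" where
  "FP_module R M \<longleftrightarrow>
     additive_functor R M \<and> preserves_direct_limits R M \<and> preserves_products R M"

section \<open>Direct limits of functors\<close>

definition direct_system_functor ::
    "('r, 's) ring_scheme \<Rightarrow> 'i set \<Rightarrow> 'i rel \<Rightarrow> ('i \<Rightarrow> ('r, 'u) lmod_functor) \<Rightarrow>
     ('i \<Rightarrow> 'i \<Rightarrow> ('r, 'u) module \<Rightarrow> 'u \<Rightarrow> 'u) \<Rightarrow> bool" where
  "direct_system_functor R I r F \<phi> \<longleftrightarrow>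
     (\<forall>i\<in>I. additive_functor R (F i)) \<and>
     (\<forall>(i, j)\<in>r. \<phi> i j \<in> nat_trans R (F i) (F j)) \<and>
     (\<forall>S\<in>lmod_ob R. \<forall>i\<in>I. \<phi> i i S = (\<lambda>x\<in>carrier (fobj (F i) S). x)) \<and>
     (\<forall>S\<in>lmod_ob R. \<forall>i j k. (i, j) \<in> r \<longrightarrow> (j, k) \<in> r \<longrightarrow>
        \<phi> i k S = compose (carrier (fobj (F i) S)) (\<phi> j k S) (\<phi> i j S))"

definition direct_limit_functor ::
    "('r, 's) ring_scheme \<Rightarrow> 'i set \<Rightarrow> 'i rel \<Rightarrow> ('i \<Rightarrow> ('r, 'u) lmod_functor) \<Rightarrow>
     ('i \<Rightarrow> 'i \<Rightarrow> ('r, 'u) module \<Rightarrow> 'u \<Rightarrow> 'u) \<Rightarrow> ('r, 'u) lmod_functor \<Rightarrow>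
     ('i \<Rightarrow> ('r, 'u) module \<Rightarrow> 'u \<Rightarrow> 'u) \<Rightarrow> bool" where
  "direct_limit_functor R I r F \<phi> M \<psi> \<longleftrightarrow>
     additive_functor R M \<and>
     (\<forall>i\<in>I. \<psi> i \<in> nat_trans R (F i) M) \<and>
     (\<forall>S\<in>lmod_ob R. \<forall>(i, j)\<in>r.
        \<psi> i S = compose (carrier (fobj (F i) S)) (\<psi> j S) (\<phi> i j S)) \<and>
     (\<forall>S\<in>lmod_ob R. dl_map (\<lambda>i. \<psi> i S) \<in>
        iso (dl_group I r (\<lambda>i. fobj (F i) S) (\<lambda>i j. \<phi> i j S)) (fobj M S))"

definition is_direct_limit_of_FP ::
    "('r, 's) ring_scheme \<Rightarrow> ('r, 'u) lmod_functor \<Rightarrow> bool" where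
  "is_direct_limit_of_FP R M \<longleftrightarrow>
     (\<exists>(I :: 'u set) r F \<phi> \<psi>.
        small TYPE('u) I \<and> directed_set I r \<and> direct_system_functor R I r F \<phi> \<and>
        (\<forall>i\<in>I. FP_module R (F i)) \<and> direct_limit_functor R I r F \<phi> M \<psi>)"

end

theory Submission
  imports Defs
begin

text \<open>
  Suppose first that \<open>M\<close> is the direct limit of functors \<open>F i\<close> that preserve direct limits. Then
  \<open>M\<close> preserves direct limits because direct limits commute with each other
  (\<open>preserves_direct_limits_colimit\<close>).

  For the converse, suppose that \<open>M\<close> preserves direct limits. Two facts about finitely
  presented modules are needed. For a finitely presented module \<open>S\<close>, the functor \<open>Hom(S, -)\<close>
  preserves direct limits, since a morphism out of \<open>S\<close> amounts to finitely many elements that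
  satisfy finitely many equations (\<open>finitely_presented_lift\<close>, \<open>finitely_presented_kernel\<close>). Every
  module is a direct limit of finitely presented ones, and these can be taken from one small set
  \<open>\<G>\<close> of representatives (\<open>finitely_presented_catalogue\<close>, \<open>lmod_limit_finitely_presented\<close>).

  The functors \<open>F i\<close> are cokernels of natural transformations
  \<open>d: \<Oplus>b\<in>B. Hom(T b, -) \<rightarrow> \<Oplus>g\<in>A. Hom(S g, -)\<close> with \<open>A\<close> and \<open>B\<close> finite and all \<open>S g\<close> and \<open>T b\<close>
  finitely presented. Source and target of \<open>d\<close> preserve direct limits and products. The cokernel
  inherits both properties, because direct limits and products of abelian groups are exact
  (\<open>F_preserves_direct_limits\<close>, \<open>F_preserves_products\<close>).

  By the Yoneda lemma, an element \<open>m\<close> of \<open>M S\<close> is a natural transformation \<open>Hom(S, -) \<rightarrow> M\<close>. The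
  elements of \<open>M\<close> at the modules in \<open>\<G>\<close> are therefore generators for a presentation of \<open>M\<close> by
  representable functors, with relations at the modules in \<open>\<G>\<close> again. The index set consists of
  the finite pieces \<open>(A, B)\<close> of this presentation: finitely many generators, and finitely many
  relations between them. It is directed under inclusion, and the cokernels \<open>F (A, B)\<close> map to \<open>M\<close>.
  Their direct limit is \<open>M\<close> because the value of \<open>M\<close> at any \<open>X\<close> is determined by its values on
  \<open>\<G>\<close>: write \<open>X\<close> as a direct limit of modules in \<open>\<G>\<close>. Every element of \<open>M X\<close> comes from one of
  them, and every relation that holds in \<open>M X\<close> already holds at one of them (\<open>cocone_limit\<close>).

  All index sets in this argument are small because the cardinality of the universe is regular
  and uncountable and \<open>R\<close> is small: there are few finite sequences in a small set, hence few
  finite presentations and few finite pieces.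
\<close>

section \<open>Small sets\<close>

lemma small_mono: "small TYPE('u) B \<Longrightarrow> A \<subseteq> B \<Longrightarrow> small TYPE('u) A"
  unfolding small_def using card_of_mono1 ordLeq_ordLess_trans by blast

lemma small_image: "small TYPE('u) A \<Longrightarrow> small TYPE('u) (f ` A)"
  unfolding small_def using card_of_image ordLeq_ordLess_trans by blast

lemma small_inj_into:
  assumes "inj_on f A" "f ` A \<subseteq> B" "small TYPE('u) B"
  shows "small TYPE('u) A"
  using assms(3) ordLeq_ordLess_trans[of "|A|" "|B|"] assms(1,2) card_of_ordLeq[of A B]
  unfolding small_def by metis

lemma small_imp_embedding:
  assumes "small TYPE('u) A"
  obtains e :: "'a \<Rightarrow> 'u" where "inj_on e A"
  using ordLess_imp_ordLeq[OF assms[unfolded small_def]] card_of_ordLeq[of A "UNIV :: 'u set"]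
  by auto

lemma universe_stable:
  assumes "universe_type TYPE('u)"
  shows "stable |UNIV :: 'u set|"
proof -
  have "|UNIV :: nat set| \<le>o |UNIV :: 'u set|"
    using assms card_of_nat ordIso_ordLess_trans ordLess_imp_ordLeq
    unfolding universe_type_def by blast
  then have "infinite (UNIV :: 'u set)"
    using card_of_ordLeq_infinite infinite_UNIV_nat by blast
  then show ?thesis
    using assms regularCard_stable card_of_Card_order unfolding universe_type_def
    by (metis Field_card_of)
qed

lemma small_countable:
  assumes "universe_type TYPE('u)"
  shows "small TYPE('u) (A :: nat set)"
proof -
  have "small TYPE('u) (UNIV :: nat set)"
    using assms card_of_nat ordIso_ordLess_trans unfolding universe_type_def small_def by blast
  then show ?thesis
    using small_mono by blast
qed

lemma small_finite:
  assumes "universe_type TYPE('u)" "finite A"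
  shows "small TYPE('u) A"
proof -
  obtain n and g :: "nat \<Rightarrow> 'a" where "A = g ` {i. i < n}"
    using assms(2) finite_imp_nat_seg_image_inj_on by blast
  then show ?thesis
    using small_image small_countable[OF assms(1)] by metis
qed

lemma small_UN:
  assumes "universe_type TYPE('u)" "small TYPE('u) I" "\<And>i. i \<in> I \<Longrightarrow> small TYPE('u) (A i)"
  shows "small TYPE('u) (\<Union>i\<in>I. A i)"
  using assms universe_stable stable_UNION unfolding small_def by blast

lemma small_Sigma:
  assumes "universe_type TYPE('u)" "small TYPE('u) I" "\<And>i. i \<in> I \<Longrightarrow> small TYPE('u) (A i)"
  shows "small TYPE('u) (SIGMA i:I. A i)"
  using assms universe_stable stable_elim unfolding small_def by blast

lemma small_finite_PiE:
  assumes u: "universe_type TYPE('u)" and "finite I" "\<And>i. i \<in> I \<Longrightarrow> small TYPE('u) (A i)"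
  shows "small TYPE('u) (\<Pi>\<^sub>E i\<in>I. A i)"
  using assms(2,3)
proof (induction I)
  case empty
  show ?case by (simp add: small_finite[OF u])
next
  case (insert i I)
  have "small TYPE('u) (A i \<times> (\<Pi>\<^sub>E i\<in>I. A i))"
    using insert by (intro small_Sigma[OF u]) auto
  then show ?case
    unfolding PiE_insert_eq by (rule small_image)
qed

text \<open>A finite subset is the image of a function on an initial segment of \<open>\<nat>\<close>, and there
  are few such functions.\<close>

lemma small_finite_subsets:
  assumes u: "universe_type TYPE('u)" and A: "small TYPE('u) A"
  shows "small TYPE('u) {B. finite B \<and> B \<subseteq> A}"
proof (rule small_mono)
  show "small TYPE('u) (\<Union>n. (\<lambda>g. g ` {i. i < n}) ` (\<Pi>\<^sub>E i\<in>{i::nat. i < n}. A))"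
    using A by (intro small_UN[OF u] small_countable[OF u] small_image small_finite_PiE[OF u]) auto
  show "{B. finite B \<and> B \<subseteq> A} \<subseteq> (\<Union>n. (\<lambda>g. g ` {i. i < n}) ` (\<Pi>\<^sub>E i\<in>{i::nat. i < n}. A))"
  proof
    fix B assume "B \<in> {B. finite B \<and> B \<subseteq> A}"
    then have B: "finite B" "B \<subseteq> A"
      by auto
    obtain n and g :: "nat \<Rightarrow> 'a" where g: "B = g ` {i. i < n}"
      using finite_imp_nat_seg_image_inj_on[OF B(1)] by auto
    have "B = restrict g {i. i < n} ` {i. i < n}"
      using g by simp
    moreover have "restrict g {i. i < n} \<in> (\<Pi>\<^sub>E i\<in>{i. i < n}. A)"
      unfolding restrict_PiE_iff using g B(2) by blast
    ultimately have "B \<in> (\<lambda>g. g ` {i. i < n}) ` (\<Pi>\<^sub>E i\<in>{i::nat. i < n}. A)"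
      by (rule image_eqI)
    then show "B \<in> (\<Union>n. (\<lambda>g. g ` {i. i < n}) ` (\<Pi>\<^sub>E i\<in>{i::nat. i < n}. A))"
      by (rule UN_I[OF UNIV_I])
  qed
qed

section \<open>Quotients of abelian groups\<close>

lemma (in group) mult_inv_eq_one_iff:
  assumes "x \<in> carrier G" "y \<in> carrier G"
  shows "x \<otimes> inv y = \<one> \<longleftrightarrow> x = y"
  using assms by (metis inv_inv inv_equality r_inv inv_closed)

text \<open>Up to isomorphism, \<open>H\<close> is the factor group of \<open>E\<close> by \<open>D\<close>. Its carrier may lie in another
  type than that of \<open>E\<close>.\<close>

definition quotient_map ::
    "('e, 'c) monoid_scheme \<Rightarrow> 'e set \<Rightarrow> ('e \<Rightarrow> 'u) \<Rightarrow> 'u monoid \<Rightarrow> bool" where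
  "quotient_map E D q H \<longleftrightarrow> comm_group E \<and> comm_group H \<and> q \<in> hom E H \<and>
     q ` carrier E = carrier H \<and> (\<forall>x\<in>carrier E. q x = \<one>\<^bsub>H\<^esub> \<longleftrightarrow> x \<in> D)"

definition factor_map ::
    "('e, 'c) monoid_scheme \<Rightarrow> ('e \<Rightarrow> 'u) \<Rightarrow> 'u monoid \<Rightarrow> ('e \<Rightarrow> 'v) \<Rightarrow> 'u \<Rightarrow> 'v" where
  "factor_map E q H g = (\<lambda>y\<in>carrier H. g (inv_into (carrier E) q y))"

lemma quotient_map_eq_iff:
  assumes "quotient_map E D q H" "x \<in> carrier E" "y \<in> carrier E"
  shows "q x = q y \<longleftrightarrow> x \<otimes>\<^bsub>E\<^esub> inv\<^bsub>E\<^esub> y \<in> D"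
proof -
  interpret E: comm_group E using assms unfolding quotient_map_def by auto
  interpret H: comm_group H using assms unfolding quotient_map_def by auto
  interpret q: group_hom E H q
    using assms E.is_group H.is_group unfolding quotient_map_def
    by (auto simp: group_hom_def group_hom_axioms_def)
  have "x \<otimes>\<^bsub>E\<^esub> inv\<^bsub>E\<^esub> y \<in> D \<longleftrightarrow> q (x \<otimes>\<^bsub>E\<^esub> inv\<^bsub>E\<^esub> y) = \<one>\<^bsub>H\<^esub>"
    using assms E.m_closed[OF assms(2) E.inv_closed[OF assms(3)]] unfolding quotient_map_def by blast
  also have "\<dots> \<longleftrightarrow> q x \<otimes>\<^bsub>H\<^esub> inv\<^bsub>H\<^esub> q y = \<one>\<^bsub>H\<^esub>"
    using assms(2,3) by simp
  also have "\<dots> \<longleftrightarrow> q x = q y"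
    using assms(2,3) H.mult_inv_eq_one_iff by simp
  finally show ?thesis by simp
qed

lemma factor_map_apply:
  assumes q: "quotient_map E D q H" and K: "group K" and g: "g \<in> hom E K"
    and D: "\<And>x. x \<in> carrier E \<Longrightarrow> x \<in> D \<Longrightarrow> g x = \<one>\<^bsub>K\<^esub>" and x: "x \<in> carrier E"
  shows "factor_map E q H g (q x) = g x"
proof -
  interpret E: comm_group E using q unfolding quotient_map_def by auto
  interpret g: group_hom E K g
    using K g E.is_group by (auto simp: group_hom_def group_hom_axioms_def)
  have qx: "q x \<in> q ` carrier E" "q x \<in> carrier H"
    using q x unfolding quotient_map_def by auto
  define y where "y = inv_into (carrier E) q (q x)"
  have y: "y \<in> carrier E" "q y = q x"
    unfolding y_def using qx(1) by (rule inv_into_into, rule f_inv_into_f)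
  then have "g (y \<otimes>\<^bsub>E\<^esub> inv\<^bsub>E\<^esub> x) = \<one>\<^bsub>K\<^esub>"
    using quotient_map_eq_iff[OF q y(1) x] D x by auto
  then have "g y = g x"
    using y(1) x g.H.mult_inv_eq_one_iff by simp
  then show ?thesis
    using qx(2) by (simp add: factor_map_def y_def)
qed

lemma factor_map_hom:
  assumes q: "quotient_map E D q H" and K: "group K" and g: "g \<in> hom E K"
    and D: "\<And>x. x \<in> carrier E \<Longrightarrow> x \<in> D \<Longrightarrow> g x = \<one>\<^bsub>K\<^esub>"
  shows "factor_map E q H g \<in> hom H K"
proof (rule homI)
  interpret E: comm_group E using q unfolding quotient_map_def by auto
  have lift: "\<exists>a\<in>carrier E. x = q a" if "x \<in> carrier H" for x
    using that q unfolding quotient_map_def by auto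
  show "factor_map E q H g x \<in> carrier K" if "x \<in> carrier H" for x
    using lift[OF that] factor_map_apply[OF assms] g by (auto simp: hom_def)
  fix x y assume "x \<in> carrier H" "y \<in> carrier H"
  then obtain a b where ab: "a \<in> carrier E" "b \<in> carrier E" "x = q a" "y = q b"
    using lift by metis
  have "x \<otimes>\<^bsub>H\<^esub> y = q (a \<otimes>\<^bsub>E\<^esub> b)"
    using ab q by (auto simp: quotient_map_def hom_def)
  then show "factor_map E q H g (x \<otimes>\<^bsub>H\<^esub> y) = factor_map E q H g x \<otimes>\<^bsub>K\<^esub> factor_map E q H g y"
    using ab factor_map_apply[OF assms] g by (simp add: hom_mult)
qed

lemma quotient_map_surj:
  assumes "quotient_map E D q H" "y \<in> carrier H"
  obtains x where "x \<in> carrier E" "y = q x"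
  using assms unfolding quotient_map_def by auto

lemma factor_map_ab_mor:
  assumes "quotient_map E D q H" "comm_group K" "g \<in> hom E K"
    and "\<And>x. x \<in> carrier E \<Longrightarrow> x \<in> D \<Longrightarrow> g x = \<one>\<^bsub>K\<^esub>"
  shows "factor_map E q H g \<in> ab_mor H K"
  using factor_map_hom[OF assms(1) _ assms(3,4)] assms(2)
  by (auto simp: ab_mor_def factor_map_def comm_group_def)

text \<open>Transporting the factor group along an embedding of its carrier makes it an object
  of the category of small abelian groups.\<close>

lemma small_quotient_exists:
  fixes E :: "('e, 'c) monoid_scheme"
  assumes "comm_group E" "subgroup D E" "small TYPE('u) (carrier E)"
  shows "\<exists>(H :: 'u monoid) q. H \<in> ab_ob \<and> quotient_map E D q H"
proof -
  interpret E: comm_group E by fact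
  interpret D: normal D E
    using assms(2) E.normal_iff_subgroup by blast
  interpret Q: comm_group "E Mod D"
    using E.abelian_FactGroup[OF assms(2)] .
  define p where "p = r_coset E D"
  have p: "p \<in> hom E (E Mod D)"
    unfolding p_def by (rule D.r_coset_hom_Mod)
  have pE: "carrier (E Mod D) = p ` carrier E"
    unfolding p_def by (simp add: carrier_FactGroup)
  have small: "small TYPE('u) (carrier (E Mod D))"
    unfolding pE using assms(3) by (rule small_image)
  then obtain e :: "'e set \<Rightarrow> 'u" where e: "inj_on e (carrier (E Mod D))"
    using small_imp_embedding by blast
  define H where "H = \<lparr>carrier = e ` carrier (E Mod D),
    mult = (\<lambda>x y. e (inv_into (carrier (E Mod D)) e x \<otimes>\<^bsub>E Mod D\<^esub> inv_into (carrier (E Mod D)) e y)),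
    one = e \<one>\<^bsub>E Mod D\<^esub>\<rparr>"
  have mult: "e x \<otimes>\<^bsub>H\<^esub> e y = e (x \<otimes>\<^bsub>E Mod D\<^esub> y)" if "x \<in> carrier (E Mod D)" "y \<in> carrier (E Mod D)" for x y
    using that e by (simp add: H_def)
  have carH: "carrier H = e ` carrier (E Mod D)" and oneH: "\<one>\<^bsub>H\<^esub> = e \<one>\<^bsub>E Mod D\<^esub>"
    by (simp_all add: H_def)
  have H: "comm_group H"
  proof (rule comm_groupI)
    fix x assume "x \<in> carrier H"
    then obtain a where "a \<in> carrier (E Mod D)" "x = e a"
      by (auto simp: carH)
    then have "e (inv\<^bsub>E Mod D\<^esub> a) \<in> carrier H" "e (inv\<^bsub>E Mod D\<^esub> a) \<otimes>\<^bsub>H\<^esub> x = \<one>\<^bsub>H\<^esub>"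
      using Q.l_inv Q.inv_closed by (simp_all add: carH mult oneH del: Q.l_inv one_FactGroup mult_FactGroup)
    then show "\<exists>y\<in>carrier H. y \<otimes>\<^bsub>H\<^esub> x = \<one>\<^bsub>H\<^esub>"
      by blast
  next
    fix x y assume "x \<in> carrier H" "y \<in> carrier H"
    then obtain a b where "a \<in> carrier (E Mod D)" "x = e a" "b \<in> carrier (E Mod D)" "y = e b"
      by (auto simp: carH)
    then show "x \<otimes>\<^bsub>H\<^esub> y = y \<otimes>\<^bsub>H\<^esub> x"
      using Q.m_comm by (simp add: mult del: one_FactGroup mult_FactGroup)
  qed (auto simp: carH oneH mult Q.m_assoc simp del: one_FactGroup mult_FactGroup)
  have ker: "e (p x) = \<one>\<^bsub>H\<^esub> \<longleftrightarrow> x \<in> D" if "x \<in> carrier E" for x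
  proof -
    have "e (p x) = \<one>\<^bsub>H\<^esub> \<longleftrightarrow> p x = \<one>\<^bsub>E Mod D\<^esub>"
      unfolding oneH using that pE e by (intro inj_on_eq_iff) (auto simp del: one_FactGroup)
    also have "\<dots> \<longleftrightarrow> x \<in> D"
      unfolding p_def using that assms(2)
      by (metis E.coset_join1 E.coset_join2 D.subset one_FactGroup)
    finally show ?thesis .
  qed
  have "quotient_map E D (e \<circ> p) H"
    unfolding quotient_map_def
  proof (intro conjI ballI)
    show "(e \<circ> p) \<in> hom E H"
      using p by (auto simp: hom_def carH mult Pi_def pE)
  qed (use H ker assms(1) in \<open>auto simp: carH pE\<close>)
  moreover have "H \<in> ab_ob"
    using H small_image[OF small] by (simp add: ab_ob_def carH)
  ultimately show ?thesis by blast
qed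

section \<open>Direct limits in terms of elements\<close>

text \<open>For a directed system of groups, this says that \<open>dl_map l\<close> is an isomorphism, without
  mentioning classes of the relation on the disjoint union. The kernel suffices for injectivity,
  because two elements can be moved to a common index and subtracted there.\<close>

definition limit_cocone ::
    "'i set \<Rightarrow> 'i rel \<Rightarrow> ('i \<Rightarrow> ('a, 'm) monoid_scheme) \<Rightarrow> ('i \<Rightarrow> 'i \<Rightarrow> 'a \<Rightarrow> 'a) \<Rightarrow>
     ('b, 'n) monoid_scheme \<Rightarrow> ('i \<Rightarrow> 'a \<Rightarrow> 'b) \<Rightarrow> bool" where
  "limit_cocone I r G f H l \<longleftrightarrow>
     (\<forall>y\<in>carrier H. \<exists>i\<in>I. \<exists>x\<in>carrier (G i). y = l i x) \<and>
     (\<forall>i\<in>I. \<forall>x\<in>carrier (G i). l i x = \<one>\<^bsub>H\<^esub> \<longrightarrow> (\<exists>j\<in>I. (i, j) \<in> r \<and> f i j x = \<one>\<^bsub>G j\<^esub>))"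

lemma limit_cocone_surj:
  assumes "limit_cocone I r G f H l" "y \<in> carrier H"
  obtains i x where "i \<in> I" "x \<in> carrier (G i)" "y = l i x"
  using assms unfolding limit_cocone_def by blast

lemma limit_cocone_kernel:
  assumes "limit_cocone I r G f H l" "i \<in> I" "x \<in> carrier (G i)" "l i x = \<one>\<^bsub>H\<^esub>"
  obtains j where "j \<in> I" "(i, j) \<in> r" "f i j x = \<one>\<^bsub>G j\<^esub>"
  using assms unfolding limit_cocone_def by blast

lemma dl_map_const:
  assumes "c \<noteq> {}" "\<And>i x. (i, x) \<in> c \<Longrightarrow> l i x = y"
  shows "dl_map l c = y"
proof -
  have "(\<lambda>(i, x). l i x) ` c = {y}"
    using assms by force
  then show ?thesis by (simp add: dl_map_def)
qed

lemma directed_set_rel: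
  assumes "directed_set I r"
  shows "\<And>i j. (i, j) \<in> r \<Longrightarrow> i \<in> I \<and> j \<in> I" "\<And>i. i \<in> I \<Longrightarrow> (i, i) \<in> r"
    "\<And>i j k. (i, j) \<in> r \<Longrightarrow> (j, k) \<in> r \<Longrightarrow> (i, k) \<in> r"
proof -
  have p: "partial_order_on I r" using assms unfolding directed_set_def by blast
  show "\<And>i j. (i, j) \<in> r \<Longrightarrow> i \<in> I \<and> j \<in> I" "\<And>i. i \<in> I \<Longrightarrow> (i, i) \<in> r"
    using partial_order_onD[OF p] by (auto simp: refl_on_def)
  show "\<And>i j k. (i, j) \<in> r \<Longrightarrow> (j, k) \<in> r \<Longrightarrow> (i, k) \<in> r"
    using partial_order_onD(2)[OF p] by (rule transD)
qed

lemma directed_set_upper: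
  assumes "directed_set I r" "i \<in> I" "j \<in> I"
  obtains k where "k \<in> I" "(i, k) \<in> r" "(j, k) \<in> r"
  using assms unfolding directed_set_def by blast

text \<open>The index \<open>i\<close> is listed separately from the \<open>m a\<close>, so that \<open>A\<close> may be empty.\<close>

lemma directed_set_upper_finite:
  assumes I: "directed_set I r" and "finite A" "\<And>a. a \<in> A \<Longrightarrow> m a \<in> I" and i: "i \<in> I"
  shows "\<exists>k\<in>I. (i, k) \<in> r \<and> (\<forall>a\<in>A. (m a, k) \<in> r)"
  using assms(2,3)
proof (induction A)
  case empty
  then show ?case using directed_set_rel(2)[OF I i] i by auto
next
  case (insert a A)
  then obtain k where k: "k \<in> I" "(i, k) \<in> r" "\<forall>a\<in>A. (m a, k) \<in> r"
    by auto
  obtain k' where "k' \<in> I" "(k, k') \<in> r" "(m a, k') \<in> r"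
    using directed_set_upper[OF I k(1), of "m a"] insert by auto
  then show ?case
    using k directed_set_rel(3)[OF I] by (intro bexI[of _ k']) auto
qed

locale group_cocone =
  fixes I :: "'i set" and r :: "'i rel" and G :: "'i \<Rightarrow> ('a, 'm) monoid_scheme"
    and f :: "'i \<Rightarrow> 'i \<Rightarrow> 'a \<Rightarrow> 'a" and H :: "('b, 'n) monoid_scheme" and l :: "'i \<Rightarrow> 'a \<Rightarrow> 'b"
  assumes directed: "directed_set I r"
    and G: "\<And>i. i \<in> I \<Longrightarrow> group (G i)" and H: "group H"
    and f: "\<And>i j. (i, j) \<in> r \<Longrightarrow> f i j \<in> hom (G i) (G j)"
    and f_comp: "\<And>i j k x. (i, j) \<in> r \<Longrightarrow> (j, k) \<in> r \<Longrightarrow> x \<in> carrier (G i) \<Longrightarrow>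
      f i k x = f j k (f i j x)"
    and l: "\<And>i. i \<in> I \<Longrightarrow> l i \<in> hom (G i) H"
    and l_comp: "\<And>i j x. (i, j) \<in> r \<Longrightarrow> x \<in> carrier (G i) \<Longrightarrow> l j (f i j x) = l i x"
begin

lemmas rel = directed_set_rel[OF directed]

abbreviation "E \<equiv> dl_rel I r (\<lambda>i. carrier (G i)) f"
abbreviation "Q \<equiv> (SIGMA i:I. carrier (G i)) // E"

lemma f_closed: "(i, j) \<in> r \<Longrightarrow> x \<in> carrier (G i) \<Longrightarrow> f i j x \<in> carrier (G j)"
  using f by (auto simp: hom_def)

lemma l_closed: "i \<in> I \<Longrightarrow> x \<in> carrier (G i) \<Longrightarrow> l i x \<in> carrier H"
  using l by (auto simp: hom_def)

lemma rel_refl: "i \<in> I \<Longrightarrow> x \<in> carrier (G i) \<Longrightarrow> ((i, x), (i, x)) \<in> E"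
  unfolding dl_rel_def using rel(2) by auto

lemma rel_imp_eq: "((i, x), (j, y)) \<in> E \<Longrightarrow> l i x = l j y"
  unfolding dl_rel_def using l_comp by (simp, metis)

lemma rel_equiv: "equiv (SIGMA i:I. carrier (G i)) E"
proof (rule equivI)
  show "E \<subseteq> (SIGMA i:I. carrier (G i)) \<times> (SIGMA i:I. carrier (G i))"
    unfolding dl_rel_def by auto
  show "refl_on (SIGMA i:I. carrier (G i)) E"
    using rel_refl by (auto simp: refl_on_def)
  show "sym E"
  proof (rule symI)
    fix p q assume "(p, q) \<in> E"
    then show "(q, p) \<in> E"
      unfolding dl_rel_def by (cases p, cases q) (simp, metis)
  qed
  show "trans E"
  proof (rule transI)
    fix p q s assume "(p, q) \<in> E" "(q, s) \<in> E"
    then obtain i x j y k z where p: "p = (i, x)" "q = (j, y)" "s = (k, z)"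
      and ij: "((i, x), (j, y)) \<in> E" and jk: "((j, y), (k, z)) \<in> E"
      by (metis surj_pair)
    from ij obtain a where a: "a \<in> I" "(i, a) \<in> r" "(j, a) \<in> r" "f i a x = f j a y"
      and xy: "i \<in> I" "x \<in> carrier (G i)" "j \<in> I" "y \<in> carrier (G j)"
      unfolding dl_rel_def by auto
    from jk obtain b where b: "b \<in> I" "(j, b) \<in> r" "(k, b) \<in> r" "f j b y = f k b z"
      and z: "k \<in> I" "z \<in> carrier (G k)"
      unfolding dl_rel_def by auto
    obtain c where c: "c \<in> I" "(a, c) \<in> r" "(b, c) \<in> r"
      using directed_set_upper[OF directed a(1) b(1)] by blast
    have "f i c x = f a c (f j a y)" using f_comp[OF a(2) c(2)] a xy by simp
    also have "\<dots> = f b c (f j b y)" using f_comp a b c xy by metis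
    also have "\<dots> = f k c z" using f_comp[OF b(3) c(3)] b z by simp
    finally have "f i c x = f k c z" .
    then show "(p, s) \<in> E"
      unfolding p dl_rel_def using xy z c(1) rel(3)[OF a(2) c(2)] rel(3)[OF b(3) c(3)] by blast
  qed
qed

lemma dl_map_class: "i \<in> I \<Longrightarrow> x \<in> carrier (G i) \<Longrightarrow> dl_map l (E `` {(i, x)}) = l i x"
  using rel_refl rel_imp_eq by (intro dl_map_const) fastforce+

lemma class_cases:
  assumes "c \<in> Q"
  obtains i x where "i \<in> I" "x \<in> carrier (G i)" "c = E `` {(i, x)}"
  using assms by (auto elim!: quotientE)

lemma class_elem:
  assumes "c \<in> Q" "(i, x) \<in> c"
  shows "i \<in> I" "x \<in> carrier (G i)" "dl_map l c = l i x"
proof -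
  obtain j y where y: "j \<in> I" "y \<in> carrier (G j)" "c = E `` {(j, y)}"
    using class_cases[OF assms(1)] .
  then have ij: "((j, y), (i, x)) \<in> E"
    using assms(2) by blast
  then show "i \<in> I" "x \<in> carrier (G i)"
    unfolding dl_rel_def by auto
  show "dl_map l c = l i x"
    using y dl_map_class[OF y(1,2)] rel_imp_eq[OF ij] by simp
qed

lemma class_nonempty:
  assumes "c \<in> Q"
  obtains i x where "(i, x) \<in> c"
  using assms rel_refl by (auto elim!: class_cases)

text \<open>For injectivity, \<open>x\<close> and \<open>y\<close> are moved to a common index \<open>k\<close>, where they become \<open>u\<close> and
  \<open>v\<close>. Their quotient lies in the kernel of \<open>l k\<close> and therefore dies at some \<open>m\<close>.\<close>

lemma bij_iff_limit_cocone: "bij_betw (dl_map l) Q (carrier H) \<longleftrightarrow> limit_cocone I r G f H l"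
proof
  assume bij: "bij_betw (dl_map l) Q (carrier H)"
  show "limit_cocone I r G f H l"
    unfolding limit_cocone_def
  proof (intro conjI ballI impI)
    fix y assume "y \<in> carrier H"
    then obtain c where "c \<in> Q" "y = dl_map l c"
      using bij unfolding bij_betw_def by blast
    then show "\<exists>i\<in>I. \<exists>x\<in>carrier (G i). y = l i x"
      using dl_map_class by (auto elim!: class_cases)
  next
    fix i x assume x: "i \<in> I" "x \<in> carrier (G i)" "l i x = \<one>\<^bsub>H\<^esub>"
    interpret G: group "G i" using G x by blast
    interpret l: group_hom "G i" H "l i"
      using G.is_group H l x by (auto simp: group_hom_def group_hom_axioms_def)
    have "E `` {(i, x)} = E `` {(i, \<one>\<^bsub>G i\<^esub>)}"
      using x dl_map_class[of i] by (intro inj_onD[OF bij_betw_imp_inj_on[OF bij]] quotientI) auto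
    then have "((i, x), (i, \<one>\<^bsub>G i\<^esub>)) \<in> E"
      using rel_refl[of i "\<one>\<^bsub>G i\<^esub>"] x by blast
    then obtain k where k: "k \<in> I" "(i, k) \<in> r" "f i k x = f i k \<one>\<^bsub>G i\<^esub>"
      unfolding dl_rel_def by auto
    then have "f i k x = \<one>\<^bsub>G k\<^esub>"
      using f G x hom_one by metis
    then show "\<exists>j\<in>I. (i, j) \<in> r \<and> f i j x = \<one>\<^bsub>G j\<^esub>"
      using k by blast
  qed
next
  assume lim: "limit_cocone I r G f H l"
  show "bij_betw (dl_map l) Q (carrier H)"
  proof (rule bij_betw_imageI)
    have "dl_map l c \<in> carrier H" if "c \<in> Q" for c
      using that l_closed by (auto elim!: class_cases simp: dl_map_class)
    moreover have "y \<in> dl_map l ` Q" if yH: "y \<in> carrier H" for y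
    proof -
      obtain i x where "i \<in> I" "x \<in> carrier (G i)" "y = l i x"
        using limit_cocone_surj[OF lim yH] .
      then show ?thesis
        by (intro image_eqI[of _ _ "E `` {(i, x)}"] quotientI) (auto simp: dl_map_class)
    qed
    ultimately show "dl_map l ` Q = carrier H" by blast
    show "inj_on (dl_map l) Q"
    proof (rule inj_onI)
      fix c d assume cd: "c \<in> Q" "d \<in> Q" and eq: "dl_map l c = dl_map l d"
      obtain i x where x: "i \<in> I" "x \<in> carrier (G i)" "c = E `` {(i, x)}"
        using class_cases[OF cd(1)] .
      obtain j y where y: "j \<in> I" "y \<in> carrier (G j)" "d = E `` {(j, y)}"
        using class_cases[OF cd(2)] .
      obtain k where k: "k \<in> I" "(i, k) \<in> r" "(j, k) \<in> r"
        using directed_set_upper[OF directed x(1) y(1)] by blast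
      interpret G: group "G k" using G k by blast
      interpret l: group_hom "G k" H "l k"
        using G.is_group H l k by (auto simp: group_hom_def group_hom_axioms_def)
      define u v where "u = f i k x" and "v = f j k y"
      have uv: "u \<in> carrier (G k)" "v \<in> carrier (G k)" "l k u = l k v"
        using x y k f_closed l_comp eq by (auto simp: u_def v_def dl_map_class)
      then have "l k (u \<otimes>\<^bsub>G k\<^esub> inv\<^bsub>G k\<^esub> v) = \<one>\<^bsub>H\<^esub>"
        by (simp add: l.H.r_inv)
      then obtain m where m: "m \<in> I" "(k, m) \<in> r" "f k m (u \<otimes>\<^bsub>G k\<^esub> inv\<^bsub>G k\<^esub> v) = \<one>\<^bsub>G m\<^esub>"
        using limit_cocone_kernel[OF lim k(1), of "u \<otimes>\<^bsub>G k\<^esub> inv\<^bsub>G k\<^esub> v"] uv by auto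
      interpret f: group_hom "G k" "G m" "f k m"
        using G.is_group G f m by (auto simp: group_hom_def group_hom_axioms_def)
      have "f k m u \<otimes>\<^bsub>G m\<^esub> inv\<^bsub>G m\<^esub> (f k m v) = \<one>\<^bsub>G m\<^esub>"
        using m uv by simp
      then have "f k m u = f k m v"
        using uv(1,2) f.H.mult_inv_eq_one_iff by simp
      then have "f i m x = f j m y"
        using f_comp[OF k(2) m(2) x(2)] f_comp[OF k(3) m(2) y(2)] unfolding u_def v_def by simp
      then have "((i, x), (j, y)) \<in> E"
        unfolding dl_rel_def using x y m(1) rel(3)[OF k(2) m(2)] rel(3)[OF k(3) m(2)] by blast
      then show "c = d"
        using x y equiv_class_eq[OF rel_equiv] by simp
    qed
  qed
qed

text \<open>Every member of the union that defines the operation has the same value under \<open>l\<close>, and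
  \<open>dl_map\<close> reads off this value.\<close>

lemma dl_map_op:
  assumes "c \<in> Q" "d \<in> Q"
  shows "dl_map l (dl_op I r (\<lambda>i. carrier (G i)) f (\<lambda>k. mult (G k)) c d) =
    dl_map l c \<otimes>\<^bsub>H\<^esub> dl_map l d"
proof (rule dl_map_const)
  have mult: "f i k x \<otimes>\<^bsub>G k\<^esub> f j k y \<in> carrier (G k)
      \<and> l k (f i k x \<otimes>\<^bsub>G k\<^esub> f j k y) = dl_map l c \<otimes>\<^bsub>H\<^esub> dl_map l d"
    if "(i, x) \<in> c" "(j, y) \<in> d" "k \<in> I" "(i, k) \<in> r" "(j, k) \<in> r" for i x j y k
  proof -
    interpret Gk: group "G k" using G that by blast
    have x: "i \<in> I" "x \<in> carrier (G i)" "dl_map l c = l i x"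
      using class_elem[OF assms(1) that(1)] .
    have y: "j \<in> I" "y \<in> carrier (G j)" "dl_map l d = l j y"
      using class_elem[OF assms(2) that(2)] .
    have "f i k x \<in> carrier (G k)" "f j k y \<in> carrier (G k)"
      using that x y f_closed by auto
    then show ?thesis
      using that x y l_comp hom_mult[OF l[OF that(3)]] by simp
  qed
  show "dl_op I r (\<lambda>i. carrier (G i)) f (\<lambda>k. mult (G k)) c d \<noteq> {}"
  proof -
    obtain i x where x: "(i, x) \<in> c" using class_nonempty[OF assms(1)] .
    obtain j y where y: "(j, y) \<in> d" using class_nonempty[OF assms(2)] .
    obtain k where k: "k \<in> I" "(i, k) \<in> r" "(j, k) \<in> r"
      using directed_set_upper[OF directed class_elem(1)[OF assms(1) x] class_elem(1)[OF assms(2) y]]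
      by blast
    have "(k, f i k x \<otimes>\<^bsub>G k\<^esub> f j k y) \<in> E `` {(k, f i k x \<otimes>\<^bsub>G k\<^esub> f j k y)}"
      using mult[OF x y k] k(1) rel_refl by blast
    then show ?thesis
      unfolding dl_op_def using x y k by blast
  qed
  fix m z assume "(m, z) \<in> dl_op I r (\<lambda>i. carrier (G i)) f (\<lambda>k. mult (G k)) c d"
  then obtain i x j y k where "(i, x) \<in> c" "(j, y) \<in> d" and k: "k \<in> I" "(i, k) \<in> r" "(j, k) \<in> r"
    and z: "((k, f i k x \<otimes>\<^bsub>G k\<^esub> f j k y), (m, z)) \<in> E"
    unfolding dl_op_def by blast
  then show "l m z = dl_map l c \<otimes>\<^bsub>H\<^esub> dl_map l d"
    using mult rel_imp_eq[OF z] by simp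
qed

end

lemma dl_group_iso_iff:
  fixes G :: "'i \<Rightarrow> 'a monoid"
  assumes "group_cocone I r G f H l"
  shows "dl_map l \<in> iso (dl_group I r G f) H \<longleftrightarrow> limit_cocone I r G f H l"
proof -
  interpret group_cocone I r G f H l by fact
  have "dl_map l \<in> hom (dl_group I r G f) H" if "bij_betw (dl_map l) Q (carrier H)"
    using dl_map_op bij_betw_apply[OF that]
    by (intro homI) (auto simp: dl_group_def Let_def)
  then show ?thesis
    using bij_iff_limit_cocone by (auto simp: iso_def dl_group_def Let_def)
qed

section \<open>Morphisms of modules\<close>

lemma lmod_ob_left_module: "S \<in> lmod_ob R \<Longrightarrow> left_module R S"
  by (simp add: lmod_ob_def)

lemma lmod_ob_abelian: "S \<in> lmod_ob R \<Longrightarrow> abelian_group S"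
  using lmod_ob_left_module left_module.axioms(2) by blast

lemma lmod_ob_add_group: "S \<in> lmod_ob R \<Longrightarrow> comm_group (add_monoid S)"
  using lmod_ob_abelian abelian_group.a_comm_group by blast

lemma lmod_mor_closed: "f \<in> lmod_mor R S T \<Longrightarrow> x \<in> carrier S \<Longrightarrow> f x \<in> carrier T"
  by (auto simp: lmod_mor_def lmod_hom_def)

lemma lmod_mor_add:
  "f \<in> lmod_mor R S T \<Longrightarrow> x \<in> carrier S \<Longrightarrow> y \<in> carrier S \<Longrightarrow> f (x \<oplus>\<^bsub>S\<^esub> y) = f x \<oplus>\<^bsub>T\<^esub> f y"
  by (auto simp: lmod_mor_def lmod_hom_def)

lemma lmod_mor_smult:
  "f \<in> lmod_mor R S T \<Longrightarrow> a \<in> carrier R \<Longrightarrow> x \<in> carrier S \<Longrightarrow> f (a \<odot>\<^bsub>S\<^esub> x) = a \<odot>\<^bsub>T\<^esub> f x"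
  by (auto simp: lmod_mor_def lmod_hom_def)

lemma lmod_mor_hom: "f \<in> lmod_mor R S T \<Longrightarrow> f \<in> hom (add_monoid S) (add_monoid T)"
  by (auto simp: lmod_mor_def lmod_hom_def hom_def)

lemma lmod_mor_zero:
  assumes "f \<in> lmod_mor R S T" "S \<in> lmod_ob R" "T \<in> lmod_ob R"
  shows "f \<zero>\<^bsub>S\<^esub> = \<zero>\<^bsub>T\<^esub>"
  using hom_one[OF lmod_mor_hom[OF assms(1)]] lmod_ob_add_group[OF assms(2)]
    lmod_ob_add_group[OF assms(3)] by (simp add: comm_group_def)

lemma lmod_morI:
  assumes "\<And>x. x \<in> carrier S \<Longrightarrow> f x \<in> carrier T"
    and "\<And>x y. x \<in> carrier S \<Longrightarrow> y \<in> carrier S \<Longrightarrow> f (x \<oplus>\<^bsub>S\<^esub> y) = f x \<oplus>\<^bsub>T\<^esub> f y"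
    and "\<And>a x. a \<in> carrier R \<Longrightarrow> x \<in> carrier S \<Longrightarrow> f (a \<odot>\<^bsub>S\<^esub> x) = a \<odot>\<^bsub>T\<^esub> f x"
    and "f \<in> extensional (carrier S)"
  shows "f \<in> lmod_mor R S T"
  using assms by (auto simp: lmod_mor_def lmod_hom_def)

lemma lmod_mor_ext:
  assumes "f \<in> lmod_mor R S T" "g \<in> lmod_mor R S T'" "\<And>x. x \<in> carrier S \<Longrightarrow> f x = g x"
  shows "f = g"
  using assms extensionalityI[of f "carrier S" g] by (auto simp: lmod_mor_def)

lemma lmod_mor_compose:
  assumes "f \<in> lmod_mor R S T" "g \<in> lmod_mor R T U"
    and "left_module R S"
  shows "compose (carrier S) g f \<in> lmod_mor R S U"
proof -
  interpret S: left_module R S by fact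
  show ?thesis
    using assms
    by (intro lmod_morI)
      (auto simp: compose_def lmod_mor_closed lmod_mor_add lmod_mor_smult S.smult_closed)
qed

lemma lmod_mor_id:
  assumes "left_module R S"
  shows "(\<lambda>x\<in>carrier S. x) \<in> lmod_mor R S S"
proof -
  interpret S: left_module R S by fact
  show ?thesis by (intro lmod_morI) (auto simp: S.smult_closed)
qed

section \<open>Direct limits of modules\<close>

text \<open>The modules of the system are additive groups, and the criterion for groups
  applies to them: \<open>lmod_limitD\<close> and \<open>lmod_limitI\<close> replace the isomorphism with the standard limit
  module by \<open>limit_cocone\<close>.\<close>

definition lmod_limit ::
    "('r, 's) ring_scheme \<Rightarrow> 'i set \<Rightarrow> 'i rel \<Rightarrow> ('i \<Rightarrow> ('r, 'u) module) \<Rightarrow>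
     ('i \<Rightarrow> 'i \<Rightarrow> 'u \<Rightarrow> 'u) \<Rightarrow> ('r, 'u) module \<Rightarrow> ('i \<Rightarrow> 'u \<Rightarrow> 'u) \<Rightarrow> bool" where
  "lmod_limit R I r S f L l \<longleftrightarrow>
     directed_set I r \<and> direct_system_lmod R I r S f \<and> direct_limit_lmod R I r S f L l"

lemma direct_system_lmodD:
  assumes "direct_system_lmod R I r S f"
  shows "\<And>i. i \<in> I \<Longrightarrow> S i \<in> lmod_ob R"
    and "\<And>i j. (i, j) \<in> r \<Longrightarrow> f i j \<in> lmod_mor R (S i) (S j)"
    and "\<And>i. i \<in> I \<Longrightarrow> f i i = (\<lambda>x\<in>carrier (S i). x)"
    and "\<And>i j k. (i, j) \<in> r \<Longrightarrow> (j, k) \<in> r \<Longrightarrow> f i k = compose (carrier (S i)) (f j k) (f i j)"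
  using assms unfolding direct_system_lmod_def by auto

lemma lmod_group_cocone:
  assumes dir: "directed_set I r" and sys: "direct_system_lmod R I r S f" and L: "L \<in> lmod_ob R"
    and l: "\<And>i. i \<in> I \<Longrightarrow> l i \<in> lmod_mor R (S i) L"
    and comp: "\<And>i j. (i, j) \<in> r \<Longrightarrow> l i = compose (carrier (S i)) (l j) (f i j)"
  shows "group_cocone I r (\<lambda>i. add_monoid (S i)) f (add_monoid L) l"
proof (rule group_cocone.intro)
  note D = direct_system_lmodD[OF sys]
  show "group (add_monoid (S i))" if "i \<in> I" for i
    using D(1)[OF that] lmod_ob_add_group comm_group.axioms(2) by blast
  show "group (add_monoid L)"
    using L lmod_ob_add_group comm_group.axioms(2) by blast
  show "f i j \<in> hom (add_monoid (S i)) (add_monoid (S j))" if "(i, j) \<in> r" for i j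
    using D(2)[OF that] by (rule lmod_mor_hom)
  show "f i k x = f j k (f i j x)"
    if "(i, j) \<in> r" "(j, k) \<in> r" "x \<in> carrier (add_monoid (S i))" for i j k x
    using D(4)[OF that(1,2)] that(3) by (simp add: compose_def)
  show "l i \<in> hom (add_monoid (S i)) (add_monoid L)" if "i \<in> I" for i
    using l[OF that] by (rule lmod_mor_hom)
  show "l j (f i j x) = l i x" if "(i, j) \<in> r" "x \<in> carrier (add_monoid (S i))" for i j x
    using comp[OF that(1)] that(2) by (simp add: compose_def)
qed (rule dir)

lemma lmod_limitD:
  assumes "lmod_limit R I r S f L l"
  shows "directed_set I r" "direct_system_lmod R I r S f" "L \<in> lmod_ob R"
    and "\<And>i. i \<in> I \<Longrightarrow> l i \<in> lmod_mor R (S i) L"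
    and "\<And>i j. (i, j) \<in> r \<Longrightarrow> l i = compose (carrier (S i)) (l j) (f i j)"
    and "limit_cocone I r (\<lambda>i. add_monoid (S i)) f (add_monoid L) l"
proof -
  show 1: "directed_set I r" "direct_system_lmod R I r S f" "L \<in> lmod_ob R"
    and 2: "\<And>i. i \<in> I \<Longrightarrow> l i \<in> lmod_mor R (S i) L"
    and 3: "\<And>i j. (i, j) \<in> r \<Longrightarrow> l i = compose (carrier (S i)) (l j) (f i j)"
    using assms unfolding lmod_limit_def direct_limit_lmod_def by auto
  interpret group_cocone I r "\<lambda>i. add_monoid (S i)" f "add_monoid L" l
    using lmod_group_cocone[OF 1 2 3] .
  have "bij_betw (dl_map l) Q (carrier L)"
    using assms unfolding lmod_limit_def direct_limit_lmod_def lmod_iso_def dl_module_def Let_def by simp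
  then show "limit_cocone I r (\<lambda>i. add_monoid (S i)) f (add_monoid L) l"
    using bij_iff_limit_cocone by simp
qed

lemma lmod_limitI:
  assumes dir: "directed_set I r" and sys: "direct_system_lmod R I r S f" and L: "L \<in> lmod_ob R"
    and mor: "\<And>i. i \<in> I \<Longrightarrow> l i \<in> lmod_mor R (S i) L"
    and comp: "\<And>i j. (i, j) \<in> r \<Longrightarrow> l i = compose (carrier (S i)) (l j) (f i j)"
    and lim: "limit_cocone I r (\<lambda>i. add_monoid (S i)) f (add_monoid L) l"
  shows "lmod_limit R I r S f L l"
proof -
  interpret group_cocone I r "\<lambda>i. add_monoid (S i)" f "add_monoid L" l
    using lmod_group_cocone[OF dir sys L mor comp] .
  have bij: "bij_betw (dl_map l) Q (carrier L)"
    using lim bij_iff_limit_cocone by simp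
  have "dl_map l (\<Union>(i, x)\<in>c. E `` {(i, a \<odot>\<^bsub>S i\<^esub> x)}) = a \<odot>\<^bsub>L\<^esub> dl_map l c"
    if a: "a \<in> carrier R" and c: "c \<in> Q" for a c
  proof (rule dl_map_const)
    have smult: "a \<odot>\<^bsub>S i\<^esub> x \<in> carrier (S i) \<and> i \<in> I \<and> l i (a \<odot>\<^bsub>S i\<^esub> x) = a \<odot>\<^bsub>L\<^esub> dl_map l c"
      if ix: "(i, x) \<in> c" for i x
    proof -
      note x = class_elem[OF c ix]
      then show ?thesis
        using lmod_mor_smult[OF mor a, of i x] left_module.smult_closed[of R "S i" a x] a
          lmod_ob_left_module[OF direct_system_lmodD(1)[OF sys]] by simp
    qed
    obtain i x where ix: "(i, x) \<in> c" using class_nonempty[OF c] .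
    then have "(i, a \<odot>\<^bsub>S i\<^esub> x) \<in> E `` {(i, a \<odot>\<^bsub>S i\<^esub> x)}"
      using smult[OF ix] rel_refl by simp
    then show "(\<Union>(i, x)\<in>c. E `` {(i, a \<odot>\<^bsub>S i\<^esub> x)}) \<noteq> {}"
      using ix by blast
    fix j z assume "(j, z) \<in> (\<Union>(i, x)\<in>c. E `` {(i, a \<odot>\<^bsub>S i\<^esub> x)})"
    then obtain i x where ix: "(i, x) \<in> c" and z: "((i, a \<odot>\<^bsub>S i\<^esub> x), (j, z)) \<in> E"
      by blast
    show "l j z = a \<odot>\<^bsub>L\<^esub> dl_map l c"
      using smult[OF ix] rel_imp_eq[OF z] by simp
  qed
  then have "dl_map l \<in> lmod_iso R (dl_module I r S f) L"
    using bij dl_map_op bij_betw_apply[OF bij]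
    unfolding lmod_iso_def lmod_hom_def dl_module_def Let_def by simp
  then show ?thesis
    using dir sys L mor comp unfolding lmod_limit_def direct_limit_lmod_def by blast
qed

section \<open>Additive functors\<close>

lemma functor_ob:
  assumes "additive_functor R M" "S \<in> lmod_ob R"
  shows "comm_group (fobj M S)"
  using assms unfolding additive_functor_def ab_ob_def by blast

lemma functor_group:
  assumes "additive_functor R M" "S \<in> lmod_ob R"
  shows "group (fobj M S)"
  using functor_ob[OF assms] comm_group.axioms(2) by blast

context
  fixes R :: "('r, 's) ring_scheme" and M :: "('r, 'u) lmod_functor"
    and S T :: "('r, 'u) module"
  assumes M: "additive_functor R M" and S: "S \<in> lmod_ob R" and T: "T \<in> lmod_ob R"
begin

lemma functor_ab_mor: "f \<in> lmod_mor R S T \<Longrightarrow> fmor M S T f \<in> ab_mor (fobj M S) (fobj M T)"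
  using M S T unfolding additive_functor_def by blast

lemma functor_hom: "f \<in> lmod_mor R S T \<Longrightarrow> fmor M S T f \<in> hom (fobj M S) (fobj M T)"
  using functor_ab_mor unfolding ab_mor_def by blast

lemma functor_closed:
  "f \<in> lmod_mor R S T \<Longrightarrow> x \<in> carrier (fobj M S) \<Longrightarrow> fmor M S T f x \<in> carrier (fobj M T)"
  using functor_hom by (auto simp: hom_def)

lemma functor_compose:
  assumes "U \<in> lmod_ob R" "f \<in> lmod_mor R S T" "g \<in> lmod_mor R T U" "x \<in> carrier (fobj M S)"
  shows "fmor M S U (compose (carrier S) g f) x = fmor M T U g (fmor M S T f x)"
proof -
  have "fmor M S U (compose (carrier S) g f) =
          compose (carrier (fobj M S)) (fmor M T U g) (fmor M S T f)"
    using M S T assms(1,2,3) unfolding additive_functor_def by blast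
  then show ?thesis using assms(4) by (simp add: compose_def)
qed

lemma functor_add:
  assumes "f \<in> lmod_mor R S T" "g \<in> lmod_mor R S T" "x \<in> carrier (fobj M S)"
  shows "fmor M S T (\<lambda>x\<in>carrier S. f x \<oplus>\<^bsub>T\<^esub> g x) x =
    fmor M S T f x \<otimes>\<^bsub>fobj M T\<^esub> fmor M S T g x"
proof -
  have "fmor M S T (\<lambda>x\<in>carrier S. f x \<oplus>\<^bsub>T\<^esub> g x) =
          (\<lambda>x\<in>carrier (fobj M S). fmor M S T f x \<otimes>\<^bsub>fobj M T\<^esub> fmor M S T g x)"
    using M S T assms(1,2) unfolding additive_functor_def by blast
  then show ?thesis using assms(3) by simp
qed

end

lemma functor_group_cocone:
  assumes M: "additive_functor R M" and lim: "lmod_limit R I r S f L l"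
  shows "group_cocone I r (\<lambda>i. fobj M (S i)) (\<lambda>i j. fmor M (S i) (S j) (f i j)) (fobj M L)
    (\<lambda>i. fmor M (S i) L (l i))"
proof (rule group_cocone.intro)
  note L = lmod_limitD[OF lim]
  note D = direct_system_lmodD[OF L(2)]
  note rel = directed_set_rel[OF L(1)]
  show "directed_set I r" by fact
  show "group (fobj M (S i))" if "i \<in> I" for i
    using functor_group[OF M D(1)[OF that]] .
  show "group (fobj M L)" using functor_group[OF M L(3)] .
  show "fmor M (S i) (S j) (f i j) \<in> hom (fobj M (S i)) (fobj M (S j))" if "(i, j) \<in> r" for i j
    using functor_hom[OF M D(1) D(1) D(2)] rel(1)[OF that] that by blast
  show "fmor M (S i) (S k) (f i k) x = fmor M (S j) (S k) (f j k) (fmor M (S i) (S j) (f i j) x)"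
    if "(i, j) \<in> r" "(j, k) \<in> r" "x \<in> carrier (fobj M (S i))" for i j k x
    using functor_compose[OF M D(1) D(1) D(1) D(2) D(2)] rel(1) that D(4)[OF that(1,2)] by simp
  show "fmor M (S i) L (l i) \<in> hom (fobj M (S i)) (fobj M L)" if "i \<in> I" for i
    using functor_hom[OF M D(1) L(3) L(4)] that by blast
  show "fmor M (S j) L (l j) (fmor M (S i) (S j) (f i j) x) = fmor M (S i) L (l i) x"
    if "(i, j) \<in> r" "x \<in> carrier (fobj M (S i))" for i j x
    using functor_compose[OF M D(1) D(1) L(3) D(2) L(4)] rel(1) that L(5)[OF that(1)] by simp
qed

abbreviation functor_limit where
  "functor_limit M I r S f L l \<equiv>
     limit_cocone I r (\<lambda>i. fobj M (S i)) (\<lambda>i j. fmor M (S i) (S j) (f i j)) (fobj M L)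
       (\<lambda>i. fmor M (S i) L (l i))"

lemma preserves_direct_limits_iff:
  fixes M :: "('r, 'u) lmod_functor"
  assumes M: "additive_functor R M"
  shows "preserves_direct_limits R M \<longleftrightarrow>
    (\<forall>(I :: 'u set) r S f L l. small TYPE('u) I \<longrightarrow> lmod_limit R I r S f L l \<longrightarrow>
       functor_limit M I r S f L l)"
proof -
  have "preserves_direct_limits R M \<longleftrightarrow>
    (\<forall>(I :: 'u set) r S f L l. small TYPE('u) I \<longrightarrow> lmod_limit R I r S f L l \<longrightarrow>
      dl_map (\<lambda>i. fmor M (S i) L (l i)) \<in>
        iso (dl_group I r (\<lambda>i. fobj M (S i)) (\<lambda>i j. fmor M (S i) (S j) (f i j))) (fobj M L))"
    unfolding preserves_direct_limits_def lmod_limit_def by blast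
  then show ?thesis
    using dl_group_iso_iff[OF functor_group_cocone[OF M]] by blast
qed

section \<open>Change of index sets\<close>

text \<open>The index sets that arise in the proof are sets of pairs of finite sets. A small set of
  any type has a copy in the universe \<open>'u\<close>, and systems are pulled back to this copy.\<close>

definition pullback_rel :: "('j \<Rightarrow> 'i) \<Rightarrow> 'j set \<Rightarrow> 'i rel \<Rightarrow> 'j rel" where
  "pullback_rel \<rho> J r = {(a, b). a \<in> J \<and> b \<in> J \<and> (\<rho> a, \<rho> b) \<in> r}"

lemma directed_set_pullback:
  assumes "directed_set I r" and b: "bij_betw \<rho> J I"
  shows "directed_set J (pullback_rel \<rho> J r)"
proof -
  note rel = directed_set_rel[OF assms(1)]
  have I: "\<rho> ` J = I" and inj: "inj_on \<rho> J"
    using b by (auto simp: bij_betw_def)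
  have "antisym r"
    using assms(1) partial_order_onD(3) unfolding directed_set_def by blast
  then have "antisym (pullback_rel \<rho> J r)"
    using inj_onD[OF inj] unfolding pullback_rel_def antisym_def by auto
  moreover have "trans (pullback_rel \<rho> J r)"
    using rel(3) unfolding pullback_rel_def trans_def by blast
  moreover have "refl_on J (pullback_rel \<rho> J r)"
    using rel(2) I unfolding pullback_rel_def refl_on_def by blast
  moreover have "pullback_rel \<rho> J r \<subseteq> J \<times> J"
    unfolding pullback_rel_def by blast
  moreover have "J \<noteq> {}"
    using assms(1) I unfolding directed_set_def by blast
  moreover have "\<exists>k\<in>J. (i, k) \<in> pullback_rel \<rho> J r \<and> (j, k) \<in> pullback_rel \<rho> J r"
    if ij: "i \<in> J" "j \<in> J" for i j
  proof -
    obtain k where "k \<in> I" "(\<rho> i, k) \<in> r" "(\<rho> j, k) \<in> r"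
      using directed_set_upper[OF assms(1), of "\<rho> i" "\<rho> j"] ij I by blast
    then show ?thesis
      using I ij unfolding pullback_rel_def by auto
  qed
  ultimately show ?thesis
    unfolding directed_set_def partial_order_on_def preorder_on_def by blast
qed

lemma limit_cocone_pullback:
  assumes b: "bij_betw \<rho> J I"
  shows "limit_cocone J (pullback_rel \<rho> J r) (\<lambda>a. G (\<rho> a)) (\<lambda>a b. f (\<rho> a) (\<rho> b)) H (\<lambda>a. l (\<rho> a))
    \<longleftrightarrow> limit_cocone I r G f H l"
proof -
  have I: "I = \<rho> ` J"
    using b by (auto simp: bij_betw_def)
  show ?thesis
    unfolding limit_cocone_def I pullback_rel_def by simp
qed

lemma lmod_limit_pullback:
  assumes lim: "lmod_limit R I r S f L l" and b: "bij_betw \<rho> J I"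
  shows "lmod_limit R J (pullback_rel \<rho> J r) (\<lambda>a. S (\<rho> a)) (\<lambda>a b. f (\<rho> a) (\<rho> b)) L (\<lambda>a. l (\<rho> a))"
proof (rule lmod_limitI)
  note L = lmod_limitD[OF lim]
  note D = direct_system_lmodD[OF L(2)]
  have \<rho>: "\<rho> a \<in> I" if "a \<in> J" for a
    using b that by (auto simp: bij_betw_def)
  show "directed_set J (pullback_rel \<rho> J r)"
    using directed_set_pullback[OF L(1) b] .
  show "direct_system_lmod R J (pullback_rel \<rho> J r) (\<lambda>a. S (\<rho> a)) (\<lambda>a b. f (\<rho> a) (\<rho> b))"
    unfolding direct_system_lmod_def pullback_rel_def using D \<rho> by auto
  show "L \<in> lmod_ob R" by fact
  show "l (\<rho> a) \<in> lmod_mor R (S (\<rho> a)) L" if "a \<in> J" for a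
    using L(4) \<rho> that by blast
  show "l (\<rho> a) = compose (carrier (S (\<rho> a))) (l (\<rho> b)) (f (\<rho> a) (\<rho> b))"
    if "(a, b) \<in> pullback_rel \<rho> J r" for a b
    using L(5)[of "\<rho> a" "\<rho> b"] that unfolding pullback_rel_def by blast
  show "limit_cocone J (pullback_rel \<rho> J r) (\<lambda>a. add_monoid (S (\<rho> a))) (\<lambda>a b. f (\<rho> a) (\<rho> b))
     (add_monoid L) (\<lambda>a. l (\<rho> a))"
    using L(6) limit_cocone_pullback[OF b, of r "\<lambda>i. add_monoid (S i)" f "add_monoid L" l] by blast
qed

lemma small_copy:
  assumes "small TYPE('u) I"
  obtains J :: "'u set" and \<rho> where "small TYPE('u) J" "bij_betw \<rho> J I"
proof -
  obtain e :: "_ \<Rightarrow> 'u" where "inj_on e I"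
    using small_imp_embedding[OF assms] .
  then show ?thesis
    using that[OF small_image[OF assms] bij_betw_inv_into[OF inj_on_imp_bij_betw]] by blast
qed

lemma preserves_direct_limitsD:
  fixes M :: "('r, 'u) lmod_functor" and I :: "'i set"
  assumes M: "additive_functor R M" and p: "preserves_direct_limits R M"
    and I: "small TYPE('u) I" and lim: "lmod_limit R I r S f L l"
  shows "functor_limit M I r S f L l"
proof -
  obtain J :: "'u set" and \<rho> where J: "small TYPE('u) J" "bij_betw \<rho> J I"
    using small_copy[OF I] .
  have "functor_limit M J (pullback_rel \<rho> J r) (\<lambda>a. S (\<rho> a)) (\<lambda>a b. f (\<rho> a) (\<rho> b)) L (\<lambda>a. l (\<rho> a))"
    using p J(1) lmod_limit_pullback[OF lim J(2)] unfolding preserves_direct_limits_iff[OF M] by blast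
  then show ?thesis
    by (subst (asm) limit_cocone_pullback[OF J(2), where G = "\<lambda>i. fobj M (S i)"
          and f = "\<lambda>i j. fmor M (S i) (S j) (f i j)" and l = "\<lambda>i. fmor M (S i) L (l i)"])
qed

section \<open>Direct limits of functors\<close>

lemma nat_trans_ab_mor:
  "\<tau> \<in> nat_trans R F G \<Longrightarrow> S \<in> lmod_ob R \<Longrightarrow> \<tau> S \<in> ab_mor (fobj F S) (fobj G S)"
  unfolding nat_trans_def by blast

lemma nat_trans_hom:
  "\<tau> \<in> nat_trans R F G \<Longrightarrow> S \<in> lmod_ob R \<Longrightarrow> \<tau> S \<in> hom (fobj F S) (fobj G S)"
  using nat_trans_ab_mor unfolding ab_mor_def by blast

lemma nat_trans_closed:
  "\<tau> \<in> nat_trans R F G \<Longrightarrow> S \<in> lmod_ob R \<Longrightarrow> x \<in> carrier (fobj F S) \<Longrightarrow> \<tau> S x \<in> carrier (fobj G S)"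
  using nat_trans_hom by (metis hom_in_carrier)

lemma nat_trans_natural:
  assumes "\<tau> \<in> nat_trans R F G" "S \<in> lmod_ob R" "T \<in> lmod_ob R" "f \<in> lmod_mor R S T"
    and "x \<in> carrier (fobj F S)"
  shows "\<tau> T (fmor F S T f x) = fmor G S T f (\<tau> S x)"
proof -
  have "compose (carrier (fobj F S)) (\<tau> T) (fmor F S T f) =
        compose (carrier (fobj F S)) (fmor G S T f) (\<tau> S)"
    using assms(1-4) unfolding nat_trans_def by blast
  from fun_cong[OF this, of x] show ?thesis
    using assms(5) by (simp add: compose_def)
qed

lemma direct_system_functorD:
  assumes "direct_system_functor R I r F \<phi>"
  shows "\<And>i. i \<in> I \<Longrightarrow> additive_functor R (F i)"
    and "\<And>i j. (i, j) \<in> r \<Longrightarrow> \<phi> i j \<in> nat_trans R (F i) (F j)"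
    and "\<And>S i j k x. S \<in> lmod_ob R \<Longrightarrow> (i, j) \<in> r \<Longrightarrow> (j, k) \<in> r \<Longrightarrow>
      x \<in> carrier (fobj (F i) S) \<Longrightarrow> \<phi> i k S x = \<phi> j k S (\<phi> i j S x)"
proof -
  show "\<And>i. i \<in> I \<Longrightarrow> additive_functor R (F i)"
    and "\<And>i j. (i, j) \<in> r \<Longrightarrow> \<phi> i j \<in> nat_trans R (F i) (F j)"
    using assms unfolding direct_system_functor_def by auto
  show "\<phi> i k S x = \<phi> j k S (\<phi> i j S x)"
    if "S \<in> lmod_ob R" "(i, j) \<in> r" "(j, k) \<in> r" "x \<in> carrier (fobj (F i) S)" for S i j k x
  proof -
    have "\<phi> i k S = compose (carrier (fobj (F i) S)) (\<phi> j k S) (\<phi> i j S)"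
      using assms that(1-3) unfolding direct_system_functor_def by blast
    then show ?thesis using that(4) by (simp add: compose_def)
  qed
qed

lemma pointwise_group_cocone:
  assumes dir: "directed_set I r" and sys: "direct_system_functor R I r F \<phi>"
    and M: "additive_functor R M" and \<psi>: "\<And>i. i \<in> I \<Longrightarrow> \<psi> i \<in> nat_trans R (F i) M"
    and comp: "\<And>i j x. (i, j) \<in> r \<Longrightarrow> x \<in> carrier (fobj (F i) S) \<Longrightarrow> \<psi> i S x = \<psi> j S (\<phi> i j S x)"
    and S: "S \<in> lmod_ob R"
  shows "group_cocone I r (\<lambda>i. fobj (F i) S) (\<lambda>i j. \<phi> i j S) (fobj M S) (\<lambda>i. \<psi> i S)"
proof (rule group_cocone.intro)
  note D = direct_system_functorD[OF sys]
  show "group (fobj (F i) S)" if "i \<in> I" for i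
    using functor_group[OF D(1)[OF that] S] .
  show "group (fobj M S)" using functor_group[OF M S] .
  show "\<phi> i j S \<in> hom (fobj (F i) S) (fobj (F j) S)" if "(i, j) \<in> r" for i j
    using nat_trans_hom[OF D(2)[OF that] S] .
  show "\<phi> i k S x = \<phi> j k S (\<phi> i j S x)"
    if "(i, j) \<in> r" "(j, k) \<in> r" "x \<in> carrier (fobj (F i) S)" for i j k x
    using D(3)[OF S that] .
  show "\<psi> i S \<in> hom (fobj (F i) S) (fobj M S)" if "i \<in> I" for i
    using nat_trans_hom[OF \<psi>[OF that] S] .
  show "\<psi> j S (\<phi> i j S x) = \<psi> i S x" if "(i, j) \<in> r" "x \<in> carrier (fobj (F i) S)" for i j x
    using comp[OF that] by simp
qed (rule dir)

text \<open>Two direct limits commute: an element of \<open>M L\<close> comes from some \<open>F i L\<close>, hence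
  from some \<open>F i (S a)\<close>. An element that dies in \<open>M L\<close> dies in some \<open>F i L\<close>, and
  then in some \<open>F i (S b)\<close>.\<close>

lemma preserves_direct_limits_colimit:
  fixes M :: "('r, 'u) lmod_functor"
  assumes dir: "directed_set I r" and sys: "direct_system_functor R I r F \<phi>"
    and lim: "direct_limit_functor R I r F \<phi> M \<psi>"
    and pres: "\<And>i. i \<in> I \<Longrightarrow> preserves_direct_limits R (F i)"
  shows "preserves_direct_limits R M"
proof -
  note D = direct_system_functorD[OF sys]
  have M: "additive_functor R M" and \<psi>: "\<And>i. i \<in> I \<Longrightarrow> \<psi> i \<in> nat_trans R (F i) M"
    and comp: "\<And>S i j. S \<in> lmod_ob R \<Longrightarrow> (i, j) \<in> r \<Longrightarrow>
        \<psi> i S = compose (carrier (fobj (F i) S)) (\<psi> j S) (\<phi> i j S)"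
    and iso: "\<And>S. S \<in> lmod_ob R \<Longrightarrow> dl_map (\<lambda>i. \<psi> i S) \<in>
        iso (dl_group I r (\<lambda>i. fobj (F i) S) (\<lambda>i j. \<phi> i j S)) (fobj M S)"
    using lim unfolding direct_limit_functor_def by auto
  have comp': "\<psi> i S x = \<psi> j S (\<phi> i j S x)"
    if "S \<in> lmod_ob R" "(i, j) \<in> r" "x \<in> carrier (fobj (F i) S)" for S i j x
    using comp[OF that(1,2)] that(3) by (simp add: compose_def)
  have pt: "limit_cocone I r (\<lambda>i. fobj (F i) S) (\<lambda>i j. \<phi> i j S) (fobj M S) (\<lambda>i. \<psi> i S)"
    if "S \<in> lmod_ob R" for S
    using iso[OF that] dl_group_iso_iff[OF pointwise_group_cocone[OF dir sys M \<psi> comp' that]] that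
    by blast
  show ?thesis
    unfolding preserves_direct_limits_iff[OF M]
  proof (intro allI impI)
    fix J :: "'u set" and s and S :: "'u \<Rightarrow> ('r, 'u) module" and f L l
    assume J: "small TYPE('u) J" and SL: "lmod_limit R J s S f L l"
    note L = lmod_limitD[OF SL]
    note DS = direct_system_lmodD[OF L(2)]
    have Flim: "functor_limit (F i) J s S f L l" if "i \<in> I" for i
      using pres[OF that] J SL unfolding preserves_direct_limits_iff[OF D(1)[OF that]] by blast
    show "functor_limit M J s S f L l"
      unfolding limit_cocone_def
    proof (intro conjI ballI impI)
      fix y assume y: "y \<in> carrier (fobj M L)"
      obtain i z where z: "i \<in> I" "z \<in> carrier (fobj (F i) L)" "y = \<psi> i L z"
        using limit_cocone_surj[OF pt[OF L(3)] y] .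
      obtain a w where w: "a \<in> J" "w \<in> carrier (fobj (F i) (S a))" "z = fmor (F i) (S a) L (l a) w"
        using limit_cocone_surj[OF Flim[OF z(1)] z(2)] .
      have "y = fmor M (S a) L (l a) (\<psi> i (S a) w)"
        using nat_trans_natural[OF \<psi>[OF z(1)] DS(1)[OF w(1)] L(3) L(4)[OF w(1)] w(2)] z w by simp
      moreover have "\<psi> i (S a) w \<in> carrier (fobj M (S a))"
        using nat_trans_closed[OF \<psi>[OF z(1)] DS(1)[OF w(1)] w(2)] .
      ultimately show "\<exists>a\<in>J. \<exists>x\<in>carrier (fobj M (S a)). y = fmor M (S a) L (l a) x"
        using w(1) by blast
    next
      fix a x assume a: "a \<in> J" and x: "x \<in> carrier (fobj M (S a))"
        and dies: "fmor M (S a) L (l a) x = \<one>\<^bsub>fobj M L\<^esub>"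
      note Sa = DS(1)[OF a]
      obtain i w where w: "i \<in> I" "w \<in> carrier (fobj (F i) (S a))" "x = \<psi> i (S a) w"
        using limit_cocone_surj[OF pt[OF Sa] x] .
      let ?w = "fmor (F i) (S a) L (l a) w"
      have w': "?w \<in> carrier (fobj (F i) L)"
        using functor_closed[OF D(1)[OF w(1)] Sa L(3) L(4)[OF a] w(2)] .
      have "\<psi> i L ?w = \<one>\<^bsub>fobj M L\<^esub>"
        using nat_trans_natural[OF \<psi>[OF w(1)] Sa L(3) L(4)[OF a] w(2)] w dies by simp
      then obtain j where j: "j \<in> I" "(i, j) \<in> r" "\<phi> i j L ?w = \<one>\<^bsub>fobj (F j) L\<^esub>"
        using limit_cocone_kernel[OF pt[OF L(3)] w(1) w'] by blast
      let ?v = "\<phi> i j (S a) w"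
      have v: "?v \<in> carrier (fobj (F j) (S a))"
        using nat_trans_closed[OF D(2)[OF j(2)] Sa w(2)] .
      have "fmor (F j) (S a) L (l a) ?v = \<one>\<^bsub>fobj (F j) L\<^esub>"
        using nat_trans_natural[OF D(2)[OF j(2)] Sa L(3) L(4)[OF a] w(2)] j(3) by simp
      then obtain b where b: "b \<in> J" "(a, b) \<in> s"
        "fmor (F j) (S a) (S b) (f a b) ?v = \<one>\<^bsub>fobj (F j) (S b)\<^esub>"
        using limit_cocone_kernel[OF Flim[OF j(1)] a v] by blast
      note Sb = DS(1)[OF b(1)]
      have "\<psi> j (S a) ?v = x"
        using comp'[OF Sa j(2) w(2)] w(3) by simp
      then have "fmor M (S a) (S b) (f a b) x = \<psi> j (S b) \<one>\<^bsub>fobj (F j) (S b)\<^esub>"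
        using nat_trans_natural[OF \<psi>[OF j(1)] Sa Sb DS(2)[OF b(2)] v] b(3) by simp
      also have "\<dots> = \<one>\<^bsub>fobj M (S b)\<^esub>"
        using hom_one[OF nat_trans_hom[OF \<psi>[OF j(1)] Sb] functor_group[OF D(1)[OF j(1)] Sb]
            functor_group[OF M Sb]] .
      finally show "\<exists>b\<in>J. (a, b) \<in> s \<and> fmor M (S a) (S b) (f a b) x = \<one>\<^bsub>fobj M (S b)\<^esub>"
        using b by blast
    qed
  qed
qed

lemma is_direct_limit_of_FPI:
  fixes M :: "('r, 'u) lmod_functor" and I :: "'i set"
  assumes I: "small TYPE('u) I" and dir: "directed_set I r"
    and sys: "direct_system_functor R I r F \<phi>"
    and FP: "\<And>i. i \<in> I \<Longrightarrow> FP_module R (F i)"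
    and M: "additive_functor R M" and \<psi>: "\<And>i. i \<in> I \<Longrightarrow> \<psi> i \<in> nat_trans R (F i) M"
    and comp: "\<And>S i j. S \<in> lmod_ob R \<Longrightarrow> (i, j) \<in> r \<Longrightarrow>
        \<psi> i S = compose (carrier (fobj (F i) S)) (\<psi> j S) (\<phi> i j S)"
    and lim: "\<And>S. S \<in> lmod_ob R \<Longrightarrow>
      limit_cocone I r (\<lambda>i. fobj (F i) S) (\<lambda>i j. \<phi> i j S) (fobj M S) (\<lambda>i. \<psi> i S)"
  shows "is_direct_limit_of_FP R M"
proof -
  obtain J :: "'u set" and \<rho> where J: "small TYPE('u) J" "bij_betw \<rho> J I"
    using small_copy[OF I] .
  have \<rho>: "\<rho> a \<in> I" if "a \<in> J" for a
    using J(2) that by (auto simp: bij_betw_def)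
  let ?r = "pullback_rel \<rho> J r"
  have rD: "(\<rho> a, \<rho> b) \<in> r" if "(a, b) \<in> ?r" for a b
    using that unfolding pullback_rel_def by blast
  have dirJ: "directed_set J ?r"
    using directed_set_pullback[OF dir J(2)] .
  have sysJ: "direct_system_functor R J ?r (\<lambda>a. F (\<rho> a)) (\<lambda>a b. \<phi> (\<rho> a) (\<rho> b))"
    unfolding direct_system_functor_def
  proof (intro conjI ballI allI impI)
    show "additive_functor R (F (\<rho> a))" if "a \<in> J" for a
      using sys \<rho>[OF that] unfolding direct_system_functor_def by blast
    show "case p of (a, b) \<Rightarrow> \<phi> (\<rho> a) (\<rho> b) \<in> nat_trans R (F (\<rho> a)) (F (\<rho> b))"
      if "p \<in> ?r" for p
      using sys rD that unfolding direct_system_functor_def by (cases p) blast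
    show "\<phi> (\<rho> a) (\<rho> a) S = (\<lambda>x\<in>carrier (fobj (F (\<rho> a)) S). x)" if "S \<in> lmod_ob R" "a \<in> J" for S a
      using sys \<rho>[OF that(2)] that(1) unfolding direct_system_functor_def by blast
    show "\<phi> (\<rho> a) (\<rho> c) S = compose (carrier (fobj (F (\<rho> a)) S)) (\<phi> (\<rho> b) (\<rho> c) S) (\<phi> (\<rho> a) (\<rho> b) S)"
      if "S \<in> lmod_ob R" "(a, b) \<in> ?r" "(b, c) \<in> ?r" for S a b c
      using sys rD[OF that(2)] rD[OF that(3)] that(1) unfolding direct_system_functor_def by blast
  qed
  have "direct_limit_functor R J ?r (\<lambda>a. F (\<rho> a)) (\<lambda>a b. \<phi> (\<rho> a) (\<rho> b)) M (\<lambda>a. \<psi> (\<rho> a))"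
    unfolding direct_limit_functor_def
  proof (intro conjI ballI)
    show "additive_functor R M" by fact
    show "\<psi> (\<rho> a) \<in> nat_trans R (F (\<rho> a)) M" if "a \<in> J" for a
      using \<psi>[OF \<rho>[OF that]] .
    show "case p of (a, b) \<Rightarrow> \<psi> (\<rho> a) S = compose (carrier (fobj (F (\<rho> a)) S)) (\<psi> (\<rho> b) S) (\<phi> (\<rho> a) (\<rho> b) S)"
      if "S \<in> lmod_ob R" "p \<in> ?r" for S p
      using comp[OF that(1)] rD that(2) by (cases p) blast
    fix S :: "('r, 'u) module" assume S: "S \<in> lmod_ob R"
    have "\<psi> (\<rho> a) S x = \<psi> (\<rho> b) S (\<phi> (\<rho> a) (\<rho> b) S x)"
      if "(a, b) \<in> ?r" "x \<in> carrier (fobj (F (\<rho> a)) S)" for a b x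
      using comp[OF S rD[OF that(1)]] that(2) by (simp add: compose_def)
    then have "group_cocone J ?r (\<lambda>a. fobj (F (\<rho> a)) S) (\<lambda>a b. \<phi> (\<rho> a) (\<rho> b) S) (fobj M S) (\<lambda>a. \<psi> (\<rho> a) S)"
      using pointwise_group_cocone[OF dirJ sysJ M \<psi>[OF \<rho>] _ S] by blast
    moreover have "limit_cocone J ?r (\<lambda>a. fobj (F (\<rho> a)) S) (\<lambda>a b. \<phi> (\<rho> a) (\<rho> b) S) (fobj M S) (\<lambda>a. \<psi> (\<rho> a) S)"
      using lim[OF S] limit_cocone_pullback[OF J(2), where G = "\<lambda>i. fobj (F i) S"
          and f = "\<lambda>i j. \<phi> i j S" and l = "\<lambda>i. \<psi> i S"] by blast
    ultimately show "dl_map (\<lambda>a. \<psi> (\<rho> a) S) \<in>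
        iso (dl_group J ?r (\<lambda>a. fobj (F (\<rho> a)) S) (\<lambda>a b. \<phi> (\<rho> a) (\<rho> b) S)) (fobj M S)"
      using dl_group_iso_iff by blast
  qed
  then show ?thesis
    unfolding is_direct_limit_of_FP_def using J(1) dirJ sysJ FP \<rho> by blast
qed

section \<open>Linear combinations\<close>

lemma (in left_module) smult_r_zero:
  assumes "a \<in> carrier R"
  shows "a \<odot>\<^bsub>M\<^esub> \<zero>\<^bsub>M\<^esub> = \<zero>\<^bsub>M\<^esub>"
proof -
  have c: "a \<odot>\<^bsub>M\<^esub> \<zero>\<^bsub>M\<^esub> \<in> carrier M"
    using assms smult_closed by blast
  have "a \<odot>\<^bsub>M\<^esub> \<zero>\<^bsub>M\<^esub> \<oplus>\<^bsub>M\<^esub> a \<odot>\<^bsub>M\<^esub> \<zero>\<^bsub>M\<^esub> = a \<odot>\<^bsub>M\<^esub> (\<zero>\<^bsub>M\<^esub> \<oplus>\<^bsub>M\<^esub> \<zero>\<^bsub>M\<^esub>)"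
    using smult_r_distr[OF assms M.zero_closed M.zero_closed] by simp
  also have "\<dots> = a \<odot>\<^bsub>M\<^esub> \<zero>\<^bsub>M\<^esub> \<oplus>\<^bsub>M\<^esub> \<zero>\<^bsub>M\<^esub>"
    using c by simp
  finally show ?thesis
    using c M.add.l_cancel_one[OF c c] by simp
qed

lemma (in left_module) smult_l_zero:
  assumes "x \<in> carrier M"
  shows "\<zero>\<^bsub>R\<^esub> \<odot>\<^bsub>M\<^esub> x = \<zero>\<^bsub>M\<^esub>"
proof -
  have c: "\<zero>\<^bsub>R\<^esub> \<odot>\<^bsub>M\<^esub> x \<in> carrier M"
    using assms smult_closed by blast
  have "\<zero>\<^bsub>R\<^esub> \<odot>\<^bsub>M\<^esub> x \<oplus>\<^bsub>M\<^esub> \<zero>\<^bsub>R\<^esub> \<odot>\<^bsub>M\<^esub> x = (\<zero>\<^bsub>R\<^esub> \<oplus>\<^bsub>R\<^esub> \<zero>\<^bsub>R\<^esub>) \<odot>\<^bsub>M\<^esub> x"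
    using smult_l_distr[OF R.zero_closed R.zero_closed assms] by simp
  also have "\<dots> = \<zero>\<^bsub>R\<^esub> \<odot>\<^bsub>M\<^esub> x \<oplus>\<^bsub>M\<^esub> \<zero>\<^bsub>M\<^esub>"
    using c by simp
  finally show ?thesis
    using c M.add.l_cancel_one[OF c c] by simp
qed

definition lincomb :: "('r, 'a, 'm) module_scheme \<Rightarrow> 'k set \<Rightarrow> ('k \<Rightarrow> 'r) \<Rightarrow> ('k \<Rightarrow> 'a) \<Rightarrow> 'a" where
  "lincomb S A v x = finsum S (\<lambda>k. v k \<odot>\<^bsub>S\<^esub> x k) A"

text \<open>Vectors vanish off the index set, so that a vector for \<open>A\<close> is one for every larger
  index set.\<close>

definition vectors :: "('r, 's) ring_scheme \<Rightarrow> 'k set \<Rightarrow> ('k \<Rightarrow> 'r) set" where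
  "vectors R A = {v. (\<forall>k\<in>A. v k \<in> carrier R) \<and> (\<forall>k. k \<notin> A \<longrightarrow> v k = \<zero>\<^bsub>R\<^esub>)}"

lemma vectors_mono: "ring R \<Longrightarrow> A \<subseteq> A' \<Longrightarrow> vectors R A \<subseteq> vectors R A'"
  using ring.ring_simprules(2)[of R] unfolding vectors_def by fastforce

lemma vectors_carrier:
  assumes "ring R" "v \<in> vectors R A"
  shows "v k \<in> carrier R"
  using assms ring.ring_simprules(2)[of R] unfolding vectors_def by (cases "k \<in> A") auto

context left_module
begin

lemma lincomb_closed:
  assumes "\<And>k. k \<in> A \<Longrightarrow> v k \<in> carrier R" "\<And>k. k \<in> A \<Longrightarrow> x k \<in> carrier M"
  shows "lincomb M A v x \<in> carrier M"
  unfolding lincomb_def using assms smult_closed by (intro M.finsum_closed) auto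

lemma lincomb_add:
  assumes "\<And>k. k \<in> A \<Longrightarrow> v k \<in> carrier R" "\<And>k. k \<in> A \<Longrightarrow> w k \<in> carrier R"
    and "\<And>k. k \<in> A \<Longrightarrow> x k \<in> carrier M"
  shows "lincomb M A (\<lambda>k. v k \<oplus>\<^bsub>R\<^esub> w k) x = lincomb M A v x \<oplus>\<^bsub>M\<^esub> lincomb M A w x"
proof -
  have "lincomb M A (\<lambda>k. v k \<oplus>\<^bsub>R\<^esub> w k) x = finsum M (\<lambda>k. v k \<odot>\<^bsub>M\<^esub> x k \<oplus>\<^bsub>M\<^esub> w k \<odot>\<^bsub>M\<^esub> x k) A"
    unfolding lincomb_def using assms smult_closed
    by (intro M.finsum_cong') (auto simp: smult_l_distr)
  also have "\<dots> = lincomb M A v x \<oplus>\<^bsub>M\<^esub> lincomb M A w x"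
    unfolding lincomb_def using assms smult_closed by (intro M.finsum_addf) auto
  finally show ?thesis .
qed

lemma lincomb_smult:
  assumes "finite A" "a \<in> carrier R"
    and "\<And>k. k \<in> A \<Longrightarrow> v k \<in> carrier R" "\<And>k. k \<in> A \<Longrightarrow> x k \<in> carrier M"
  shows "lincomb M A (\<lambda>k. a \<otimes>\<^bsub>R\<^esub> v k) x = a \<odot>\<^bsub>M\<^esub> lincomb M A v x"
  using assms(1,3,4)
proof (induction A)
  case empty
  show ?case by (simp add: lincomb_def smult_r_zero assms(2))
next
  case (insert k A)
  have "(a \<otimes>\<^bsub>R\<^esub> v k) \<odot>\<^bsub>M\<^esub> x k = a \<odot>\<^bsub>M\<^esub> (v k \<odot>\<^bsub>M\<^esub> x k)"
    using insert assms(2) by (simp add: smult_assoc)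
  moreover have "lincomb M A v x \<in> carrier M"
    using insert by (intro lincomb_closed) auto
  ultimately show ?case
    using insert assms(2) smult_closed
    by (simp add: lincomb_def smult_r_distr Pi_def)
qed

lemma lincomb_superset:
  assumes "finite A'" "A \<subseteq> A'" "\<And>k. k \<in> A' \<Longrightarrow> v k \<in> carrier R" "\<And>k. k \<in> A' - A \<Longrightarrow> v k = \<zero>\<^bsub>R\<^esub>"
    and "\<And>k. k \<in> A' \<Longrightarrow> x k \<in> carrier M"
  shows "lincomb M A' v x = lincomb M A v x"
  unfolding lincomb_def
  using assms smult_closed smult_l_zero
  by (intro M.add.finprod_mono_neutral_cong_right) auto

lemma lincomb_unit:
  assumes "finite A" "k \<in> A" "\<And>k. k \<in> A \<Longrightarrow> x k \<in> carrier M"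
  shows "lincomb M A (\<lambda>j. if j = k then \<one>\<^bsub>R\<^esub> else \<zero>\<^bsub>R\<^esub>) x = x k"
proof -
  have "lincomb M A (\<lambda>j. if j = k then \<one>\<^bsub>R\<^esub> else \<zero>\<^bsub>R\<^esub>) x =
      lincomb M {k} (\<lambda>j. if j = k then \<one>\<^bsub>R\<^esub> else \<zero>\<^bsub>R\<^esub>) x"
    using assms by (intro lincomb_superset) auto
  then show ?thesis
    using assms smult_one by (simp add: lincomb_def)
qed

lemma lincomb_cong:
  assumes "\<And>k. k \<in> A \<Longrightarrow> v k = w k" "\<And>k. k \<in> A \<Longrightarrow> x k = y k"
    and "\<And>k. k \<in> A \<Longrightarrow> w k \<in> carrier R" "\<And>k. k \<in> A \<Longrightarrow> y k \<in> carrier M"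
  shows "lincomb M A v x = lincomb M A w y"
  unfolding lincomb_def using assms smult_closed by (intro M.finsum_cong') auto

lemma lincomb_reindex:
  assumes "bij_betw \<sigma> N A" "\<And>k. k \<in> A \<Longrightarrow> v k \<in> carrier R" "\<And>k. k \<in> A \<Longrightarrow> x k \<in> carrier M"
  shows "lincomb M A v x = lincomb M N (\<lambda>n. v (\<sigma> n)) (\<lambda>n. x (\<sigma> n))"
proof -
  have "A = \<sigma> ` N" "inj_on \<sigma> N"
    using assms(1) by (auto simp: bij_betw_def)
  then show ?thesis
    unfolding lincomb_def using assms(2,3) smult_closed
    by (simp add: M.finsum_reindex Pi_def)
qed

end

lemma lincomb_mor:
  assumes f: "f \<in> lmod_mor R S T" and S: "S \<in> lmod_ob R" and T: "T \<in> lmod_ob R"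
    and "finite A" "\<And>k. k \<in> A \<Longrightarrow> v k \<in> carrier R" "\<And>k. k \<in> A \<Longrightarrow> x k \<in> carrier S"
  shows "f (lincomb S A v x) = lincomb T A v (\<lambda>k. f (x k))"
  using assms(4-)
proof (induction A)
  interpret S: left_module R S using S by (rule lmod_ob_left_module)
  interpret T: left_module R T using T by (rule lmod_ob_left_module)
  case empty
  show ?case by (simp add: lincomb_def lmod_mor_zero[OF f S T])
next
  interpret S: left_module R S using S by (rule lmod_ob_left_module)
  interpret T: left_module R T using T by (rule lmod_ob_left_module)
  case (insert k A)
  have "lincomb S A v x \<in> carrier S"
    using insert by (intro S.lincomb_closed) auto
  then show ?case
    using insert S.smult_closed T.smult_closed f
    by (simp add: lincomb_def Pi_def lmod_mor_add[OF f] lmod_mor_smult[OF f] lmod_mor_closed[OF f])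
qed

section \<open>Finitely presented modules\<close>

text \<open>The last conjunct is one half of the universal property of the module with generators
  \<open>e k\<close> for \<open>k \<in> A\<close> and relation vectors \<open>B\<close>. Uniqueness of the morphism holds
  because the generators span.\<close>

definition presents ::
    "('r, 's) ring_scheme \<Rightarrow> ('r, 'u) module \<Rightarrow> ('k \<Rightarrow> 'u) \<Rightarrow> 'k set \<Rightarrow> ('k \<Rightarrow> 'r) set \<Rightarrow> bool" where
  "presents R S e A B \<longleftrightarrow> S \<in> lmod_ob R \<and> (\<forall>k\<in>A. e k \<in> carrier S) \<and>
     (\<forall>s\<in>carrier S. \<exists>v\<in>vectors R A. s = lincomb S A v e) \<and>
     (\<forall>v\<in>B. lincomb S A v e = \<zero>\<^bsub>S\<^esub>) \<and>
     (\<forall>X\<in>lmod_ob R. \<forall>x. (\<forall>k\<in>A. x k \<in> carrier X) \<longrightarrow> (\<forall>v\<in>B. lincomb X A v x = \<zero>\<^bsub>X\<^esub>) \<longrightarrow>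
        (\<exists>h\<in>lmod_mor R S X. \<forall>k\<in>A. h (e k) = x k))"

lemma small_vectors:
  assumes u: "universe_type TYPE('u)" and "finite A" "small TYPE('u) (carrier R)"
  shows "small TYPE('u) (vectors R A)"
proof (rule small_inj_into)
  show "inj_on (\<lambda>v. restrict v A) (vectors R A)"
  proof (rule inj_onI)
    fix v w assume vw: "v \<in> vectors R A" "w \<in> vectors R A" and eq: "restrict v A = restrict w A"
    show "v = w"
    proof
      fix k show "v k = w k"
        using vw fun_cong[OF eq, of k] unfolding vectors_def by (cases "k \<in> A") auto
    qed
  qed
  show "(\<lambda>v. restrict v A) ` vectors R A \<subseteq> (\<Pi>\<^sub>E k\<in>A. carrier R)"
    unfolding vectors_def by auto
  show "small TYPE('u) (\<Pi>\<^sub>E k\<in>A. carrier R)"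
    using assms by (intro small_finite_PiE[OF u])
qed

text \<open>The module is \<open>R\<^sup>A\<close> modulo those vectors that vanish on every solution of \<open>B\<close>
  in every module. This is the submodule spanned by \<open>B\<close>, in a form that yields the universal
  property at once.\<close>

lemma presentation_exists:
  fixes R :: "('r, 's) ring_scheme" and A :: "'k set"
  assumes u: "universe_type TYPE('u)" and R: "ring R" and smallR: "small TYPE('u) (carrier R)"
    and A: "finite A" and B: "B \<subseteq> vectors R A"
  shows "\<exists>(S :: ('r, 'u) module) e. presents R S e A B"
proof -
  interpret R: ring R by (rule R)
  define E :: "('k \<Rightarrow> 'r) monoid" where "E = \<lparr>carrier = vectors R A, mult = (\<lambda>v w k. v k \<oplus>\<^bsub>R\<^esub> w k), one = (\<lambda>k. \<zero>\<^bsub>R\<^esub>)\<rparr>"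
  note vc = vectors_carrier[OF R]
  have Esimps [simp]: "carrier E = vectors R A" "\<one>\<^bsub>E\<^esub> = (\<lambda>k. \<zero>\<^bsub>R\<^esub>)"
    "v \<otimes>\<^bsub>E\<^esub> w = (\<lambda>k. v k \<oplus>\<^bsub>R\<^esub> w k)" for v w
    by (simp_all add: E_def)
  have addE: "(\<lambda>k. v k \<oplus>\<^bsub>R\<^esub> w k) \<in> vectors R A" if "v \<in> vectors R A" "w \<in> vectors R A" for v w
    using that by (auto simp: vectors_def)
  have smE: "(\<lambda>k. a \<otimes>\<^bsub>R\<^esub> v k) \<in> vectors R A" if "a \<in> carrier R" "v \<in> vectors R A" for a v
    using that by (auto simp: vectors_def)
  have negE: "(\<lambda>k. \<ominus>\<^bsub>R\<^esub> v k) \<in> vectors R A" if "v \<in> vectors R A" for v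
    using that by (auto simp: vectors_def)
  have E: "comm_group E"
  proof (rule comm_groupI)
    fix v assume v: "v \<in> carrier E"
    then show "\<exists>w\<in>carrier E. w \<otimes>\<^bsub>E\<^esub> v = \<one>\<^bsub>E\<^esub>"
      using negE[of v] vc[of v A] by (intro bexI[of _ "\<lambda>k. \<ominus>\<^bsub>R\<^esub> v k"]) (auto simp: R.l_neg)
  next
    show "\<one>\<^bsub>E\<^esub> \<in> carrier E" by (simp add: vectors_def)
  qed (auto simp: addE vc R.a_ac)
  interpret E: comm_group E by (rule E)
  define sol where "sol X x \<longleftrightarrow> (\<forall>k\<in>A. x k \<in> carrier X) \<and> (\<forall>w\<in>B. lincomb X A w x = \<zero>\<^bsub>X\<^esub>)"
    for X :: "('r, 'u) module" and x
  define D where "D = {v \<in> vectors R A. \<forall>X\<in>lmod_ob R. \<forall>x. sol X x \<longrightarrow> lincomb X A v x = \<zero>\<^bsub>(X :: ('r, 'u) module)\<^esub>}"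
  have linhom: "(\<lambda>v. lincomb X A v x) \<in> hom E (add_monoid X)"
    if X: "X \<in> lmod_ob R" and x: "\<And>k. k \<in> A \<Longrightarrow> x k \<in> carrier X" for X :: "('r, 'u) module" and x
  proof -
    interpret X: left_module R X using X by (rule lmod_ob_left_module)
    show ?thesis
      using x by (intro homI) (auto simp: X.lincomb_closed X.lincomb_add vc)
  qed
  have D: "subgroup D E"
  proof -
    let ?Ker = "\<lambda>X x. {v \<in> carrier E. lincomb X A v x = \<zero>\<^bsub>(X :: ('r, 'u) module)\<^esub>}"
    have "subgroup (?Ker X x) E" if X: "X \<in> lmod_ob R" and x: "sol X x" for X x
    proof -
      interpret X: abelian_group X using X by (rule lmod_ob_abelian)
      interpret g: group_hom E "add_monoid X" "\<lambda>v. lincomb X A v x"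
        using linhom[OF X] x E.is_group X.a_group
        by (auto simp: group_hom_def group_hom_axioms_def sol_def)
      show ?thesis using g.subgroup_kernel by (simp add: kernel_def)
    qed
    then have "subgroup (\<Inter> (insert (carrier E) {?Ker X x |X x. X \<in> lmod_ob R \<and> sol X x})) E"
      using E.subgroup_self by (intro E.subgroups_Inter) auto
    moreover have "\<Inter> (insert (carrier E) {?Ker X x |X x. X \<in> lmod_ob R \<and> sol X x}) = D"
      by (auto simp: D_def)
    ultimately show ?thesis by simp
  qed
  have smD: "(\<lambda>k. a \<otimes>\<^bsub>R\<^esub> v k) \<in> D" if a: "a \<in> carrier R" and v: "v \<in> D" for a v
  proof -
    have "lincomb X A (\<lambda>k. a \<otimes>\<^bsub>R\<^esub> v k) x = \<zero>\<^bsub>X\<^esub>" if X: "X \<in> lmod_ob R" "sol X x" for X x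
    proof -
      interpret X: left_module R X using X(1) by (rule lmod_ob_left_module)
      have "lincomb X A (\<lambda>k. a \<otimes>\<^bsub>R\<^esub> v k) x = a \<odot>\<^bsub>X\<^esub> lincomb X A v x"
        using X v vc[of v A] unfolding sol_def D_def by (intro X.lincomb_smult[OF A a]) auto
      then show ?thesis using X v X.smult_r_zero[OF a] by (simp add: D_def)
    qed
    then show ?thesis using v smE[OF a] by (auto simp: D_def)
  qed
  have "small TYPE('u) (carrier E)"
    using small_vectors[OF u A smallR] by simp
  then obtain H :: "'u monoid" and q where H: "H \<in> ab_ob" and q: "quotient_map E D q H"
    using small_quotient_exists[OF E D] by blast
  interpret H: comm_group H using H by (simp add: ab_ob_def)
  have qhom: "q \<in> hom E H" using q by (simp add: quotient_map_def)
  have qc: "q v \<in> carrier H" if "v \<in> vectors R A" for v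
    using hom_in_carrier[OF qhom] that by simp
  have qadd: "q (\<lambda>k. v k \<oplus>\<^bsub>R\<^esub> w k) = q v \<otimes>\<^bsub>H\<^esub> q w" if "v \<in> vectors R A" "w \<in> vectors R A" for v w
    using hom_mult[OF qhom, of v w] that by simp
  have q1: "q (\<lambda>k. \<zero>\<^bsub>R\<^esub>) = \<one>\<^bsub>H\<^esub>"
    using hom_one[OF qhom E.is_group H.is_group] by simp
  define sm where "sm a = factor_map E q H (\<lambda>v. q (\<lambda>k. a \<otimes>\<^bsub>R\<^esub> v k))" for a
  have smhom: "(\<lambda>v. q (\<lambda>k. a \<otimes>\<^bsub>R\<^esub> v k)) \<in> hom E H" if a: "a \<in> carrier R" for a
  proof (rule homI)
    show "q (\<lambda>k. a \<otimes>\<^bsub>R\<^esub> v k) \<in> carrier H" if "v \<in> carrier E" for v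
      using qc smE[OF a] that by simp
    fix v w assume vw: "v \<in> carrier E" "w \<in> carrier E"
    have "(\<lambda>k. a \<otimes>\<^bsub>R\<^esub> (v \<otimes>\<^bsub>E\<^esub> w) k) = (\<lambda>k. a \<otimes>\<^bsub>R\<^esub> v k \<oplus>\<^bsub>R\<^esub> a \<otimes>\<^bsub>R\<^esub> w k)"
      using vw vc[of v A] vc[of w A] a by (auto simp: R.r_distr)
    then show "q (\<lambda>k. a \<otimes>\<^bsub>R\<^esub> (v \<otimes>\<^bsub>E\<^esub> w) k) = q (\<lambda>k. a \<otimes>\<^bsub>R\<^esub> v k) \<otimes>\<^bsub>H\<^esub> q (\<lambda>k. a \<otimes>\<^bsub>R\<^esub> w k)"
      using qadd smE[OF a] vw by simp
  qed
  have sm: "sm a (q v) = q (\<lambda>k. a \<otimes>\<^bsub>R\<^esub> v k)" if a: "a \<in> carrier R" and v: "v \<in> vectors R A" for a v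
    unfolding sm_def
  proof (rule factor_map_apply[OF q H.is_group smhom[OF a]])
    show "q (\<lambda>k. a \<otimes>\<^bsub>R\<^esub> w k) = \<one>\<^bsub>H\<^esub>" if "w \<in> carrier E" "w \<in> D" for w
      using q smD[OF a that(2)] smE[OF a] that unfolding quotient_map_def by simp
  qed (use v in simp)
  define S :: "('r, 'u) module" where
    "S = \<lparr>carrier = carrier H, mult = undefined, one = undefined, zero = \<one>\<^bsub>H\<^esub>, add = mult H, smult = sm\<rparr>"
  have Ssimps: "carrier S = carrier H" "\<zero>\<^bsub>S\<^esub> = \<one>\<^bsub>H\<^esub>" "x \<oplus>\<^bsub>S\<^esub> y = x \<otimes>\<^bsub>H\<^esub> y" "a \<odot>\<^bsub>S\<^esub> x = sm a x" for a x y
    by (simp_all add: S_def)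
  have lift: "\<exists>v\<in>vectors R A. x = q v" if "x \<in> carrier S" for x
    using that q by (auto simp: Ssimps quotient_map_def)
  have "left_module R S"
  proof (intro left_module.intro left_module_axioms.intro)
    show "ring R" by (rule R)
    show "abelian_group S"
    proof (rule abelian_groupI)
      fix x assume "x \<in> carrier S"
      then show "\<exists>y\<in>carrier S. y \<oplus>\<^bsub>S\<^esub> x = \<zero>\<^bsub>S\<^esub>"
        using H.l_inv H.inv_closed unfolding Ssimps by blast
    qed (auto simp: Ssimps H.m_ac)
    fix a x assume a: "a \<in> carrier R" and x: "x \<in> carrier S"
    obtain v where v: "v \<in> vectors R A" "x = q v" using lift[OF x] by blast
    show "a \<odot>\<^bsub>S\<^esub> x \<in> carrier S"
      using a v by (simp add: Ssimps sm qc smE)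
    fix b assume b: "b \<in> carrier R"
    have eq: "(\<lambda>k. (a \<oplus>\<^bsub>R\<^esub> b) \<otimes>\<^bsub>R\<^esub> v k) = (\<lambda>k. a \<otimes>\<^bsub>R\<^esub> v k \<oplus>\<^bsub>R\<^esub> b \<otimes>\<^bsub>R\<^esub> v k)"
      "(\<lambda>k. (a \<otimes>\<^bsub>R\<^esub> b) \<otimes>\<^bsub>R\<^esub> v k) = (\<lambda>k. a \<otimes>\<^bsub>R\<^esub> (b \<otimes>\<^bsub>R\<^esub> v k))"
      using a b vc[OF v(1)] by (auto simp: R.l_distr R.m_assoc)
    show "(a \<oplus>\<^bsub>R\<^esub> b) \<odot>\<^bsub>S\<^esub> x = a \<odot>\<^bsub>S\<^esub> x \<oplus>\<^bsub>S\<^esub> b \<odot>\<^bsub>S\<^esub> x"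
      using a b v by (simp add: Ssimps sm eq qadd smE)
    show "(a \<otimes>\<^bsub>R\<^esub> b) \<odot>\<^bsub>S\<^esub> x = a \<odot>\<^bsub>S\<^esub> (b \<odot>\<^bsub>S\<^esub> x)"
      using a b v by (simp add: Ssimps sm eq smE)
  next
    fix a x y assume a: "a \<in> carrier R" and x: "x \<in> carrier S" and y: "y \<in> carrier S"
    obtain v where v: "v \<in> vectors R A" "x = q v" using lift[OF x] by blast
    obtain w where w: "w \<in> vectors R A" "y = q w" using lift[OF y] by blast
    show "a \<odot>\<^bsub>S\<^esub> (x \<oplus>\<^bsub>S\<^esub> y) = a \<odot>\<^bsub>S\<^esub> x \<oplus>\<^bsub>S\<^esub> a \<odot>\<^bsub>S\<^esub> y"
      using hom_mult[OF smhom[OF a], of v w] sm[OF a addE[OF v(1) w(1)]] v w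
      by (simp add: Ssimps sm a qadd[symmetric] addE smE)
  next
    fix x assume x: "x \<in> carrier S"
    obtain v where v: "v \<in> vectors R A" "x = q v" using lift[OF x] by blast
    then show "\<one>\<^bsub>R\<^esub> \<odot>\<^bsub>S\<^esub> x = x"
      using vc[OF v(1)] by (simp add: Ssimps sm)
  qed
  then interpret S: left_module R S .
  have S: "S \<in> lmod_ob R"
    using H S.left_module_axioms by (simp add: lmod_ob_def ab_ob_def Ssimps)
  define \<delta> where "\<delta> k = (\<lambda>j. if j = k then \<one>\<^bsub>R\<^esub> else \<zero>\<^bsub>R\<^esub>)" for k :: 'k
  have \<delta>: "\<delta> k \<in> vectors R A" if "k \<in> A" for k
    using that by (auto simp: \<delta>_def vectors_def)
  define e where "e k = q (\<delta> k)" for k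
  have e: "e k \<in> carrier S" if "k \<in> A" for k
    using qc[OF \<delta>[OF that]] by (simp add: e_def Ssimps)
  \<comment> \<open>Induction on the support shows that \<open>q v\<close> is the combination of the \<open>e k\<close> with
    coefficients \<open>v\<close>.\<close>
  have partial: "lincomb S C v e = q (\<lambda>k. if k \<in> C then v k else \<zero>\<^bsub>R\<^esub>)"
    if v: "v \<in> vectors R A" and "finite C" "C \<subseteq> A" for v C
    using that(2,3)
  proof (induction C)
    case empty
    show ?case by (simp add: lincomb_def Ssimps q1)
  next
    case (insert k C)
    have vk: "v k \<in> carrier R" and k: "k \<in> A" using vc[OF v] insert by auto
    have vC: "(\<lambda>j. if j \<in> C then v j else \<zero>\<^bsub>R\<^esub>) \<in> vectors R A"
      using v insert by (auto simp: vectors_def)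
    have "lincomb S (insert k C) v e = v k \<odot>\<^bsub>S\<^esub> e k \<oplus>\<^bsub>S\<^esub> lincomb S C v e"
      unfolding lincomb_def using insert e vc[OF v] S.smult_closed
      by (intro S.M.finsum_insert) auto
    also have "v k \<odot>\<^bsub>S\<^esub> e k = q (\<lambda>j. v k \<otimes>\<^bsub>R\<^esub> \<delta> k j)"
      by (simp add: Ssimps e_def sm vk \<delta> k)
    also have "lincomb S C v e = q (\<lambda>j. if j \<in> C then v j else \<zero>\<^bsub>R\<^esub>)"
      using insert by simp
    also have "q (\<lambda>j. v k \<otimes>\<^bsub>R\<^esub> \<delta> k j) \<oplus>\<^bsub>S\<^esub> q (\<lambda>j. if j \<in> C then v j else \<zero>\<^bsub>R\<^esub>) =
      q (\<lambda>j. v k \<otimes>\<^bsub>R\<^esub> \<delta> k j \<oplus>\<^bsub>R\<^esub> (if j \<in> C then v j else \<zero>\<^bsub>R\<^esub>))"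
      by (simp add: Ssimps qadd vC smE vk \<delta> k)
    also have "(\<lambda>j. v k \<otimes>\<^bsub>R\<^esub> \<delta> k j \<oplus>\<^bsub>R\<^esub> (if j \<in> C then v j else \<zero>\<^bsub>R\<^esub>)) =
        (\<lambda>j. if j \<in> insert k C then v j else \<zero>\<^bsub>R\<^esub>)"
      using insert(2) vc[OF v] by (auto simp: \<delta>_def)
    finally show ?case .
  qed
  have span: "lincomb S A v e = q v" if v: "v \<in> vectors R A" for v
  proof -
    have "(\<lambda>k. if k \<in> A then v k else \<zero>\<^bsub>R\<^esub>) = v"
      using v by (auto simp: vectors_def)
    then show ?thesis using partial[OF v A] by simp
  qed
  have "presents R S e A B"
    unfolding presents_def
  proof (intro conjI ballI allI impI)
    show "\<exists>v\<in>vectors R A. s = lincomb S A v e" if "s \<in> carrier S" for s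
      using lift[OF that] span by auto
    show "lincomb S A v e = \<zero>\<^bsub>S\<^esub>" if "v \<in> B" for v
    proof -
      have "v \<in> D" using that B by (auto simp: D_def sol_def)
      then show ?thesis
        using q B that span unfolding quotient_map_def by (auto simp: Ssimps)
    qed
    fix X :: "('r, 'u) module" and x
    assume X: "X \<in> lmod_ob R" and x: "\<forall>k\<in>A. x k \<in> carrier X" "\<forall>v\<in>B. lincomb X A v x = \<zero>\<^bsub>X\<^esub>"
    interpret X: left_module R X using X by (rule lmod_ob_left_module)
    define h where "h = factor_map E q H (\<lambda>v. lincomb X A v x)"
    have h: "h (q v) = lincomb X A v x" if "v \<in> vectors R A" for v
      unfolding h_def
    proof (rule factor_map_apply[OF q X.a_group linhom[OF X]])
      show "lincomb X A w x = \<one>\<^bsub>add_monoid X\<^esub>" if "w \<in> carrier E" "w \<in> D" for w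
        using that X x by (simp add: D_def sol_def)
    qed (use that x in auto)
    have "h \<in> lmod_mor R S X"
    proof (rule lmod_morI)
      fix s assume s: "s \<in> carrier S"
      obtain v where v: "v \<in> vectors R A" "s = q v" using lift[OF s] by blast
      show "h s \<in> carrier X"
        using v x h vc[OF v(1)] by (auto intro: X.lincomb_closed)
      show "h (a \<odot>\<^bsub>S\<^esub> s) = a \<odot>\<^bsub>X\<^esub> h s" if a: "a \<in> carrier R" for a
        using v x vc[OF v(1)] a X.lincomb_smult[OF A a] by (simp add: Ssimps sm h smE)
      fix t assume t: "t \<in> carrier S"
      obtain w where w: "w \<in> vectors R A" "t = q w" using lift[OF t] by blast
      show "h (s \<oplus>\<^bsub>S\<^esub> t) = h s \<oplus>\<^bsub>X\<^esub> h t"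
        using v w x vc[OF v(1)] vc[OF w(1)] h[OF addE[OF v(1) w(1)]] X.lincomb_add[of A v w x]
        by (simp add: Ssimps qadd[symmetric] h)
    next
      show "h \<in> extensional (carrier S)"
        by (simp add: h_def factor_map_def Ssimps)
    qed
    moreover have "h (e k) = x k" if "k \<in> A" for k
      using h[OF \<delta>[OF that]] X.lincomb_unit[OF A that] x by (simp add: e_def \<delta>_def)
    ultimately show "\<exists>h\<in>lmod_mor R S X. \<forall>k\<in>A. h (e k) = x k" by blast
  qed (use S e in auto)
  then show ?thesis by blast
qed

lemma presentsD:
  assumes "presents R S e A B"
  shows "S \<in> lmod_ob R" "\<And>k. k \<in> A \<Longrightarrow> e k \<in> carrier S"
    and "\<And>s. s \<in> carrier S \<Longrightarrow> \<exists>v\<in>vectors R A. s = lincomb S A v e"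
    and "\<And>v. v \<in> B \<Longrightarrow> lincomb S A v e = \<zero>\<^bsub>S\<^esub>"
    and "\<And>X x. X \<in> lmod_ob R \<Longrightarrow> (\<And>k. k \<in> A \<Longrightarrow> x k \<in> carrier X) \<Longrightarrow>
      (\<And>v. v \<in> B \<Longrightarrow> lincomb X A v x = \<zero>\<^bsub>X\<^esub>) \<Longrightarrow> \<exists>h\<in>lmod_mor R S X. \<forall>k\<in>A. h (e k) = x k"
proof -
  note a = assms[unfolded presents_def]
  note a1 = a[THEN conjunct2] note a2 = a1[THEN conjunct2] note a3 = a2[THEN conjunct2]
  show "S \<in> lmod_ob R" by (rule a[THEN conjunct1])
  show "\<And>k. k \<in> A \<Longrightarrow> e k \<in> carrier S" using a1[THEN conjunct1] by blast
  show "\<And>s. s \<in> carrier S \<Longrightarrow> \<exists>v\<in>vectors R A. s = lincomb S A v e" using a2[THEN conjunct1] by blast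
  show "\<And>v. v \<in> B \<Longrightarrow> lincomb S A v e = \<zero>\<^bsub>S\<^esub>" using a3[THEN conjunct1] by blast
  show "\<exists>h\<in>lmod_mor R S X. \<forall>k\<in>A. h (e k) = x k"
    if "X \<in> lmod_ob R" "\<And>k. k \<in> A \<Longrightarrow> x k \<in> carrier X"
      "\<And>v. v \<in> B \<Longrightarrow> lincomb X A v x = \<zero>\<^bsub>X\<^esub>" for X x
    using a3[THEN conjunct2, rule_format, OF that] .
qed

text \<open>The generators span, so it suffices to compare the two morphisms on them.\<close>

lemma presents_mor_eqI:
  assumes p: "presents R S e A B" and A: "finite A" and X: "X \<in> lmod_ob R"
    and g: "g \<in> lmod_mor R S X" and h: "h \<in> lmod_mor R S X"
    and eq: "\<And>k. k \<in> A \<Longrightarrow> g (e k) = h (e k)"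
  shows "g = h"
proof (rule lmod_mor_ext[OF g h])
  note P = presentsD[OF p]
  interpret X: left_module R X using X by (rule lmod_ob_left_module)
  fix s assume "s \<in> carrier S"
  then obtain v where v: "v \<in> vectors R A" "s = lincomb S A v e"
    using P(3) by blast
  note vc = vectors_carrier[OF X.ring_axioms v(1)]
  have "g s = lincomb X A v (\<lambda>k. g (e k))"
    unfolding v(2) using lincomb_mor[OF g P(1) X A, of v e] vc P(2) by blast
  also have "\<dots> = lincomb X A v (\<lambda>k. h (e k))"
    using eq vc lmod_mor_closed[OF h P(2)] by (intro X.lincomb_cong) auto
  also have "\<dots> = h s"
    unfolding v(2) using lincomb_mor[OF h P(1) X A, of v e] vc P(2) by auto
  finally show "g s = h s" .
qed

lemma presents_relabel:
  fixes S :: "('r, 'u) module"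
  assumes p: "presents R S e N ((\<lambda>v n. if n \<in> N then v (\<sigma> n) else \<zero>\<^bsub>R\<^esub>) ` B)"
    and \<sigma>: "bij_betw \<sigma> N A" and B: "B \<subseteq> vectors R A"
  shows "presents R S (\<lambda>k. e (inv_into N \<sigma> k)) A B"
proof -
  let ?pull = "\<lambda>v n. if n \<in> N then v (\<sigma> n) else \<zero>\<^bsub>R\<^esub>"
  note P = presentsD[OF p]
  interpret S: left_module R S using P(1) by (rule lmod_ob_left_module)
  have \<sigma>N: "\<sigma> n \<in> A" if "n \<in> N" for n
    using \<sigma> that by (auto simp: bij_betw_def)
  have \<tau>A: "inv_into N \<sigma> k \<in> N" "\<sigma> (inv_into N \<sigma> k) = k" if "k \<in> A" for k
    using bij_betw_apply[OF bij_betw_inv_into[OF \<sigma>] that] bij_betw_inv_into_right[OF \<sigma> that] .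
  have \<tau>\<sigma>: "inv_into N \<sigma> (\<sigma> n) = n" if "n \<in> N" for n
    using bij_betw_inv_into_left[OF \<sigma> that] .
  have pull: "lincomb X A v x =
      lincomb X N (?pull v) (\<lambda>n. x (\<sigma> n))"
    if X: "X \<in> lmod_ob R" and v: "v \<in> vectors R A" and x: "\<And>k. k \<in> A \<Longrightarrow> x k \<in> carrier X" for X :: "('r, 'u) module" and v x
  proof -
    interpret X: left_module R X using X by (rule lmod_ob_left_module)
    have "lincomb X A v x = lincomb X N (\<lambda>n. v (\<sigma> n)) (\<lambda>n. x (\<sigma> n))"
      using v x by (intro X.lincomb_reindex[OF \<sigma>]) (auto simp: vectors_def)
    also have "\<dots> = lincomb X N (?pull v) (\<lambda>n. x (\<sigma> n))"
      using vectors_carrier[OF S.ring_axioms v] x \<sigma>N by (intro X.lincomb_cong) auto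
    finally show ?thesis .
  qed
  have pull_e: "lincomb S A v (\<lambda>k. e (inv_into N \<sigma> k)) =
      lincomb S N (?pull v) e" if v: "v \<in> vectors R A" for v
  proof -
    have "lincomb S A v (\<lambda>k. e (inv_into N \<sigma> k)) =
      lincomb S N (?pull v) (\<lambda>n. e (inv_into N \<sigma> (\<sigma> n)))"
      using P(2) \<tau>A by (intro pull[OF P(1) v]) auto
    also have "\<dots> = lincomb S N (?pull v) e"
      using P(2) \<tau>\<sigma> vectors_carrier[OF S.ring_axioms v] by (intro S.lincomb_cong) auto
    finally show ?thesis .
  qed
  show ?thesis
    unfolding presents_def
  proof (intro conjI ballI allI impI)
    show "S \<in> lmod_ob R" by (rule P(1))
    show "e (inv_into N \<sigma> k) \<in> carrier S" if "k \<in> A" for k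
      using P(2) \<tau>A[OF that] by blast
    show "\<exists>v\<in>vectors R A. s = lincomb S A v (\<lambda>k. e (inv_into N \<sigma> k))" if "s \<in> carrier S" for s
    proof -
      obtain w where w: "w \<in> vectors R N" "s = lincomb S N w e"
        using P(3) \<open>s \<in> carrier S\<close> by blast
      define v where "v k = (if k \<in> A then w (inv_into N \<sigma> k) else \<zero>\<^bsub>R\<^esub>)" for k
      have v: "v \<in> vectors R A"
        using w \<tau>A by (auto simp: v_def vectors_def)
      have "lincomb S N (?pull v) e = lincomb S N w e"
        using w P(2) \<sigma>N \<tau>\<sigma> by (intro S.lincomb_cong) (auto simp: v_def vectors_def)
      then show ?thesis
        using pull_e[OF v] v w(2) by (intro bexI[of _ v]) auto
    qed
    show "lincomb S A v (\<lambda>k. e (inv_into N \<sigma> k)) = \<zero>\<^bsub>S\<^esub>" if "v \<in> B" for v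
      using pull_e[of v] P(4) that B by auto
    fix X :: "('r, 'u) module" and x
    assume X: "X \<in> lmod_ob R" and x: "\<forall>k\<in>A. x k \<in> carrier X" "\<forall>v\<in>B. lincomb X A v x = \<zero>\<^bsub>X\<^esub>"
    have "lincomb X N (?pull v) (\<lambda>n. x (\<sigma> n)) = \<zero>\<^bsub>X\<^esub>" if "v \<in> B" for v
      using pull[OF X, of v x] x B that by auto
    then have "\<exists>h\<in>lmod_mor R S X. \<forall>n\<in>N. h (e n) = x (\<sigma> n)"
      using x(1) \<sigma>N by (intro P(5)[OF X]) auto
    then show "\<exists>h\<in>lmod_mor R S X. \<forall>k\<in>A. h (e (inv_into N \<sigma> k)) = x k"
      using \<tau>A by metis
  qed
qed

definition finitely_presented :: "('r, 's) ring_scheme \<Rightarrow> ('r, 'u) module \<Rightarrow> bool" where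
  "finitely_presented R S \<longleftrightarrow>
     (\<exists>(A :: nat set) B e. finite A \<and> finite B \<and> B \<subseteq> vectors R A \<and> presents R S e A B)"

lemma finitely_presented_ob: "finitely_presented R S \<Longrightarrow> S \<in> lmod_ob R"
  unfolding finitely_presented_def presents_def by blast

text \<open>There are few finite presentations with generators indexed by an initial segment of
  \<open>\<nat>\<close>, and every finite presentation can be relabelled to become one of these.\<close>

lemma finitely_presented_catalogue:
  fixes R :: "('r, 's) ring_scheme"
  assumes u: "universe_type TYPE('u)" and R: "ring R" and smallR: "small TYPE('u) (carrier R)"
  obtains \<G> :: "('r, 'u) module set" where "small TYPE('u) \<G>"
    and "\<And>S. S \<in> \<G> \<Longrightarrow> finitely_presented R S"
    and "\<And>(A :: 'k set) B. finite A \<Longrightarrow> finite B \<Longrightarrow> B \<subseteq> vectors R A \<Longrightarrow> \<exists>S\<in>\<G>. \<exists>e. presents R S e A B"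
proof -
  define codes where
    "codes = (SIGMA n:(UNIV :: nat set). {B. finite B \<and> B \<subseteq> vectors R {..<n}})"
  define obj :: "nat \<times> (nat \<Rightarrow> 'r) set \<Rightarrow> ('r, 'u) module" where
    "obj = (\<lambda>(n, B). SOME S. \<exists>e. presents R S e {..<n} B)"
  have obj: "\<exists>e. presents R (obj (n, B)) e {..<n} B" if "B \<subseteq> vectors R {..<n}" for n B
  proof -
    have "\<exists>S :: ('r, 'u) module. \<exists>e. presents R S e {..<n} B"
      using presentation_exists[OF u R smallR _ that] by simp
    then show ?thesis
      using someI_ex[of "\<lambda>S :: ('r, 'u) module. \<exists>e. presents R S e {..<n} B"] by (simp add: obj_def)
  qed
  have "small TYPE('u) codes"
    unfolding codes_def
    by (intro small_Sigma[OF u] small_countable[OF u] small_finite_subsets[OF u]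
        small_vectors[OF u _ smallR]) auto
  then have "small TYPE('u) (obj ` codes)"
    by (rule small_image)
  moreover have "finitely_presented R S" if S: "S \<in> obj ` codes" for S
  proof -
    obtain n B where "S = obj (n, B)" "finite B" "B \<subseteq> vectors R {..<n}"
      using S by (auto simp: codes_def)
    then show ?thesis
      using obj[of B n] unfolding finitely_presented_def by blast
  qed
  moreover have "\<exists>S\<in>obj ` codes. \<exists>e. presents R S e A B"
    if A: "finite A" and "finite B" and B: "B \<subseteq> vectors R A" for A :: "'k set" and B
  proof -
    obtain \<sigma> where \<sigma>: "bij_betw \<sigma> {..<card A} A"
      using ex_bij_betw_nat_finite[OF A] by (auto simp: atLeast0LessThan)
    define B' where "B' = (\<lambda>v n. if n \<in> {..<card A} then v (\<sigma> n) else \<zero>\<^bsub>R\<^esub>) ` B"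
    have "v k \<in> carrier R" if "v \<in> B" for v k
      using vectors_carrier[OF R subsetD[OF B that]] .
    then have B': "finite B'" "B' \<subseteq> vectors R {..<card A}"
      using \<open>finite B\<close> by (auto simp: B'_def vectors_def)
    then obtain e where "presents R (obj (card A, B')) e {..<card A} B'"
      using obj by blast
    then have "presents R (obj (card A, B')) (\<lambda>k. e (inv_into {..<card A} \<sigma> k)) A B"
      unfolding B'_def by (rule presents_relabel[OF _ \<sigma> B])
    moreover have "obj (card A, B') \<in> obj ` codes"
      using B' by (auto simp: codes_def)
    ultimately show ?thesis by blast
  qed
  ultimately show ?thesis using that by blast
qed

section \<open>Morphisms from a finitely presented module commute with direct limits\<close>

definition zero_mor :: "('r, 'u) module \<Rightarrow> ('r, 'u) module \<Rightarrow> 'u \<Rightarrow> 'u" where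
  "zero_mor S T = (\<lambda>x\<in>carrier S. \<zero>\<^bsub>T\<^esub>)"

lemma zero_mor:
  assumes "S \<in> lmod_ob R" "T \<in> lmod_ob R"
  shows "zero_mor S T \<in> lmod_mor R S T"
proof -
  interpret S: left_module R S using assms(1) by (rule lmod_ob_left_module)
  interpret T: left_module R T using assms(2) by (rule lmod_ob_left_module)
  show ?thesis
    unfolding zero_mor_def by (intro lmod_morI) (auto simp: S.smult_closed T.smult_r_zero)
qed

lemma small_lmod_mor:
  assumes u: "universe_type TYPE('u)" and S: "finitely_presented R S" and X: "X \<in> lmod_ob R"
  shows "small TYPE('u) (lmod_mor R S (X :: ('r, 'u) module))"
proof -
  obtain A :: "nat set" and B e where A: "finite A" and p: "presents R S e A B"
    using S unfolding finitely_presented_def by blast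
  show ?thesis
  proof (rule small_inj_into)
    show "inj_on (\<lambda>h. \<lambda>k\<in>A. h (e k)) (lmod_mor R S X)"
    proof (rule inj_onI)
      fix g h assume gh: "g \<in> lmod_mor R S X" "h \<in> lmod_mor R S X"
        and eq: "(\<lambda>k\<in>A. g (e k)) = (\<lambda>k\<in>A. h (e k))"
      show "g = h"
        using fun_cong[OF eq] by (intro presents_mor_eqI[OF p A X gh]) (metis restrict_apply')
    qed
    show "(\<lambda>h. \<lambda>k\<in>A. h (e k)) ` lmod_mor R S X \<subseteq> (\<Pi>\<^sub>E k\<in>A. carrier X)"
      using lmod_mor_closed presentsD(2)[OF p] by fastforce
    show "small TYPE('u) (\<Pi>\<^sub>E k\<in>A. carrier X)"
      using X by (intro small_finite_PiE[OF u A]) (simp add: lmod_ob_def)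
  qed
qed

text \<open>Any upper bound of the finitely many indices at which the single elements die will do.\<close>

lemma lmod_limit_kernel_finite:
  assumes lim: "lmod_limit R I r X f L l" and "finite C" and i: "i \<in> I"
    and C: "\<And>c. c \<in> C \<Longrightarrow> x c \<in> carrier (X i)" "\<And>c. c \<in> C \<Longrightarrow> l i (x c) = \<zero>\<^bsub>L\<^esub>"
  obtains j where "j \<in> I" "(i, j) \<in> r" "\<And>c. c \<in> C \<Longrightarrow> f i j (x c) = \<zero>\<^bsub>X j\<^esub>"
proof -
  note L = lmod_limitD[OF lim]
  note D = direct_system_lmodD[OF L(2)]
  note rel = directed_set_rel[OF L(1)]
  have "\<exists>j\<in>I. (i, j) \<in> r \<and> f i j (x c) = \<zero>\<^bsub>X j\<^esub>" if "c \<in> C" for c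
    using L(6) i C that unfolding limit_cocone_def by simp
  then obtain m where m: "\<And>c. c \<in> C \<Longrightarrow> m c \<in> I \<and> (i, m c) \<in> r \<and> f i (m c) (x c) = \<zero>\<^bsub>X (m c)\<^esub>"
    by metis
  obtain j where j: "j \<in> I" "(i, j) \<in> r" "\<forall>c\<in>C. (m c, j) \<in> r"
    using directed_set_upper_finite[OF L(1) \<open>finite C\<close> _ i, of m] m by blast
  have "f i j (x c) = \<zero>\<^bsub>X j\<^esub>" if c: "c \<in> C" for c
  proof -
    have r: "(i, m c) \<in> r" "(m c, j) \<in> r" using m j c by auto
    have "f i j (x c) = f (m c) j (f i (m c) (x c))"
      using D(4)[OF r] C(1)[OF c] by (simp add: compose_def)
    also have "\<dots> = \<zero>\<^bsub>X j\<^esub>"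
      using m[OF c] lmod_mor_zero[OF D(2)[OF r(2)] D(1) D(1)] rel(1)[OF r(2)] by simp
    finally show ?thesis .
  qed
  then show ?thesis using that j by blast
qed

text \<open>A morphism into the limit lifts on the finitely many generators, and the lifts satisfy the
  finitely many relations at some later index.\<close>

lemma finitely_presented_lift:
  assumes S: "finitely_presented R S" and lim: "lmod_limit R I r X f L l"
    and h: "h \<in> lmod_mor R S L"
  obtains i h' where "i \<in> I" "h' \<in> lmod_mor R S (X i)" "h = compose (carrier S) (l i) h'"
proof -
  obtain A :: "nat set" and B e where A: "finite A" and B: "finite B" "B \<subseteq> vectors R A"
    and p: "presents R S e A B"
    using S unfolding finitely_presented_def by blast
  note P = presentsD[OF p]
  note L = lmod_limitD[OF lim]
  note D = direct_system_lmodD[OF L(2)]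
  interpret S: left_module R S using P(1) by (rule lmod_ob_left_module)
  have vc: "v k \<in> carrier R" if "v \<in> B" for v k
    using vectors_carrier[OF S.ring_axioms subsetD[OF B(2) that]] .
  have "\<exists>i\<in>I. \<exists>y\<in>carrier (X i). h (e k) = l i y" if "k \<in> A" for k
    using L(6) lmod_mor_closed[OF h P(2)[OF that]] unfolding limit_cocone_def by simp
  then obtain m y where m: "\<And>k. k \<in> A \<Longrightarrow> m k \<in> I"
    and y: "\<And>k. k \<in> A \<Longrightarrow> y k \<in> carrier (X (m k)) \<and> h (e k) = l (m k) (y k)"
    by metis
  obtain i0 where "i0 \<in> I" using L(1) unfolding directed_set_def by blast
  then obtain i where i: "i \<in> I" "\<forall>k\<in>A. (m k, i) \<in> r"
    using directed_set_upper_finite[OF L(1) A, of m] m by blast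
  \<comment> \<open>The elements \<open>x k\<close> lift the images of the generators, but the relations hold for them in the
    limit only.\<close>
  define x where "x k = f (m k) i (y k)" for k
  have x: "x k \<in> carrier (X i)" "l i (x k) = h (e k)" if k: "k \<in> A" for k
  proof -
    have r: "(m k, i) \<in> r" using i k by blast
    show "x k \<in> carrier (X i)"
      using lmod_mor_closed[OF D(2)[OF r]] y[OF k] by (simp add: x_def)
    show "l i (x k) = h (e k)"
      using L(5)[OF r] y[OF k] by (simp add: x_def compose_def)
  qed
  interpret Xi: left_module R "X i" using D(1)[OF i(1)] by (rule lmod_ob_left_module)
  have rels: "lincomb (X i) A v x \<in> carrier (X i)" "l i (lincomb (X i) A v x) = \<zero>\<^bsub>L\<^esub>"
    if v: "v \<in> B" for v
  proof -
    show "lincomb (X i) A v x \<in> carrier (X i)"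
      using vc[OF v] x by (intro Xi.lincomb_closed) auto
    interpret L: left_module R L using L(3) by (rule lmod_ob_left_module)
    have "l i (lincomb (X i) A v x) = lincomb L A v (\<lambda>k. l i (x k))"
      using lincomb_mor[OF L(4)[OF i(1)] D(1)[OF i(1)] L(3) A, of v x] vc[OF v] x(1) by blast
    also have "\<dots> = lincomb L A v (\<lambda>k. h (e k))"
      using vc[OF v] x lmod_mor_closed[OF h P(2)] by (intro L.lincomb_cong) auto
    also have "\<dots> = h (lincomb S A v e)"
      using lincomb_mor[OF h P(1) L(3) A, of v e] vc[OF v] P(2) by auto
    also have "\<dots> = \<zero>\<^bsub>L\<^esub>"
      using P(4)[OF v] lmod_mor_zero[OF h P(1) L(3)] by simp
    finally show "l i (lincomb (X i) A v x) = \<zero>\<^bsub>L\<^esub>" .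
  qed
  obtain j where j: "j \<in> I" "(i, j) \<in> r" "\<And>v. v \<in> B \<Longrightarrow> f i j (lincomb (X i) A v x) = \<zero>\<^bsub>X j\<^esub>"
    using lmod_limit_kernel_finite[OF lim B(1) i(1), of "\<lambda>v. lincomb (X i) A v x"] rels by blast
  have fx: "f i j (x k) \<in> carrier (X j)" "l j (f i j (x k)) = h (e k)" if "k \<in> A" for k
    using lmod_mor_closed[OF D(2)[OF j(2)] x(1)[OF that]] x[OF that] L(5)[OF j(2)]
    by (auto simp: compose_def)
  have "lincomb (X j) A v (\<lambda>k. f i j (x k)) = \<zero>\<^bsub>X j\<^esub>" if v: "v \<in> B" for v
    using lincomb_mor[OF D(2)[OF j(2)] D(1)[OF i(1)] D(1)[OF j(1)] A, of v x] vc[OF v] x(1) j(3)[OF v]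
    by auto
  then obtain h' where h': "h' \<in> lmod_mor R S (X j)" "\<forall>k\<in>A. h' (e k) = f i j (x k)"
    using P(5)[OF D(1)[OF j(1)], of "\<lambda>k. f i j (x k)"] fx by blast
  have "h = compose (carrier S) (l j) h'"
  proof (rule presents_mor_eqI[OF p A L(3) h])
    show "compose (carrier S) (l j) h' \<in> lmod_mor R S L"
      using lmod_mor_compose[OF h'(1) L(4)[OF j(1)] S.left_module_axioms] .
    show "h (e k) = compose (carrier S) (l j) h' (e k)" if "k \<in> A" for k
      using h' fx P(2) that by (simp add: compose_def)
  qed
  then show ?thesis using that j h' by blast
qed

text \<open>The images of the finitely many generators die at a common index.\<close>

lemma finitely_presented_kernel:
  assumes S: "finitely_presented R S" and lim: "lmod_limit R I r X f L l"
    and i: "i \<in> I" and h: "h \<in> lmod_mor R S (X i)"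
    and zero: "compose (carrier S) (l i) h = zero_mor S L"
  obtains j where "j \<in> I" "(i, j) \<in> r" "compose (carrier S) (f i j) h = zero_mor S (X j)"
proof -
  obtain A :: "nat set" and B e where A: "finite A" and p: "presents R S e A B"
    using S unfolding finitely_presented_def by blast
  note P = presentsD[OF p]
  note L = lmod_limitD[OF lim]
  note D = direct_system_lmodD[OF L(2)]
  have he: "h (e k) \<in> carrier (X i)" "l i (h (e k)) = \<zero>\<^bsub>L\<^esub>" if "k \<in> A" for k
    using lmod_mor_closed[OF h] P(2)[OF that] fun_cong[OF zero, of "e k"]
    by (auto simp: compose_def zero_mor_def)
  obtain j where j: "j \<in> I" "(i, j) \<in> r" "\<And>k. k \<in> A \<Longrightarrow> f i j (h (e k)) = \<zero>\<^bsub>X j\<^esub>"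
    using lmod_limit_kernel_finite[OF lim A i, of "\<lambda>k. h (e k)"] he by blast
  have "compose (carrier S) (f i j) h = zero_mor S (X j)"
  proof (rule presents_mor_eqI[OF p A D(1)[OF j(1)]])
    show "compose (carrier S) (f i j) h \<in> lmod_mor R S (X j)"
      using lmod_mor_compose[OF h D(2)[OF j(2)] lmod_ob_left_module[OF P(1)]] .
    show "zero_mor S (X j) \<in> lmod_mor R S (X j)"
      using zero_mor[OF P(1) D(1)[OF j(1)]] .
    show "compose (carrier S) (f i j) h (e k) = zero_mor S (X j) (e k)" if "k \<in> A" for k
      using j(3)[OF that] P(2)[OF that] by (simp add: compose_def zero_mor_def)
  qed
  then show ?thesis using that j by blast
qed

section \<open>Every module is a direct limit of finitely presented modules\<close>

text \<open>The index set consists of the pairs of a finite set \<open>A\<close> of elements of \<open>X\<close> and a finite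
  set of linear relations that hold between these elements. The module at \<open>(A, B)\<close> has
  generators \<open>A\<close> and relations \<open>B\<close>. An element of it that is zero in \<open>X\<close> is a linear combination
  of generators, and it dies once this combination is added to the relations.\<close>

lemma lmod_limit_finitely_presented:
  fixes R :: "('r, 's) ring_scheme" and X :: "('r, 'u) module"
  assumes u: "universe_type TYPE('u)" and R: "ring R" and smallR: "small TYPE('u) (carrier R)"
    and \<G>: "\<And>(A :: 'u set) B. finite A \<Longrightarrow> finite B \<Longrightarrow> B \<subseteq> vectors R A \<Longrightarrow> \<exists>S\<in>\<G>. \<exists>e. presents R S e A B"
    and X: "X \<in> lmod_ob R"
  obtains I :: "('u set \<times> ('u \<Rightarrow> 'r) set) set" and r S f l
    where "small TYPE('u) I" "lmod_limit R I r S f X l" "\<And>i. i \<in> I \<Longrightarrow> S i \<in> \<G>"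
proof -
  interpret X: left_module R X using X by (rule lmod_ob_left_module)
  define K where "K A = {v \<in> vectors R A. lincomb X A v (\<lambda>x. x) = \<zero>\<^bsub>X\<^esub>}" for A
  define I where "I = (SIGMA A:{A. finite A \<and> A \<subseteq> carrier X}. {B. finite B \<and> B \<subseteq> K A})"
  define r where "r = {(i, j). i \<in> I \<and> j \<in> I \<and> fst i \<subseteq> fst j \<and> snd i \<subseteq> snd j}"
  have ID: "finite (fst i)" "fst i \<subseteq> carrier X" "finite (snd i)" "snd i \<subseteq> K (fst i)"
    "snd i \<subseteq> vectors R (fst i)" if "i \<in> I" for i
    using that by (auto simp: I_def K_def)
  have vc: "v k \<in> carrier R" if "v \<in> vectors R A" for v k and A :: "'u set"
    using vectors_carrier[OF R that] .
  have Kmono: "K A \<subseteq> K A'" if A: "A \<subseteq> A'" "finite A'" "A' \<subseteq> carrier X" for A A'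
  proof
    fix v assume v: "v \<in> K A"
    have "lincomb X A' v (\<lambda>x. x) = lincomb X A v (\<lambda>x. x)"
      using A v vc[of v A] by (intro X.lincomb_superset) (auto simp: K_def vectors_def)
    then show "v \<in> K A'"
      using v vectors_mono[OF R A(1)] by (auto simp: K_def)
  qed
  have smallI: "small TYPE('u) I"
    unfolding I_def
  proof (intro small_Sigma[OF u] small_finite_subsets[OF u])
    show "small TYPE('u) (carrier X)" using X by (simp add: lmod_ob_def)
    show "small TYPE('u) (K A)" if "A \<in> {A. finite A \<and> A \<subseteq> carrier X}" for A
      by (rule small_mono[OF small_vectors[OF u _ smallR, of A]]) (use that in \<open>auto simp: K_def\<close>)
  qed
  have dir: "directed_set I r"
    unfolding directed_set_def
  proof (intro conjI ballI)
    have "({}, {}) \<in> I" by (simp add: I_def)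
    then show "I \<noteq> {}" by blast
    show "partial_order_on I r"
      unfolding partial_order_on_def preorder_on_def refl_on_def trans_def antisym_def r_def
      by (auto simp: prod_eq_iff)
    fix i j assume ij: "i \<in> I" "j \<in> I"
    let ?A = "fst i \<union> fst j"
    have A: "finite ?A" "?A \<subseteq> carrier X" using ID[OF ij(1)] ID[OF ij(2)] by auto
    have "snd i \<union> snd j \<subseteq> K ?A"
      using ID(4)[OF ij(1)] ID(4)[OF ij(2)] Kmono[OF _ A] by blast
    then have "(?A, snd i \<union> snd j) \<in> I"
      using ID[OF ij(1)] ID[OF ij(2)] A by (simp add: I_def)
    then show "\<exists>k\<in>I. (i, k) \<in> r \<and> (j, k) \<in> r"
      using ij by (intro bexI[of _ "(?A, snd i \<union> snd j)"]) (auto simp: r_def)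
  qed
  have "\<forall>i\<in>I. \<exists>S e. S \<in> \<G> \<and> presents R S e (fst i) (snd i)"
    using \<G> ID by meson
  then obtain S e where S: "\<And>i. i \<in> I \<Longrightarrow> S i \<in> \<G>"
    and p: "\<And>i. i \<in> I \<Longrightarrow> presents R (S i) (e i) (fst i) (snd i)"
    by metis
  note P = presentsD[OF p]
  have rI: "i \<in> I" "j \<in> I" "fst i \<subseteq> fst j" "snd i \<subseteq> snd j" if "(i, j) \<in> r" for i j
    using that by (auto simp: r_def)
  have "\<exists>h\<in>lmod_mor R (S i) (S j). \<forall>k\<in>fst i. h (e i k) = e j k" if ij: "(i, j) \<in> r" for i j
  proof (rule P(5)[OF rI(1)[OF ij] P(1)[OF rI(2)[OF ij]]])
    interpret Sj: left_module R "S j" using P(1)[OF rI(2)[OF ij]] by (rule lmod_ob_left_module)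
    show "e j k \<in> carrier (S j)" if "k \<in> fst i" for k
      using P(2)[OF rI(2)[OF ij]] rI(3)[OF ij] that by blast
    fix v assume v: "v \<in> snd i"
    then have vA: "v \<in> vectors R (fst i)" using ID(5) rI(1)[OF ij] by blast
    have "lincomb (S j) (fst j) v (e j) = lincomb (S j) (fst i) v (e j)"
      using vA vc[OF vA] ID(1)[OF rI(2)[OF ij]] rI(3)[OF ij] P(2)[OF rI(2)[OF ij]]
      by (intro Sj.lincomb_superset) (auto simp: vectors_def)
    then show "lincomb (S j) (fst i) v (e j) = \<zero>\<^bsub>S j\<^esub>"
      using P(4)[OF rI(2)[OF ij]] rI(4)[OF ij] v by auto
  qed
  then obtain f where f: "\<And>i j. (i, j) \<in> r \<Longrightarrow> f i j \<in> lmod_mor R (S i) (S j)"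
    and fe: "\<And>i j k. (i, j) \<in> r \<Longrightarrow> k \<in> fst i \<Longrightarrow> f i j (e i k) = e j k"
    by metis
  have "\<exists>h\<in>lmod_mor R (S i) X. \<forall>k\<in>fst i. h (e i k) = k" if i: "i \<in> I" for i
    using ID[OF i] by (intro P(5)[OF i X]) (auto simp: K_def)
  then obtain l where l: "\<And>i. i \<in> I \<Longrightarrow> l i \<in> lmod_mor R (S i) X"
    and le: "\<And>i k. i \<in> I \<Longrightarrow> k \<in> fst i \<Longrightarrow> l i (e i k) = k"
    by metis
  note rel = directed_set_rel[OF dir]
  have comp: "compose (carrier (S i)) g h \<in> lmod_mor R (S i) T"
    if "i \<in> I" "h \<in> lmod_mor R (S i) T'" "g \<in> lmod_mor R T' T" for i g h T T'
    using lmod_mor_compose[OF that(2,3) lmod_ob_left_module[OF P(1)[OF that(1)]]] .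
  have ce: "compose (carrier (S i)) g h (e i k) = g (h (e i k))" if "i \<in> I" "k \<in> fst i"
    for i k and g h :: "'u \<Rightarrow> 'u"
    using P(2)[OF that] by (simp add: compose_def)
  have sys: "direct_system_lmod R I r S f"
    unfolding direct_system_lmod_def
  proof (intro conjI ballI allI impI)
    show "S i \<in> lmod_ob R" if "i \<in> I" for i using P(1)[OF that] .
    show "case ij of (i, j) \<Rightarrow> f i j \<in> lmod_mor R (S i) (S j)" if "ij \<in> r" for ij
      using f that by auto
    show "f i i = (\<lambda>x\<in>carrier (S i). x)" if i: "i \<in> I" for i
    proof (rule presents_mor_eqI[OF p[OF i] ID(1)[OF i] P(1)[OF i] f[OF rel(2)[OF i]]])
      show "(\<lambda>x\<in>carrier (S i). x) \<in> lmod_mor R (S i) (S i)"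
        using lmod_mor_id[OF lmod_ob_left_module[OF P(1)[OF i]]] .
      show "f i i (e i k) = (\<lambda>x\<in>carrier (S i). x) (e i k)" if "k \<in> fst i" for k
        using fe[OF rel(2)[OF i] that] P(2)[OF i that] by simp
    qed
    fix i j k assume ij: "(i, j) \<in> r" and jk: "(j, k) \<in> r"
    note ik = rel(3)[OF ij jk]
    note i = rI(1)[OF ij]
    show "f i k = compose (carrier (S i)) (f j k) (f i j)"
    proof (rule presents_mor_eqI[OF p[OF i] ID(1)[OF i] P(1)[OF rI(2)[OF jk]] f[OF ik]])
      show "compose (carrier (S i)) (f j k) (f i j) \<in> lmod_mor R (S i) (S k)"
        using comp[OF i f[OF ij] f[OF jk]] .
      show "f i k (e i a) = compose (carrier (S i)) (f j k) (f i j) (e i a)" if "a \<in> fst i" for a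
        using ce[OF i that] fe[OF ij that] fe[OF jk, of a] fe[OF ik that] rI(3)[OF ij] that by auto
    qed
  qed
  have "lmod_limit R I r S f X l"
  proof (rule lmod_limitI[OF dir sys X l])
    fix i j assume ij: "(i, j) \<in> r"
    note i = rI(1)[OF ij] and j = rI(2)[OF ij]
    show "l i = compose (carrier (S i)) (l j) (f i j)"
    proof (rule presents_mor_eqI[OF p[OF i] ID(1)[OF i] X l[OF i]])
      show "compose (carrier (S i)) (l j) (f i j) \<in> lmod_mor R (S i) X"
        using comp[OF i f[OF ij] l[OF j]] .
      show "l i (e i k) = compose (carrier (S i)) (l j) (f i j) (e i k)" if "k \<in> fst i" for k
        using ce[OF i that] fe[OF ij that] le[OF i that] le[OF j, of k] rI(3)[OF ij] that by auto
    qed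
  next
    show "limit_cocone I r (\<lambda>i. add_monoid (S i)) f (add_monoid X) l"
      unfolding limit_cocone_def
    proof (intro conjI ballI impI)
      fix y assume "y \<in> carrier (add_monoid X)"
      then have i: "({y}, {}) \<in> I" by (simp add: I_def)
      then show "\<exists>i\<in>I. \<exists>x\<in>carrier (add_monoid (S i)). y = l i x"
        using P(2)[OF i, of y] le[OF i, of y] by (intro bexI[OF _ i] bexI[of _ "e ({y}, {}) y"]) auto
    next
      fix i s assume i: "i \<in> I" and s: "s \<in> carrier (add_monoid (S i))"
        and dies: "l i s = \<one>\<^bsub>add_monoid X\<^esub>"
      obtain v where v: "v \<in> vectors R (fst i)" "s = lincomb (S i) (fst i) v (e i)"
        using P(3)[OF i] s by auto
      have "l i s = lincomb X (fst i) v (\<lambda>k. l i (e i k))"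
        unfolding v(2) using lincomb_mor[OF l[OF i] P(1)[OF i] X ID(1)[OF i], of v "e i"] vc[OF v(1)] P(2)[OF i]
        by blast
      also have "\<dots> = lincomb X (fst i) v (\<lambda>k. k)"
        using le[OF i] vc[OF v(1)] ID(2)[OF i] by (intro X.lincomb_cong) auto
      finally have vK: "v \<in> K (fst i)"
        using dies v(1) by (simp add: K_def)
      define j where "j = (fst i, insert v (snd i))"
      have j: "j \<in> I" and ij: "(i, j) \<in> r"
        using vK i by (auto simp: j_def r_def I_def)
      interpret Sj: left_module R "S j" using P(1)[OF j] by (rule lmod_ob_left_module)
      have "f i j s = lincomb (S j) (fst i) v (\<lambda>k. f i j (e i k))"
        unfolding v(2)
        using lincomb_mor[OF f[OF ij] P(1)[OF i] P(1)[OF j] ID(1)[OF i], of v "e i"] vc[OF v(1)] P(2)[OF i]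
        by blast
      also have "\<dots> = lincomb (S j) (fst j) v (e j)"
        using fe[OF ij] vc[OF v(1)] P(2)[OF j] unfolding j_def[THEN arg_cong[of _ _ fst], simplified]
        by (intro Sj.lincomb_cong) auto
      also have "\<dots> = \<zero>\<^bsub>S j\<^esub>"
        by (rule P(4)[OF j]) (simp add: j_def)
      finally show "\<exists>j\<in>I. (i, j) \<in> r \<and> f i j s = \<one>\<^bsub>add_monoid (S j)\<^esub>"
        using j ij by auto
    qed
  qed
  then show ?thesis using that smallI S by blast
qed

section \<open>Finite families of morphisms\<close>

text \<open>These are the elements of \<open>\<Oplus>g\<in>A. Hom(S g, X)\<close>. They vanish off \<open>A\<close>, so that a family for
  \<open>A\<close> is one for every larger index set.\<close>

definition families ::
    "('r, 's) ring_scheme \<Rightarrow> ('g \<Rightarrow> ('r, 'u) module) \<Rightarrow> 'g set \<Rightarrow> ('r, 'u) module \<Rightarrow>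
     ('g \<Rightarrow> 'u \<Rightarrow> 'u) set" where
  "families R S A X = {x. (\<forall>g\<in>A. x g \<in> lmod_mor R (S g) X) \<and> (\<forall>g. g \<notin> A \<longrightarrow> x g = zero_mor (S g) X)}"

definition family_group ::
    "('r, 's) ring_scheme \<Rightarrow> ('g \<Rightarrow> ('r, 'u) module) \<Rightarrow> 'g set \<Rightarrow> ('r, 'u) module \<Rightarrow>
     ('g \<Rightarrow> 'u \<Rightarrow> 'u) monoid" where
  "family_group R S A X = \<lparr>carrier = families R S A X,
     mult = (\<lambda>x y g. \<lambda>s\<in>carrier (S g). x g s \<oplus>\<^bsub>X\<^esub> y g s), one = (\<lambda>g. zero_mor (S g) X)\<rparr>"

definition push :: "('g \<Rightarrow> ('r, 'u) module) \<Rightarrow> ('u \<Rightarrow> 'u) \<Rightarrow> ('g \<Rightarrow> 'u \<Rightarrow> 'u) \<Rightarrow> 'g \<Rightarrow> 'u \<Rightarrow> 'u" where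
  "push S f x = (\<lambda>g. compose (carrier (S g)) f (x g))"

lemma carrier_family_group [simp]: "carrier (family_group R S A X) = families R S A X"
  by (simp add: family_group_def)

lemma push_apply: "s \<in> carrier (S g) \<Longrightarrow> push S f x g s = f (x g s)"
  by (simp add: push_def compose_def)

lemma family_mult_apply:
  "s \<in> carrier (S g) \<Longrightarrow> (x \<otimes>\<^bsub>family_group R S A X\<^esub> y) g s = x g s \<oplus>\<^bsub>X\<^esub> y g s"
  by (simp add: family_group_def)

lemma family_one_apply: "s \<in> carrier (S g) \<Longrightarrow> \<one>\<^bsub>family_group R S A X\<^esub> g s = \<zero>\<^bsub>X\<^esub>"
  by (simp add: family_group_def zero_mor_def)

lemma families_mor: "x \<in> families R S A X \<Longrightarrow> g \<in> A \<Longrightarrow> x g \<in> lmod_mor R (S g) X"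
  by (simp add: families_def)

lemma families_extensional: "x \<in> families R S A X \<Longrightarrow> x g \<in> extensional (carrier (S g))"
  by (cases "g \<in> A") (auto simp: families_def lmod_mor_def zero_mor_def)

lemma families_closed:
  assumes "x \<in> families R S A X" "X \<in> lmod_ob R" "s \<in> carrier (S g)"
  shows "x g s \<in> carrier X"
proof -
  interpret X: abelian_group X using assms(2) by (rule lmod_ob_abelian)
  show ?thesis
    using assms by (cases "g \<in> A") (auto simp: families_def zero_mor_def lmod_mor_closed)
qed

lemma families_eqI:
  assumes "\<And>g. x g \<in> extensional (carrier (S g))" "\<And>g. y g \<in> extensional (carrier (S g))"
    and "\<And>g s. s \<in> carrier (S g) \<Longrightarrow> x g s = y g s"
  shows "x = y"
proof
  show "x g = y g" for g
    by (rule extensionalityI[OF assms(1,2,3)])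
qed

lemma push_extensional: "push S f x g \<in> extensional (carrier (S g))"
  by (simp add: push_def compose_def)

lemma family_mult_extensional:
  "(x \<otimes>\<^bsub>family_group R S A X\<^esub> y) g \<in> extensional (carrier (S g))"
  by (simp add: family_group_def)

lemma family_one_extensional: "\<one>\<^bsub>family_group R S A X\<^esub> g \<in> extensional (carrier (S g))"
  by (simp add: family_group_def zero_mor_def)

lemma lmod_mor_sum:
  assumes f: "f \<in> lmod_mor R S T" and g: "g \<in> lmod_mor R S T" and S: "S \<in> lmod_ob R" and T: "T \<in> lmod_ob R"
  shows "(\<lambda>s\<in>carrier S. f s \<oplus>\<^bsub>T\<^esub> g s) \<in> lmod_mor R S T"
proof -
  interpret S: left_module R S using S by (rule lmod_ob_left_module)
  interpret T: left_module R T using T by (rule lmod_ob_left_module)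
  show ?thesis
    using f g
    by (intro lmod_morI)
      (auto simp: S.smult_closed T.smult_r_distr lmod_mor_closed lmod_mor_add lmod_mor_smult T.a_ac)
qed

lemma lmod_mor_uminus:
  assumes f: "f \<in> lmod_mor R S T" and S: "S \<in> lmod_ob R" and T: "T \<in> lmod_ob R"
  shows "(\<lambda>s\<in>carrier S. \<ominus>\<^bsub>T\<^esub> f s) \<in> lmod_mor R S T"
proof -
  interpret S: left_module R S using S by (rule lmod_ob_left_module)
  interpret T: left_module R T using T by (rule lmod_ob_left_module)
  have neg: "\<ominus>\<^bsub>T\<^esub> (a \<odot>\<^bsub>T\<^esub> y) = a \<odot>\<^bsub>T\<^esub> (\<ominus>\<^bsub>T\<^esub> y)" if "a \<in> carrier R" "y \<in> carrier T" for a y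
  proof (rule T.M.minus_equality)
    show "a \<odot>\<^bsub>T\<^esub> (\<ominus>\<^bsub>T\<^esub> y) \<oplus>\<^bsub>T\<^esub> a \<odot>\<^bsub>T\<^esub> y = \<zero>\<^bsub>T\<^esub>"
      using that by (simp add: T.smult_r_distr[symmetric] T.M.l_neg T.smult_r_zero)
  qed (use that in \<open>auto intro: T.smult_closed\<close>)
  show ?thesis
    using f
    by (intro lmod_morI)
      (auto simp: S.smult_closed neg lmod_mor_closed lmod_mor_add lmod_mor_smult T.M.minus_add)
qed

lemma hom_finprod:
  assumes "comm_group G" "comm_group H" "f \<in> hom G H" "finite A" "\<And>a. a \<in> A \<Longrightarrow> x a \<in> carrier G"
  shows "f (finprod G x A) = finprod H (\<lambda>a. f (x a)) A"
proof -
  interpret G: comm_group G by fact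
  interpret H: comm_group H by fact
  interpret f: group_hom G H f
    using assms(3) G.is_group H.is_group by (auto simp: group_hom_def group_hom_axioms_def)
  show ?thesis
    using assms(4,5)
  proof (induction A)
    case (insert a A)
    then show ?case
      by (subst G.finprod_insert) (auto simp: Pi_def intro!: G.finprod_closed)
  qed simp
qed

context
  fixes R :: "('r, 's) ring_scheme" and S :: "'g \<Rightarrow> ('r, 'u) module" and A :: "'g set"
  assumes ob: "\<And>g. g \<in> A \<Longrightarrow> S g \<in> lmod_ob R"
begin

lemma family_comm_group:
  assumes X: "X \<in> lmod_ob R"
  shows "comm_group (family_group R S A X)"
proof -
  let ?E = "family_group R S A X"
  interpret X: left_module R X using X by (rule lmod_ob_left_module)
  note closed = families_closed[where R = R and S = S and A = A, OF _ X]
  have mult: "x \<otimes>\<^bsub>?E\<^esub> y \<in> families R S A X"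
    if x: "x \<in> families R S A X" and y: "y \<in> families R S A X" for x y
    using lmod_mor_sum[OF families_mor[OF x] families_mor[OF y] ob X] x y
    by (auto simp: families_def family_group_def zero_mor_def)
  have one: "\<one>\<^bsub>?E\<^esub> \<in> families R S A X"
    using zero_mor[OF ob X] by (auto simp: families_def family_group_def)
  have neg: "(\<lambda>g. \<lambda>s\<in>carrier (S g). \<ominus>\<^bsub>X\<^esub> x g s) \<in> families R S A X" if x: "x \<in> families R S A X" for x
    using lmod_mor_uminus[OF families_mor[OF x] ob X] x
    by (auto simp: families_def zero_mor_def)
  show ?thesis
  proof (rule comm_groupI)
    show "\<exists>y\<in>carrier (?E). y \<otimes>\<^bsub>?E\<^esub> x = \<one>\<^bsub>?E\<^esub>"
      if x: "x \<in> carrier (?E)" for x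
    proof (rule bexI)
      show "(\<lambda>g. \<lambda>s\<in>carrier (S g). \<ominus>\<^bsub>X\<^esub> x g s) \<otimes>\<^bsub>?E\<^esub> x = \<one>\<^bsub>?E\<^esub>"
        using x closed
        by (intro families_eqI[of _ S])
          (auto simp: family_mult_extensional family_one_extensional family_mult_apply family_one_apply X.M.l_neg)
    qed (use neg x in simp)
  next
    fix x y z assume x: "x \<in> carrier (?E)" and y: "y \<in> carrier (?E)"
    show "x \<otimes>\<^bsub>?E\<^esub> y = y \<otimes>\<^bsub>?E\<^esub> x"
      using x y closed
      by (intro families_eqI[of _ S]) (auto simp: family_mult_extensional family_mult_apply X.M.a_comm)
    assume z: "z \<in> carrier (?E)"
    show "x \<otimes>\<^bsub>?E\<^esub> y \<otimes>\<^bsub>?E\<^esub> z =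
        x \<otimes>\<^bsub>?E\<^esub> (y \<otimes>\<^bsub>?E\<^esub> z)"
      using x y z closed
      by (intro families_eqI[of _ S]) (auto simp: family_mult_extensional family_mult_apply X.M.a_assoc)
  next
    fix x assume x: "x \<in> carrier (?E)"
    show "\<one>\<^bsub>?E\<^esub> \<otimes>\<^bsub>?E\<^esub> x = x"
      using x closed families_extensional
      by (intro families_eqI[of _ S]) (auto simp: family_mult_extensional family_mult_apply family_one_apply)
  qed (use mult one in auto)
qed

lemma push_closed:
  assumes f: "f \<in> lmod_mor R X Y" and X: "X \<in> lmod_ob R" and Y: "Y \<in> lmod_ob R"
    and x: "x \<in> families R S A X"
  shows "push S f x \<in> families R S A Y"
proof -
  have "compose (carrier (S g)) f (x g) \<in> lmod_mor R (S g) Y" if "g \<in> A" for g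
    using lmod_mor_compose[OF families_mor[OF x that] f lmod_ob_left_module[OF ob[OF that]]] .
  moreover have "compose (carrier (S g)) f (x g) = zero_mor (S g) Y" if "g \<notin> A" for g
    using x that lmod_mor_zero[OF f X Y] by (auto simp: families_def zero_mor_def compose_def)
  ultimately show ?thesis
    by (simp add: families_def push_def)
qed

lemma push_hom:
  assumes f: "f \<in> lmod_mor R X Y" and X: "X \<in> lmod_ob R" and Y: "Y \<in> lmod_ob R"
  shows "push S f \<in> hom (family_group R S A X) (family_group R S A Y)"
proof (rule homI)
  let ?E = "family_group R S A X"
  let ?E' = "family_group R S A Y"
  fix x y assume x: "x \<in> carrier (?E)" and y: "y \<in> carrier (?E)"
  show "push S f (x \<otimes>\<^bsub>?E\<^esub> y) =
      push S f x \<otimes>\<^bsub>?E'\<^esub> push S f y"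
    using x y lmod_mor_add[OF f] families_closed[where R = R and S = S and A = A, OF _ X]
    by (intro families_eqI[of _ S])
      (auto simp: family_mult_extensional push_extensional family_mult_apply push_apply)
qed (use push_closed[OF assms] in auto)

lemma push_compose:
  assumes "X \<in> lmod_ob R" "x \<in> families R S A X"
  shows "push S (compose (carrier X) g f) x = push S g (push S f x)"
  using families_closed[OF assms(2,1)]
  by (intro families_eqI[of _ S]) (auto simp: push_extensional push_apply compose_def)

lemma push_id:
  assumes "X \<in> lmod_ob R" "x \<in> families R S A X"
  shows "push S (\<lambda>y\<in>carrier X. y) x = x"
  using families_closed[OF assms(2,1)] families_extensional[OF assms(2)]
  by (intro families_eqI[of _ S]) (auto simp: push_extensional push_apply)

lemma push_add:
  assumes "X \<in> lmod_ob R" "x \<in> families R S A X"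
  shows "push S (\<lambda>z\<in>carrier X. f z \<oplus>\<^bsub>Y\<^esub> g z) x = push S f x \<otimes>\<^bsub>family_group R S A Y\<^esub> push S g x"
  using families_closed[OF assms(2,1)]
  by (intro families_eqI[of _ S])
    (auto simp: push_extensional family_mult_extensional family_mult_apply push_apply)

lemma push_zero_mor:
  assumes "X \<in> lmod_ob R" "x \<in> families R S A X"
  shows "push S (zero_mor X Y) x = \<one>\<^bsub>family_group R S A Y\<^esub>"
  using families_closed[OF assms(2,1)]
  by (intro families_eqI[of _ S])
    (auto simp: push_extensional family_one_extensional family_one_apply push_apply zero_mor_def)

lemma small_families:
  assumes u: "universe_type TYPE('u)" and A: "finite A" and fp: "\<And>g. g \<in> A \<Longrightarrow> finitely_presented R (S g)"
    and X: "X \<in> lmod_ob R"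
  shows "small TYPE('u) (families R S A X)"
proof (rule small_inj_into)
  show "inj_on (\<lambda>x. restrict x A) (families R S A X)"
  proof (rule inj_onI)
    fix x y assume xy: "x \<in> families R S A X" "y \<in> families R S A X" and eq: "restrict x A = restrict y A"
    show "x = y"
    proof
      fix g show "x g = y g"
        using xy fun_cong[OF eq, of g] by (cases "g \<in> A") (auto simp: families_def)
    qed
  qed
  show "(\<lambda>x. restrict x A) ` families R S A X \<subseteq> (\<Pi>\<^sub>E g\<in>A. lmod_mor R (S g) X)"
    by (auto simp: families_def)
  show "small TYPE('u) (\<Pi>\<^sub>E g\<in>A. lmod_mor R (S g) X)"
    using small_lmod_mor[OF u fp X] by (intro small_finite_PiE[OF u A])
qed

text \<open>Each of the finitely many members of a family lifts to some index, or dies at some index,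
  and there is a common upper bound.\<close>

lemma families_limit_cocone:
  assumes A: "finite A" and fp: "\<And>g. g \<in> A \<Longrightarrow> finitely_presented R (S g)"
    and lim: "lmod_limit R I r X f L l"
  shows "limit_cocone I r (\<lambda>i. family_group R S A (X i)) (\<lambda>i j. push S (f i j))
    (family_group R S A L) (\<lambda>i. push S (l i))"
proof -
  note L = lmod_limitD[OF lim]
  note D = direct_system_lmodD[OF L(2)]
  note rel = directed_set_rel[OF L(1)]
  show ?thesis
    unfolding limit_cocone_def
  proof (intro conjI ballI impI)
    fix x assume x: "x \<in> carrier (family_group R S A L)"
    have "\<exists>i h. i \<in> I \<and> h \<in> lmod_mor R (S g) (X i) \<and> x g = compose (carrier (S g)) (l i) h" if "g \<in> A" for g
      by (rule finitely_presented_lift[OF fp[OF that] lim families_mor[of x R S A L g]])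
        (use x that in auto)
    then obtain m h where m: "\<And>g. g \<in> A \<Longrightarrow> m g \<in> I"
      and h: "\<And>g. g \<in> A \<Longrightarrow> h g \<in> lmod_mor R (S g) (X (m g)) \<and> x g = compose (carrier (S g)) (l (m g)) (h g)"
      by metis
    obtain i0 where "i0 \<in> I" using L(1) unfolding directed_set_def by blast
    then obtain i where i: "i \<in> I" "\<forall>g\<in>A. (m g, i) \<in> r"
      using directed_set_upper_finite[OF L(1) A, of m] m by blast
    define x' where "x' g = (if g \<in> A then compose (carrier (S g)) (f (m g) i) (h g) else zero_mor (S g) (X i))" for g
    have x': "x' \<in> families R S A (X i)"
    proof -
      have "compose (carrier (S g)) (f (m g) i) (h g) \<in> lmod_mor R (S g) (X i)" if "g \<in> A" for g
        using lmod_mor_compose[OF conjunct1[OF h[OF that]] D(2) lmod_ob_left_module[OF ob[OF that]]] i that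
        by blast
      then show ?thesis by (simp add: families_def x'_def)
    qed
    have "x = push S (l i) x'"
    proof (rule families_eqI[of _ S])
      fix g s assume s: "s \<in> carrier (S g)"
      show "x g s = push S (l i) x' g s"
      proof (cases "g \<in> A")
        case True
        then have r: "(m g, i) \<in> r" using i by blast
        have "h g s \<in> carrier (X (m g))"
          using lmod_mor_closed[OF conjunct1[OF h[OF True]] s] .
        then have "l (m g) (h g s) = l i (f (m g) i (h g s))"
          using L(5)[OF r] by (simp add: compose_def)
        then show ?thesis
          using True s h[OF True] by (simp add: push_apply x'_def compose_def)
      next
        case False
        then show ?thesis
          using x s lmod_mor_zero[OF L(4)[OF i(1)] D(1)[OF i(1)] L(3)]
          by (simp add: push_apply x'_def families_def zero_mor_def)
      qed
    qed (use x families_extensional push_extensional in \<open>auto\<close>)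
    then show "\<exists>i\<in>I. \<exists>x'\<in>carrier (family_group R S A (X i)). x = push S (l i) x'"
      using i(1) x' by auto
  next
    fix i x assume i: "i \<in> I" and x: "x \<in> carrier (family_group R S A (X i))"
      and dies: "push S (l i) x = \<one>\<^bsub>family_group R S A L\<^esub>"
    have zero: "compose (carrier (S g)) (l i) (x g) = zero_mor (S g) L" for g
      using fun_cong[OF dies, of g] by (simp add: push_def family_group_def)
    have "\<exists>j. j \<in> I \<and> (i, j) \<in> r \<and> compose (carrier (S g)) (f i j) (x g) = zero_mor (S g) (X j)"
      if "g \<in> A" for g
      by (rule finitely_presented_kernel[OF fp[OF that] lim i families_mor[of x R S A "X i" g] zero])
        (use x that in auto)
    then obtain m where m: "\<And>g. g \<in> A \<Longrightarrow> m g \<in> I \<and> (i, m g) \<in> r \<and>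
        compose (carrier (S g)) (f i (m g)) (x g) = zero_mor (S g) (X (m g))"
      by metis
    obtain j where j: "j \<in> I" "(i, j) \<in> r" "\<forall>g\<in>A. (m g, j) \<in> r"
      using directed_set_upper_finite[OF L(1) A, of m] m i by blast
    have "push S (f i j) x = \<one>\<^bsub>family_group R S A (X j)\<^esub>"
    proof (rule families_eqI[of _ S])
      fix g s assume s: "s \<in> carrier (S g)"
      have xs: "x g s \<in> carrier (X i)" using families_closed[of x R S A "X i" s g] D(1)[OF i] s x by simp
      show "push S (f i j) x g s = \<one>\<^bsub>family_group R S A (X j)\<^esub> g s"
      proof (cases "g \<in> A")
        case True
        then have r: "(i, m g) \<in> r" "(m g, j) \<in> r" using m j by auto
        have "f i j (x g s) = f (m g) j (f i (m g) (x g s))"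
          using D(4)[OF r] xs by (simp add: compose_def)
        also have "f i (m g) (x g s) = \<zero>\<^bsub>X (m g)\<^esub>"
          using fun_cong[OF conjunct2[OF conjunct2[OF m[OF True]]], of s] s
          by (simp add: compose_def zero_mor_def)
        also have "f (m g) j \<zero>\<^bsub>X (m g)\<^esub> = \<zero>\<^bsub>X j\<^esub>"
          using lmod_mor_zero[OF D(2)[OF r(2)] D(1) D(1)] rel(1)[OF r(2)] by blast
        finally show ?thesis
          using s by (simp add: push_apply family_one_apply)
      next
        case False
        then show ?thesis
          using x s lmod_mor_zero[OF D(2)[OF j(2)] D(1)[OF i] D(1)[OF j(1)]]
          by (simp add: push_apply family_one_apply families_def zero_mor_def)
      qed
    qed (simp_all add: push_extensional family_one_extensional)
    then show "\<exists>j\<in>I. (i, j) \<in> r \<and> push S (f i j) x = \<one>\<^bsub>family_group R S A (X j)\<^esub>"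
      using j by blast
  qed
qed

end

section \<open>Products of modules\<close>

lemma product_lmodD:
  assumes "product_lmod R I X P p"
  shows "P \<in> lmod_ob R" "\<And>i. i \<in> I \<Longrightarrow> p i \<in> lmod_mor R P (X i)"
    and "\<And>y z. y \<in> carrier P \<Longrightarrow> z \<in> carrier P \<Longrightarrow> (\<And>i. i \<in> I \<Longrightarrow> p i y = p i z) \<Longrightarrow> y = z"
    and "\<And>y. (\<And>i. i \<in> I \<Longrightarrow> y i \<in> carrier (X i)) \<Longrightarrow> \<exists>z\<in>carrier P. \<forall>i\<in>I. p i z = y i"
proof -
  note a = assms[unfolded product_lmod_def]
  show "P \<in> lmod_ob R" using a by blast
  show "\<And>i. i \<in> I \<Longrightarrow> p i \<in> lmod_mor R P (X i)"
    using a[THEN conjunct2, THEN conjunct1] by blast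
  have bij: "bij_betw (\<lambda>x. \<lambda>i\<in>I. p i x) (carrier P) (\<Pi>\<^sub>E i\<in>I. carrier (X i))"
    using assms unfolding product_lmod_def lmod_iso_def product_module_def by simp
  show "y = z" if "y \<in> carrier P" "z \<in> carrier P" "\<And>i. i \<in> I \<Longrightarrow> p i y = p i z" for y z
    by (rule inj_onD[OF bij_betw_imp_inj_on[OF bij] _ that(1,2)]) (auto simp: that(3))
  show "\<exists>z\<in>carrier P. \<forall>i\<in>I. p i z = y i" if "\<And>i. i \<in> I \<Longrightarrow> y i \<in> carrier (X i)" for y
  proof -
    have "restrict y I \<in> (\<lambda>x. \<lambda>i\<in>I. p i x) ` carrier P"
      using bij_betw_imp_surj_on[OF bij] that by simp
    then obtain z where z: "z \<in> carrier P" "restrict y I = (\<lambda>i\<in>I. p i z)"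
      by blast
    have "p i z = y i" if "i \<in> I" for i
      using fun_cong[OF z(2), of i] that by simp
    then show ?thesis using z(1) by blast
  qed
qed

lemma product_lmod_lift:
  assumes prod: "product_lmod R I X P p" and S: "S \<in> lmod_ob R"
    and h: "\<And>i. i \<in> I \<Longrightarrow> h i \<in> lmod_mor R S (X i)"
  obtains h' where "h' \<in> lmod_mor R S P" "\<And>i. i \<in> I \<Longrightarrow> compose (carrier S) (p i) h' = h i"
proof -
  note P = product_lmodD[OF prod]
  interpret S: left_module R S using S by (rule lmod_ob_left_module)
  interpret P: left_module R P using P(1) by (rule lmod_ob_left_module)
  have "\<exists>z\<in>carrier P. \<forall>i\<in>I. p i z = h i s" if "s \<in> carrier S" for s
    using lmod_mor_closed[OF h that] by (rule P(4))
  then obtain t where t: "\<And>s. s \<in> carrier S \<Longrightarrow> t s \<in> carrier P \<and> (\<forall>i\<in>I. p i (t s) = h i s)"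
    by metis
  define h' where "h' = restrict t (carrier S)"
  have h'P: "h' s \<in> carrier P" and ph': "\<And>i. i \<in> I \<Longrightarrow> p i (h' s) = h i s" if "s \<in> carrier S" for s
    using t[OF that] that by (auto simp: h'_def)
  have "h' \<in> lmod_mor R S P"
  proof (rule lmod_morI)
    show "h' (x \<oplus>\<^bsub>S\<^esub> y) = h' x \<oplus>\<^bsub>P\<^esub> h' y" if "x \<in> carrier S" "y \<in> carrier S" for x y
      by (rule P(3)) (use that in \<open>auto simp: h'P ph' lmod_mor_add[OF P(2)] lmod_mor_add[OF h]\<close>)
    show "h' (a \<odot>\<^bsub>S\<^esub> x) = a \<odot>\<^bsub>P\<^esub> h' x" if "a \<in> carrier R" "x \<in> carrier S" for a x
      by (rule P(3)) (use that in \<open>auto simp: h'P ph' S.smult_closed P.smult_closed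
        lmod_mor_smult[OF P(2)] lmod_mor_smult[OF h]\<close>)
  qed (use h'P in \<open>auto simp: h'_def\<close>)
  moreover have "compose (carrier S) (p i) h' = h i" if "i \<in> I" for i
    using ph' that h[OF that]
    by (intro extensionalityI[of _ "carrier S"]) (auto simp: compose_def lmod_mor_def)
  ultimately show ?thesis using that by blast
qed

lemma families_product_lift:
  assumes ob: "\<And>g. g \<in> A \<Longrightarrow> S g \<in> lmod_ob R" and prod: "product_lmod R I X P p"
    and X: "\<And>i. i \<in> I \<Longrightarrow> X i \<in> lmod_ob R"
    and x: "\<And>i. i \<in> I \<Longrightarrow> x i \<in> families R S A (X i)"
  obtains y where "y \<in> families R S A P" "\<And>i. i \<in> I \<Longrightarrow> push S (p i) y = x i"
proof -
  note P = product_lmodD[OF prod]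
  have "\<exists>h. h \<in> lmod_mor R (S g) P \<and> (\<forall>i\<in>I. compose (carrier (S g)) (p i) h = x i g)" if g: "g \<in> A" for g
  proof -
    have "x i g \<in> lmod_mor R (S g) (X i)" if "i \<in> I" for i
      using families_mor[OF x[OF that] g] .
    then obtain h' where "h' \<in> lmod_mor R (S g) P" "\<And>i. i \<in> I \<Longrightarrow> compose (carrier (S g)) (p i) h' = x i g"
      using product_lmod_lift[OF prod ob[OF g], of "\<lambda>i. x i g"] by blast
    then show ?thesis by blast
  qed
  then obtain h where h: "\<And>g. g \<in> A \<Longrightarrow> h g \<in> lmod_mor R (S g) P"
    "\<And>g i. g \<in> A \<Longrightarrow> i \<in> I \<Longrightarrow> compose (carrier (S g)) (p i) (h g) = x i g"
    by metis
  define y where "y g = (if g \<in> A then h g else zero_mor (S g) P)" for g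
  have "y \<in> families R S A P"
    using h(1) by (simp add: y_def families_def)
  moreover have "push S (p i) y = x i" if i: "i \<in> I" for i
  proof
    fix g show "push S (p i) y g = x i g"
      using h(2)[OF _ i] x[OF i] lmod_mor_zero[OF P(2)[OF i] P(1) X[OF i]]
      by (cases "g \<in> A") (auto simp: push_def y_def families_def zero_mor_def compose_def)
  qed
  ultimately show ?thesis using that by blast
qed

lemma families_product_eqI:
  assumes prod: "product_lmod R I X P p"
    and x: "x \<in> families R S A P" and y: "y \<in> families R S A P"
    and eq: "\<And>i. i \<in> I \<Longrightarrow> push S (p i) x = push S (p i) y"
  shows "x = y"
proof (rule families_eqI[of _ S])
  note P = product_lmodD[OF prod]
  fix g s assume s: "s \<in> carrier (S g)"
  have "p i (x g s) = p i (y g s)" if "i \<in> I" for i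
    using fun_cong[OF fun_cong[OF eq[OF that], of g], of s] s by (simp add: push_apply)
  then show "x g s = y g s"
    using P(3) families_closed[OF x P(1) s] families_closed[OF y P(1) s] by blast
qed (rule families_extensional[OF x] families_extensional[OF y])+

section \<open>Finitely presented functors\<close>

definition relation_map ::
    "('r, 's) ring_scheme \<Rightarrow> ('g \<Rightarrow> ('r, 'u) module) \<Rightarrow> 'g set \<Rightarrow> 'b set \<Rightarrow>
     ('b \<Rightarrow> 'g \<Rightarrow> 'u \<Rightarrow> 'u) \<Rightarrow> ('r, 'u) module \<Rightarrow> ('b \<Rightarrow> 'u \<Rightarrow> 'u) \<Rightarrow> 'g \<Rightarrow> 'u \<Rightarrow> 'u" where
  "relation_map R S A B h X k = finprod (family_group R S A X) (\<lambda>b. push S (k b) (h b)) B"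

definition cokernel ::
    "('r, 's) ring_scheme \<Rightarrow> ('g \<Rightarrow> ('r, 'u) module) \<Rightarrow> 'g set \<Rightarrow> ('b \<Rightarrow> ('r, 'u) module) \<Rightarrow>
     'b set \<Rightarrow> ('b \<Rightarrow> 'g \<Rightarrow> 'u \<Rightarrow> 'u) \<Rightarrow> ('r, 'u) module \<Rightarrow> 'u monoid \<times> (('g \<Rightarrow> 'u \<Rightarrow> 'u) \<Rightarrow> 'u)" where
  "cokernel R S A T B h X = (SOME p. fst p \<in> ab_ob \<and>
     quotient_map (family_group R S A X) (relation_map R S A B h X ` families R T B X) (snd p) (fst p))"

text \<open>This is the functor \<open>Coker (\<Oplus>b\<in>B. Hom(T b, X) \<rightarrow> \<Oplus>g\<in>A. Hom(S g, X))\<close>, where \<open>k\<close> is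
  sent to \<open>\<Sum>b\<in>B. k b \<circ> h b\<close>.\<close>

definition cokernel_functor ::
    "('r, 's) ring_scheme \<Rightarrow> ('g \<Rightarrow> ('r, 'u) module) \<Rightarrow> 'g set \<Rightarrow> ('b \<Rightarrow> ('r, 'u) module) \<Rightarrow>
     'b set \<Rightarrow> ('b \<Rightarrow> 'g \<Rightarrow> 'u \<Rightarrow> 'u) \<Rightarrow> ('r, 'u) lmod_functor" where
  "cokernel_functor R S A T B h =
     \<lparr>fobj = (\<lambda>X. fst (cokernel R S A T B h X)),
      fmor = (\<lambda>X Y f. factor_map (family_group R S A X) (snd (cokernel R S A T B h X))
        (fst (cokernel R S A T B h X)) (\<lambda>x. snd (cokernel R S A T B h Y) (push S f x)))\<rparr>"

locale functor_presentation =
  fixes R :: "('r, 's) ring_scheme" and S :: "'g \<Rightarrow> ('r, 'u) module" and A :: "'g set"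
    and T :: "'b \<Rightarrow> ('r, 'u) module" and B :: "'b set" and h :: "'b \<Rightarrow> 'g \<Rightarrow> 'u \<Rightarrow> 'u"
  assumes universe: "universe_type TYPE('u)"
    and A: "finite A" and S: "\<And>g. g \<in> A \<Longrightarrow> finitely_presented R (S g)"
    and B: "finite B" and T: "\<And>b. b \<in> B \<Longrightarrow> finitely_presented R (T b)"
    and h: "\<And>b. b \<in> B \<Longrightarrow> h b \<in> families R S A (T b)"
begin

abbreviation "E X \<equiv> family_group R S A X"
abbreviation "K X \<equiv> family_group R T B X"
abbreviation "d X \<equiv> relation_map R S A B h X"
abbreviation "D X \<equiv> d X ` families R T B X"
abbreviation "F \<equiv> cokernel_functor R S A T B h"
abbreviation "q X \<equiv> snd (cokernel R S A T B h X)"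

lemma S_ob: "g \<in> A \<Longrightarrow> S g \<in> lmod_ob R"
  using S finitely_presented_ob by blast

lemma T_ob: "b \<in> B \<Longrightarrow> T b \<in> lmod_ob R"
  using T finitely_presented_ob by blast

lemma E_group: "X \<in> lmod_ob R \<Longrightarrow> comm_group (E X)"
  using family_comm_group[where A = A and S = S] S_ob by blast

lemma K_group: "X \<in> lmod_ob R \<Longrightarrow> comm_group (K X)"
  using family_comm_group[where A = B and S = T] T_ob by blast

lemma E_push_hom:
  assumes "f \<in> lmod_mor R X Y" "X \<in> lmod_ob R" "Y \<in> lmod_ob R"
  shows "push S f \<in> hom (E X) (E Y)"
  by (rule push_hom[where S = S and A = A, OF S_ob assms])

lemma E_push_closed:
  assumes "f \<in> lmod_mor R X Y" "X \<in> lmod_ob R" "Y \<in> lmod_ob R" "x \<in> families R S A X"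
  shows "push S f x \<in> families R S A Y"
  by (rule push_closed[where S = S and A = A, OF S_ob assms])

lemma K_push_closed:
  assumes "f \<in> lmod_mor R X Y" "X \<in> lmod_ob R" "Y \<in> lmod_ob R" "x \<in> families R T B X"
  shows "push T f x \<in> families R T B Y"
  by (rule push_closed[where S = T and A = B, OF T_ob assms])

lemma relation_closed:
  assumes "X \<in> lmod_ob R" "k \<in> families R T B X" "b \<in> B"
  shows "push S (k b) (h b) \<in> families R S A X"
  using E_push_closed[OF families_mor[OF assms(2,3)] T_ob[OF assms(3)] assms(1) h[OF assms(3)]] .

lemma d_hom:
  assumes X: "X \<in> lmod_ob R"
  shows "d X \<in> hom (K X) (E X)"
proof (rule homI)
  interpret E: comm_group "E X" using E_group[OF X] .
  show "d X k \<in> carrier (E X)" if "k \<in> carrier (K X)" for k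
    unfolding relation_map_def using relation_closed[OF X] that by (intro E.finprod_closed) auto
  fix k k' assume k: "k \<in> carrier (K X)" "k' \<in> carrier (K X)"
  have "push S ((k \<otimes>\<^bsub>K X\<^esub> k') b) (h b) = push S (k b) (h b) \<otimes>\<^bsub>E X\<^esub> push S (k' b) (h b)" if b: "b \<in> B" for b
  proof -
    have "(k \<otimes>\<^bsub>K X\<^esub> k') b = (\<lambda>s\<in>carrier (T b). k b s \<oplus>\<^bsub>X\<^esub> k' b s)"
      by (simp add: family_group_def)
    then show ?thesis
      using push_add[where S = S and A = A, OF S_ob T_ob[OF b] h[OF b]] by simp
  qed
  then have "d X (k \<otimes>\<^bsub>K X\<^esub> k') = finprod (E X) (\<lambda>b. push S (k b) (h b) \<otimes>\<^bsub>E X\<^esub> push S (k' b) (h b)) B"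
    unfolding relation_map_def using relation_closed[OF X] k E.m_closed[simplified]
    by (intro E.finprod_cong') auto
  also have "\<dots> = d X k \<otimes>\<^bsub>E X\<^esub> d X k'"
    unfolding relation_map_def using relation_closed[OF X] k by (intro E.finprod_multf) auto
  finally show "d X (k \<otimes>\<^bsub>K X\<^esub> k') = d X k \<otimes>\<^bsub>E X\<^esub> d X k'" .
qed

lemma d_closed: "X \<in> lmod_ob R \<Longrightarrow> k \<in> families R T B X \<Longrightarrow> d X k \<in> families R S A X"
  using hom_in_carrier[OF d_hom] by simp

lemma d_natural:
  assumes f: "f \<in> lmod_mor R X Y" and X: "X \<in> lmod_ob R" and Y: "Y \<in> lmod_ob R"
    and k: "k \<in> families R T B X"
  shows "push S f (d X k) = d Y (push T f k)"
proof -
  interpret E: comm_group "E Y" using E_group[OF Y] .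
  have "push S f (d X k) = finprod (E Y) (\<lambda>b. push S f (push S (k b) (h b))) B"
    unfolding relation_map_def
    using hom_finprod[OF E_group[OF X] E_group[OF Y] E_push_hom[OF f X Y] B] relation_closed[OF X k]
    by simp
  also have "\<dots> = d Y (push T f k)"
    unfolding relation_map_def
  proof (rule E.finprod_cong')
    show "push S f (push S (k b) (h b)) = push S (push T f k b) (h b)" if "b \<in> B" for b
      using push_compose[where S = S and A = A, OF S_ob T_ob[OF that] h[OF that], of f "k b"] by (simp add: push_def)
    show "(\<lambda>b. push S (push T f k b) (h b)) \<in> B \<rightarrow> carrier (E Y)"
      using relation_closed[OF Y K_push_closed[OF f X Y k]] by simp
  qed simp
  finally show ?thesis .
qed

lemma D_subgroup:
  assumes X: "X \<in> lmod_ob R"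
  shows "subgroup (D X) (E X)"
proof -
  interpret E: comm_group "E X" using E_group[OF X] .
  interpret K: comm_group "K X" using K_group[OF X] .
  interpret d: group_hom "K X" "E X" "d X"
    using d_hom[OF X] E.is_group K.is_group by (auto simp: group_hom_def group_hom_axioms_def)
  show ?thesis using d.img_is_subgroup by simp
qed

lemma quotient:
  assumes X: "X \<in> lmod_ob R"
  shows "fobj F X \<in> ab_ob" "quotient_map (E X) (D X) (q X) (fobj F X)"
proof -
  have "\<exists>p :: 'u monoid \<times> _. fst p \<in> ab_ob \<and> quotient_map (E X) (D X) (snd p) (fst p)"
    using small_quotient_exists[OF E_group[OF X] D_subgroup[OF X]]
      small_families[where S = S and A = A, OF S_ob universe A S X] by simp
  from someI_ex[OF this] show "fobj F X \<in> ab_ob" "quotient_map (E X) (D X) (q X) (fobj F X)"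
    unfolding cokernel_functor_def cokernel_def by simp_all
qed

lemma q_hom: "X \<in> lmod_ob R \<Longrightarrow> q X \<in> hom (E X) (fobj F X)"
  using quotient(2) unfolding quotient_map_def by blast

lemma q_closed: "X \<in> lmod_ob R \<Longrightarrow> x \<in> families R S A X \<Longrightarrow> q X x \<in> carrier (fobj F X)"
  using hom_in_carrier[OF q_hom] by simp

lemma q_eq_one_iff:
  "X \<in> lmod_ob R \<Longrightarrow> x \<in> families R S A X \<Longrightarrow> q X x = \<one>\<^bsub>fobj F X\<^esub> \<longleftrightarrow> x \<in> D X"
  using quotient(2)[of X] unfolding quotient_map_def by simp

lemma q_surj:
  assumes "X \<in> lmod_ob R" "y \<in> carrier (fobj F X)"
  obtains x where "x \<in> families R S A X" "y = q X x"
  using quotient_map_surj[OF quotient(2)[OF assms(1)] assms(2)] by auto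

lemma F_comm_group: "X \<in> lmod_ob R \<Longrightarrow> comm_group (fobj F X)"
  using quotient(2) unfolding quotient_map_def by blast

context
  fixes X Y :: "('r, 'u) module" and f
  assumes f: "f \<in> lmod_mor R X Y" and X: "X \<in> lmod_ob R" and Y: "Y \<in> lmod_ob R"
begin

lemma q_push_hom: "(\<lambda>x. q Y (push S f x)) \<in> hom (E X) (fobj F Y)"
  using hom_compose[OF E_push_hom[OF f X Y] q_hom[OF Y]] by (simp add: comp_def)

lemma q_push_kills:
  assumes "x \<in> D X"
  shows "q Y (push S f x) = \<one>\<^bsub>fobj F Y\<^esub>"
proof -
  obtain k where k: "k \<in> families R T B X" "x = d X k" using assms by blast
  then have "push S f x \<in> D Y"
    using d_natural[OF f X Y] K_push_closed[OF f X Y] by auto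
  moreover have "push S f x \<in> families R S A Y"
    using E_push_closed[OF f X Y d_closed[OF X k(1)]] k(2) by simp
  ultimately show ?thesis
    using q_eq_one_iff[OF Y] by blast
qed

lemma F_apply:
  assumes "x \<in> families R S A X"
  shows "fmor F X Y f (q X x) = q Y (push S f x)"
proof -
  have "fmor F X Y f = factor_map (E X) (q X) (fobj F X) (\<lambda>x. q Y (push S f x))"
    by (simp add: cokernel_functor_def)
  then show ?thesis
    using factor_map_apply[OF quotient(2)[OF X] _ q_push_hom q_push_kills] assms F_comm_group[OF Y]
    by (simp add: comm_group_def)
qed

lemma F_ab_mor: "fmor F X Y f \<in> ab_mor (fobj F X) (fobj F Y)"
proof -
  have "fmor F X Y f = factor_map (E X) (q X) (fobj F X) (\<lambda>x. q Y (push S f x))"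
    by (simp add: cokernel_functor_def)
  then show ?thesis
    using factor_map_ab_mor[OF quotient(2)[OF X] F_comm_group[OF Y] q_push_hom q_push_kills] by simp
qed

end

lemma F_additive: "additive_functor R F"
  unfolding additive_functor_def
proof (intro conjI ballI)
  show "fobj F X \<in> ab_ob" if "X \<in> lmod_ob R" for X
    using quotient(1)[OF that] .
  show "fmor F X Y f \<in> ab_mor (fobj F X) (fobj F Y)"
    if "X \<in> lmod_ob R" "Y \<in> lmod_ob R" "f \<in> lmod_mor R X Y" for X Y :: "('r, 'u) module" and f
    using F_ab_mor that by blast
  have ext: "fmor F X Y f \<in> extensional (carrier (fobj F X))" for X Y :: "('r, 'u) module" and f
    by (simp add: cokernel_functor_def factor_map_def)
  have eqI: "u = v"
    if "X \<in> lmod_ob R" "u \<in> extensional (carrier (fobj F X))" "v \<in> extensional (carrier (fobj F X))"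
      "\<And>x. x \<in> families R S A X \<Longrightarrow> u (q X x) = v (q X x)" for X :: "('r, 'u) module" and u v :: "'u \<Rightarrow> 'u"
    using that q_surj by (intro extensionalityI[OF that(2,3)]) metis
  show "fmor F X X (\<lambda>x\<in>carrier X. x) = (\<lambda>x\<in>carrier (fobj F X). x)" if X: "X \<in> lmod_ob R" for X :: "('r, 'u) module"
  proof (rule eqI[OF X ext])
    fix x assume x: "x \<in> families R S A X"
    show "fmor F X X (\<lambda>x\<in>carrier X. x) (q X x) = (\<lambda>x\<in>carrier (fobj F X). x) (q X x)"
      using F_apply[OF lmod_mor_id[OF lmod_ob_left_module[OF X]] X X x] push_id[where S = S and A = A, OF S_ob X x]
        q_closed[OF X x] by simp
  qed simp
  fix X Y :: "('r, 'u) module" assume X: "X \<in> lmod_ob R" and Y: "Y \<in> lmod_ob R"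
  show "fmor F X Z (compose (carrier X) g f) = compose (carrier (fobj F X)) (fmor F Y Z g) (fmor F X Y f)"
    if Z: "Z \<in> lmod_ob R" and f: "f \<in> lmod_mor R X Y" and g: "g \<in> lmod_mor R Y Z"
    for Z :: "('r, 'u) module" and f g
  proof (rule eqI[OF X ext])
    fix x assume x: "x \<in> families R S A X"
    note gf = lmod_mor_compose[OF f g lmod_ob_left_module[OF X]]
    show "fmor F X Z (compose (carrier X) g f) (q X x) =
        compose (carrier (fobj F X)) (fmor F Y Z g) (fmor F X Y f) (q X x)"
      using F_apply[OF gf X Z x] push_compose[where S = S and A = A, OF S_ob X x] q_closed[OF X x] F_apply[OF f X Y x]
        F_apply[OF g Y Z E_push_closed[OF f X Y x]] by (simp add: compose_def)
  qed (simp add: compose_def)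
  show "fmor F X Y (\<lambda>x\<in>carrier X. f x \<oplus>\<^bsub>Y\<^esub> g x) =
      (\<lambda>x\<in>carrier (fobj F X). fmor F X Y f x \<otimes>\<^bsub>fobj F Y\<^esub> fmor F X Y g x)"
    if f: "f \<in> lmod_mor R X Y" and g: "g \<in> lmod_mor R X Y" for f g
  proof (rule eqI[OF X ext])
    fix x assume x: "x \<in> families R S A X"
    show "fmor F X Y (\<lambda>x\<in>carrier X. f x \<oplus>\<^bsub>Y\<^esub> g x) (q X x) =
        (\<lambda>x\<in>carrier (fobj F X). fmor F X Y f x \<otimes>\<^bsub>fobj F Y\<^esub> fmor F X Y g x) (q X x)"
      using F_apply[OF lmod_mor_sum[OF f g X Y] X Y x] push_add[where S = S and A = A and Y = Y, OF S_ob X x] q_closed[OF X x]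
        F_apply[OF f X Y x] F_apply[OF g X Y x] hom_mult[OF q_hom[OF Y]]
        E_push_closed[OF f X Y x] E_push_closed[OF g X Y x] by simp
  qed simp
qed

text \<open>If the image of \<open>x\<close> in the limit is \<open>d k\<close>, then \<open>k\<close> comes from some index, and \<open>x\<close>
  becomes equal to the corresponding value of \<open>d\<close> at a later index.\<close>

lemma F_preserves_direct_limits: "preserves_direct_limits R F"
  unfolding preserves_direct_limits_iff[OF F_additive]
proof (intro allI impI)
  fix I :: "'u set" and r and X :: "'u \<Rightarrow> ('r, 'u) module" and f L l
  assume lim: "lmod_limit R I r X f L l"
  note L = lmod_limitD[OF lim]
  note Ds = direct_system_lmodD[OF L(2)]
  note rel = directed_set_rel[OF L(1)]
  note EL = families_limit_cocone[where S = S and A = A, OF S_ob A S lim]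
  note KL = families_limit_cocone[where S = T and A = B, OF T_ob B T lim]
  show "functor_limit F I r X f L l"
    unfolding limit_cocone_def
  proof (intro conjI ballI impI)
    fix y assume "y \<in> carrier (fobj F L)"
    then obtain x where x: "x \<in> families R S A L" "y = q L x"
      using q_surj[OF L(3)] by blast
    obtain i x' where x': "i \<in> I" "x' \<in> families R S A (X i)" "x = push S (l i) x'"
      using limit_cocone_surj[OF EL, of x] x by auto
    then have "y = fmor F (X i) L (l i) (q (X i) x')"
      using x F_apply[OF L(4) Ds(1) L(3)] by simp
    then show "\<exists>i\<in>I. \<exists>x\<in>carrier (fobj F (X i)). y = fmor F (X i) L (l i) x"
      using x' q_closed[OF Ds(1)] by blast
  next
    fix i y assume i: "i \<in> I" and y: "y \<in> carrier (fobj F (X i))"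
      and dies: "fmor F (X i) L (l i) y = \<one>\<^bsub>fobj F L\<^esub>"
    note Xi = Ds(1)[OF i]
    obtain x where x: "x \<in> families R S A (X i)" "y = q (X i) x"
      using q_surj[OF Xi y] .
    have "push S (l i) x \<in> D L"
      using dies x F_apply[OF L(4)[OF i] Xi L(3) x(1)]
        q_eq_one_iff[OF L(3) E_push_closed[OF L(4)[OF i] Xi L(3) x(1)]] by simp
    then obtain k where k: "k \<in> families R T B L" "push S (l i) x = d L k"
      by blast
    obtain j k' where k': "j \<in> I" "k' \<in> families R T B (X j)" "k = push T (l j) k'"
      using limit_cocone_surj[OF KL, of k] k by auto
    obtain m where m: "m \<in> I" "(i, m) \<in> r" "(j, m) \<in> r"
      using directed_set_upper[OF L(1) i k'(1)] .
    note Xj = Ds(1)[OF k'(1)] and Xm = Ds(1)[OF m(1)]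
    let ?x = "push S (f i m) x" and ?k = "push T (f j m) k'"
    have xm: "?x \<in> families R S A (X m)" and km: "?k \<in> families R T B (X m)"
      using E_push_closed[OF Ds(2)[OF m(2)] Xi Xm x(1)] K_push_closed[OF Ds(2)[OF m(3)] Xj Xm k'(2)] .
    have "push S (l m) ?x = push S (l i) x"
      using push_compose[where S = S and A = A, OF S_ob Xi x(1), of "l m" "f i m"] L(5)[OF m(2)] by simp
    also have "\<dots> = d L (push T (l m) ?k)"
      using push_compose[where S = T and A = B, OF T_ob Xj k'(2), of "l m" "f j m"] L(5)[OF m(3)] k k' by simp
    also have "\<dots> = push S (l m) (d (X m) ?k)"
      using d_natural[OF L(4)[OF m(1)] Xm L(3) km] by simp
    finally have eq: "push S (l m) ?x = push S (l m) (d (X m) ?k)" .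
    interpret Em: comm_group "E (X m)" using E_group[OF Xm] .
    interpret EL: comm_group "E L" using E_group[OF L(3)] .
    interpret lm: group_hom "E (X m)" "E L" "push S (l m)"
      using E_push_hom[OF L(4)[OF m(1)] Xm L(3)] Em.is_group EL.is_group
      by (auto simp: group_hom_def group_hom_axioms_def)
    \<comment> \<open>At \<open>m\<close>, the elements \<open>x\<close> and \<open>d k\<close> need not agree yet, but their quotient dies in the
      limit.\<close>
    let ?z = "?x \<otimes>\<^bsub>E (X m)\<^esub> inv\<^bsub>E (X m)\<^esub> d (X m) ?k"
    have dk: "d (X m) ?k \<in> carrier (E (X m))" and xm': "?x \<in> carrier (E (X m))"
      using d_closed[OF Xm km] xm by simp_all
    have z: "?z \<in> carrier (E (X m))" using xm' dk by blast
    have "push S (l m) ?z = \<one>\<^bsub>E L\<^esub>"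
      using lm.hom_mult[OF xm' Em.inv_closed[OF dk]] lm.hom_inv[OF dk] eq lm.hom_closed[OF dk] by simp
    then obtain n where n: "n \<in> I" "(m, n) \<in> r" "push S (f m n) ?z = \<one>\<^bsub>E (X n)\<^esub>"
      using limit_cocone_kernel[OF EL m(1) z] by blast
    note Xn = Ds(1)[OF n(1)] and fn = Ds(2)[OF n(2)]
    interpret En: comm_group "E (X n)" using E_group[OF Xn] .
    interpret fn: group_hom "E (X m)" "E (X n)" "push S (f m n)"
      using E_push_hom[OF fn Xm Xn] Em.is_group En.is_group
      by (auto simp: group_hom_def group_hom_axioms_def)
    have "push S (f m n) ?x \<otimes>\<^bsub>E (X n)\<^esub> inv\<^bsub>E (X n)\<^esub> push S (f m n) (d (X m) ?k) = \<one>\<^bsub>E (X n)\<^esub>"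
      using n(3) fn.hom_mult[OF xm' Em.inv_closed[OF dk]] fn.hom_inv[OF dk] by simp
    then have "push S (f m n) ?x = push S (f m n) (d (X m) ?k)"
      using En.mult_inv_eq_one_iff[OF fn.hom_closed[OF xm'] fn.hom_closed[OF dk]] by blast
    also have "push S (f m n) ?x = push S (f i n) x"
      using push_compose[where S = S and A = A, OF S_ob Xi x(1), of "f m n" "f i m"] Ds(4)[OF m(2) n(2)] by simp
    also have "push S (f m n) (d (X m) ?k) = d (X n) (push T (f m n) ?k)"
      using d_natural[OF fn Xm Xn km] .
    finally have "push S (f i n) x \<in> D (X n)"
      using K_push_closed[OF fn Xm Xn km] by blast
    moreover have r: "(i, n) \<in> r" using rel(3)[OF m(2) n(2)] .
    ultimately have "fmor F (X i) (X n) (f i n) y = \<one>\<^bsub>fobj F (X n)\<^esub>"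
      using x F_apply[OF Ds(2)[OF r] Xi Xn x(1)]
        q_eq_one_iff[OF Xn E_push_closed[OF Ds(2)[OF r] Xi Xn x(1)]] by simp
    then show "\<exists>j\<in>I. (i, j) \<in> r \<and> fmor F (X i) (X j) (f i j) y = \<one>\<^bsub>fobj F (X j)\<^esub>"
      using n(1) r by blast
  qed
qed

text \<open>Both families of representatives and families of relations can be collected into one
  morphism to the product.\<close>

lemma F_preserves_products: "preserves_products R F"
  unfolding preserves_products_def
proof (intro allI impI)
  fix I :: "'u set" and X :: "'u \<Rightarrow> ('r, 'u) module" and P p
  assume X: "\<forall>i\<in>I. X i \<in> lmod_ob R" and prod: "product_lmod R I X P p"
  note P = product_lmodD[OF prod]
  have Xi: "X i \<in> lmod_ob R" if "i \<in> I" for i using X that by blast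
  let ?N = "\<lambda>y. \<lambda>i\<in>I. fmor F P (X i) (p i) y"
  let ?G = "product_group I (\<lambda>i. fobj F (X i))"
  note hom = functor_hom[OF F_additive P(1) Xi P(2)]
  have N: "?N \<in> hom (fobj F P) ?G"
    by (rule homI) (use hom in \<open>auto simp: hom_def\<close>)
  have "group (fobj F P)" "group ?G"
    using functor_group[OF F_additive] P(1) Xi by auto
  then interpret N: group_hom "fobj F P" ?G ?N
    using N by (auto simp: group_hom_def group_hom_axioms_def)
  show "?N \<in> iso (fobj F P) ?G"
    unfolding N.iso_iff
  proof (intro conjI ballI impI)
    fix y assume y: "y \<in> carrier (fobj F P)" and one: "?N y = \<one>\<^bsub>?G\<^esub>"
    obtain x where x: "x \<in> families R S A P" "y = q P x" using q_surj[OF P(1) y] .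
    have "push S (p i) x \<in> D (X i)" if i: "i \<in> I" for i
    proof -
      have "fmor F P (X i) (p i) y = \<one>\<^bsub>fobj F (X i)\<^esub>"
        using fun_cong[OF one, of i] i by simp
      then show ?thesis
        using x F_apply[OF P(2)[OF i] P(1) Xi[OF i] x(1)]
          q_eq_one_iff[OF Xi[OF i] E_push_closed[OF P(2)[OF i] P(1) Xi[OF i] x(1)]] by simp
    qed
    then have "\<exists>k. k \<in> families R T B (X i) \<and> push S (p i) x = d (X i) k" if "i \<in> I" for i
      using that by blast
    then obtain k where k: "\<And>i. i \<in> I \<Longrightarrow> k i \<in> families R T B (X i)"
      "\<And>i. i \<in> I \<Longrightarrow> push S (p i) x = d (X i) (k i)"
      by metis
    obtain k' where k': "k' \<in> families R T B P" "\<And>i. i \<in> I \<Longrightarrow> push T (p i) k' = k i"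
      using families_product_lift[where S = T and A = B, OF T_ob prod Xi k(1)] by blast
    have "x = d P k'"
    proof (rule families_product_eqI[OF prod x(1) d_closed[OF P(1) k'(1)]])
      show "push S (p i) x = push S (p i) (d P k')" if "i \<in> I" for i
        using d_natural[OF P(2)[OF that] P(1) Xi[OF that] k'(1)] k(2)[OF that] k'(2)[OF that] by simp
    qed
    then show "y = \<one>\<^bsub>fobj F P\<^esub>"
      using x k'(1) q_eq_one_iff[OF P(1) x(1)] by blast
  next
    show "carrier ?G \<subseteq> ?N ` carrier (fobj F P)"
    proof
      fix y assume y: "y \<in> carrier ?G"
      have "\<exists>x. x \<in> families R S A (X i) \<and> y i = q (X i) x" if i: "i \<in> I" for i
      proof -
        have "y i \<in> carrier (fobj F (X i))" using y i by (auto simp: PiE_def)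
        then show ?thesis by (rule q_surj[OF Xi[OF i]]) blast
      qed
      then obtain x where x: "\<And>i. i \<in> I \<Longrightarrow> x i \<in> families R S A (X i)"
        "\<And>i. i \<in> I \<Longrightarrow> y i = q (X i) (x i)"
        by metis
      obtain x' where x': "x' \<in> families R S A P" "\<And>i. i \<in> I \<Longrightarrow> push S (p i) x' = x i"
        using families_product_lift[where S = S and A = A, OF S_ob prod Xi x(1)] by blast
      have "y = ?N (q P x')"
      proof (rule extensionalityI)
        show "y \<in> extensional I" using y by (simp add: PiE_def)
        show "y i = ?N (q P x') i" if "i \<in> I" for i
          using x(2)[OF that] x'(2)[OF that] F_apply[OF P(2)[OF that] P(1) Xi[OF that] x'(1)] that
          by simp
      qed simp
      then show "y \<in> ?N ` carrier (fobj F P)"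
        using q_closed[OF P(1) x'(1)] by (rule image_eqI)
    qed
  qed
qed

lemma F_FP: "FP_module R F"
  unfolding FP_module_def using F_additive F_preserves_direct_limits F_preserves_products by blast

end

section \<open>Evaluation of families at elements of a functor\<close>

text \<open>The zero morphism is idempotent under addition, and so is its image.\<close>

lemma functor_zero:
  assumes M: "additive_functor R M" and S: "S \<in> lmod_ob R" and T: "T \<in> lmod_ob R"
    and x: "x \<in> carrier (fobj M S)"
  shows "fmor M S T (zero_mor S T) x = \<one>\<^bsub>fobj M T\<^esub>"
proof -
  interpret T: left_module R T using T by (rule lmod_ob_left_module)
  interpret MT: comm_group "fobj M T" using functor_ob[OF M T] .
  note z = zero_mor[OF S T]
  have "(\<lambda>s\<in>carrier S. zero_mor S T s \<oplus>\<^bsub>T\<^esub> zero_mor S T s) = zero_mor S T"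
    by (auto simp: zero_mor_def)
  then have "fmor M S T (zero_mor S T) x =
      fmor M S T (zero_mor S T) x \<otimes>\<^bsub>fobj M T\<^esub> fmor M S T (zero_mor S T) x"
    using functor_add[OF M S T z z x] by simp
  then show ?thesis
    using functor_closed[OF M S T z x] MT.l_cancel_one' by blast
qed

text \<open>By the Yoneda lemma, a family of elements \<open>m g \<in> M (S g)\<close> is a natural transformation
  from \<open>\<Oplus>g\<in>A. Hom(S g, X)\<close> to \<open>M X\<close>.\<close>

definition evaluation ::
    "('r, 'u) lmod_functor \<Rightarrow> ('g \<Rightarrow> ('r, 'u) module) \<Rightarrow> ('g \<Rightarrow> 'u) \<Rightarrow> 'g set \<Rightarrow>
     ('r, 'u) module \<Rightarrow> ('g \<Rightarrow> 'u \<Rightarrow> 'u) \<Rightarrow> 'u" where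
  "evaluation M S m A X x = finprod (fobj M X) (\<lambda>g. fmor M (S g) X (x g) (m g)) A"

context
  fixes R :: "('r, 's) ring_scheme" and M :: "('r, 'u) lmod_functor"
    and S :: "'g \<Rightarrow> ('r, 'u) module" and m :: "'g \<Rightarrow> 'u" and A :: "'g set"
  assumes M: "additive_functor R M" and A: "finite A" and S: "\<And>g. g \<in> A \<Longrightarrow> S g \<in> lmod_ob R"
    and m: "\<And>g. g \<in> A \<Longrightarrow> m g \<in> carrier (fobj M (S g))"
begin

lemma evaluation_summand_closed:
  assumes "X \<in> lmod_ob R" "x \<in> families R S A X" "g \<in> A"
  shows "fmor M (S g) X (x g) (m g) \<in> carrier (fobj M X)"
  using functor_closed[OF M S[OF assms(3)] assms(1) families_mor[OF assms(2,3)] m[OF assms(3)]] .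

lemma evaluation_hom:
  assumes X: "X \<in> lmod_ob R"
  shows "evaluation M S m A X \<in> hom (family_group R S A X) (fobj M X)"
proof (rule homI)
  let ?E = "family_group R S A X"
  let ?ev = "evaluation M S m A X"
  interpret MX: comm_group "fobj M X" using functor_ob[OF M X] .
  note closed = evaluation_summand_closed[OF X]
  show "?ev x \<in> carrier (fobj M X)" if "x \<in> carrier (?E)" for x
    unfolding evaluation_def using closed that by (intro MX.finprod_closed) auto
  fix x y assume xy: "x \<in> carrier (?E)" "y \<in> carrier (?E)"
  have "fmor M (S g) X ((x \<otimes>\<^bsub>?E\<^esub> y) g) (m g) =
      fmor M (S g) X (x g) (m g) \<otimes>\<^bsub>fobj M X\<^esub> fmor M (S g) X (y g) (m g)" if g: "g \<in> A" for g
  proof -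
    have "(x \<otimes>\<^bsub>?E\<^esub> y) g = (\<lambda>s\<in>carrier (S g). x g s \<oplus>\<^bsub>X\<^esub> y g s)"
      by (simp add: family_group_def)
    then show ?thesis
      using functor_add[OF M S[OF g] X families_mor[of x R S A X g] families_mor[of y R S A X g] m[OF g]]
        xy g by simp
  qed
  then have "?ev (x \<otimes>\<^bsub>?E\<^esub> y) =
      finprod (fobj M X) (\<lambda>g. fmor M (S g) X (x g) (m g) \<otimes>\<^bsub>fobj M X\<^esub> fmor M (S g) X (y g) (m g)) A"
    unfolding evaluation_def using closed xy by (intro MX.finprod_cong') auto
  also have "\<dots> = ?ev x \<otimes>\<^bsub>fobj M X\<^esub> ?ev y"
    unfolding evaluation_def using closed xy by (intro MX.finprod_multf) auto
  finally show "?ev (x \<otimes>\<^bsub>?E\<^esub> y) =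
      ?ev x \<otimes>\<^bsub>fobj M X\<^esub> ?ev y" .
qed

lemma evaluation_closed:
  "X \<in> lmod_ob R \<Longrightarrow> x \<in> families R S A X \<Longrightarrow> evaluation M S m A X x \<in> carrier (fobj M X)"
  using hom_in_carrier[OF evaluation_hom] by simp

lemma evaluation_natural:
  assumes f: "f \<in> lmod_mor R X Y" and X: "X \<in> lmod_ob R" and Y: "Y \<in> lmod_ob R"
    and x: "x \<in> families R S A X"
  shows "fmor M X Y f (evaluation M S m A X x) = evaluation M S m A Y (push S f x)"
proof -
  interpret MY: comm_group "fobj M Y" using functor_ob[OF M Y] .
  have "fmor M X Y f (evaluation M S m A X x) =
      finprod (fobj M Y) (\<lambda>g. fmor M X Y f (fmor M (S g) X (x g) (m g))) A"
    unfolding evaluation_def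
    by (rule hom_finprod[OF functor_ob[OF M X] functor_ob[OF M Y] functor_hom[OF M X Y f] A
          evaluation_summand_closed[OF X x]])
  also have "\<dots> = evaluation M S m A Y (push S f x)"
    unfolding evaluation_def
  proof (rule MY.finprod_cong')
    show "fmor M X Y f (fmor M (S g) X (x g) (m g)) = fmor M (S g) Y (push S f x g) (m g)"
      if "g \<in> A" for g
      using functor_compose[OF M S[OF that] X Y families_mor[OF x that] f m[OF that]]
      by (simp add: push_def)
    show "(\<lambda>g. fmor M (S g) Y (push S f x g) (m g)) \<in> A \<rightarrow> carrier (fobj M Y)"
      using evaluation_summand_closed[OF Y push_closed[OF S f X Y x]] by blast
  qed simp
  finally show ?thesis .
qed

lemma families_mono:
  assumes "C \<subseteq> A" "X \<in> lmod_ob R" "x \<in> families R S C X"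
  shows "x \<in> families R S A X"
proof -
  have "x g \<in> lmod_mor R (S g) X" if "g \<in> A" for g
    using assms(3) zero_mor[OF S[OF that] assms(2)] by (cases "g \<in> C") (auto simp: families_def)
  then show ?thesis
    using assms(1,3) by (auto simp: families_def)
qed

lemma evaluation_superset:
  assumes C: "C \<subseteq> A" and X: "X \<in> lmod_ob R" and x: "x \<in> families R S C X"
  shows "evaluation M S m A X x = evaluation M S m C X x"
proof -
  interpret MX: comm_group "fobj M X" using functor_ob[OF M X] .
  have "fmor M (S g) X (x g) (m g) = \<one>\<^bsub>fobj M X\<^esub>" if g: "g \<in> A - C" for g
    using functor_zero[OF M S X m, of g] g x by (simp add: families_def)
  then show ?thesis
    unfolding evaluation_def
    using evaluation_summand_closed[OF X families_mono[OF C X x]]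
    by (intro MX.finprod_mono_neutral_cong_right[OF A C]) auto
qed

end

text \<open>Each summand \<open>k b \<circ> h b\<close> of \<open>d k\<close> is the image of \<open>h b\<close> under \<open>k b\<close>. By naturality it is
  enough to kill the universal relations \<open>h b\<close>.\<close>

lemma (in functor_presentation) evaluation_kills_relations:
  assumes M: "additive_functor R M" and m: "\<And>g. g \<in> A \<Longrightarrow> m g \<in> carrier (fobj M (S g))"
    and rel: "\<And>b. b \<in> B \<Longrightarrow> evaluation M S m A (T b) (h b) = \<one>\<^bsub>fobj M (T b)\<^esub>"
    and X: "X \<in> lmod_ob R" and x: "x \<in> D X"
  shows "evaluation M S m A X x = \<one>\<^bsub>fobj M X\<^esub>"
proof -
  obtain k where k: "k \<in> families R T B X" "x = d X k" using x by blast
  interpret MX: comm_group "fobj M X" using functor_ob[OF M X] .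
  have "evaluation M S m A X x =
      finprod (fobj M X) (\<lambda>b. evaluation M S m A X (push S (k b) (h b))) B"
    unfolding k(2) relation_map_def
    using hom_finprod[OF E_group[OF X] functor_ob[OF M X] evaluation_hom[where S = S, OF M A S_ob m X] B]
      relation_closed[OF X k(1)] by simp
  also have "\<dots> = \<one>\<^bsub>fobj M X\<^esub>"
  proof (rule MX.finprod_one_eqI)
    fix b assume b: "b \<in> B"
    note kb = families_mor[OF k(1) b] and Tb = T_ob[OF b]
    have "evaluation M S m A X (push S (k b) (h b)) = fmor M (T b) X (k b) (evaluation M S m A (T b) (h b))"
      using evaluation_natural[where S = S, OF M A S_ob m kb Tb X h[OF b]] by simp
    also have "\<dots> = \<one>\<^bsub>fobj M X\<^esub>"
      using rel[OF b] hom_one[OF functor_hom[OF M Tb X kb] functor_group[OF M Tb] functor_group[OF M X]]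
      by simp
    finally show "evaluation M S m A X (push S (k b) (h b)) = \<one>\<^bsub>fobj M X\<^esub>" .
  qed
  finally show ?thesis .
qed

text \<open>The additional summands are \<open>0 \<circ> h b\<close>, because \<open>k\<close> vanishes off \<open>B\<close>.\<close>

lemma relation_map_superset:
  assumes P: "functor_presentation R S A T B h" and P': "functor_presentation R S A' T B' h"
    and AA: "A \<subseteq> A'" and BB: "B \<subseteq> B'" and X: "X \<in> lmod_ob R" and k: "k \<in> families R T B X"
  shows "relation_map R S A' B' h X k = relation_map R S A B h X k"
proof -
  interpret P: functor_presentation R S A T B h by fact
  interpret P': functor_presentation R S A' T B' h by fact
  interpret E': comm_group "family_group R S A' X" using P'.E_group[OF X] .
  have inc: "families R S A X \<subseteq> families R S A' X"
    using zero_mor[OF P'.S_ob X] AA by (fastforce simp: families_def)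
  have id: "(\<lambda>x. x) \<in> hom (family_group R S A X) (family_group R S A' X)"
    using inc by (auto simp: hom_def family_group_def)
  have "relation_map R S A B h X k = finprod (family_group R S A' X) (\<lambda>b. push S (k b) (h b)) B"
    unfolding relation_map_def
    using hom_finprod[OF P.E_group[OF X] P'.E_group[OF X] id P.B] P.relation_closed[OF X k] by simp
  also have "\<dots> = finprod (family_group R S A' X) (\<lambda>b. push S (k b) (h b)) B'"
  proof (rule E'.finprod_mono_neutral_cong_left[OF P'.B BB])
    show one: "push S (k b) (h b) = \<one>\<^bsub>family_group R S A' X\<^esub>" if b: "b \<in> B' - B" for b
      using push_zero_mor[where S = S and A = A', OF P'.S_ob P'.T_ob P'.h] k b
      by (auto simp: families_def)
    show "(\<lambda>b. push S (k b) (h b)) \<in> B' \<rightarrow> carrier (family_group R S A' X)"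
    proof
      fix b assume b: "b \<in> B'"
      show "push S (k b) (h b) \<in> carrier (family_group R S A' X)"
      proof (cases "b \<in> B")
        case True
        then show ?thesis using P.relation_closed[OF X k] inc by auto
      next
        case False
        then show ?thesis using one b E'.one_closed by simp
      qed
    qed
  qed simp
  finally show ?thesis
    unfolding relation_map_def by simp
qed

section \<open>The presentation of a functor that preserves direct limits\<close>

locale limit_preserving =
  fixes R :: "('r, 's) ring_scheme" and M :: "('r, 'u) lmod_functor" and \<G> :: "('r, 'u) module set"
    and idx :: "'i itself"
  assumes universe: "universe_type TYPE('u)" and M: "additive_functor R M"
    and preserves: "preserves_direct_limits R M"
    and small_\<G>: "small TYPE('u) \<G>" and fp: "\<And>S. S \<in> \<G> \<Longrightarrow> finitely_presented R S"
    and approximation: "\<And>X. X \<in> lmod_ob R \<Longrightarrow> \<exists>(I :: 'i set) r S f l.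
      small TYPE('u) I \<and> lmod_limit R I r S f X l \<and> (\<forall>i\<in>I. S i \<in> \<G>)"
begin

text \<open>A generator \<open>(S, m)\<close> is a natural transformation \<open>Hom(S, -) \<rightarrow> M\<close>. A relation \<open>(T, h)\<close> is a
  natural transformation \<open>Hom(T, -) \<rightarrow> \<Oplus>g\<in>A. Hom(fst g, -)\<close> whose composite with the
  evaluation is zero.\<close>

definition gens :: "(('r, 'u) module \<times> 'u) set" where
  "gens = (SIGMA S:\<G>. carrier (fobj M S))"

definition rels where
  "rels A = (SIGMA T:\<G>. {h \<in> families R fst A T. evaluation M fst snd A T h = \<one>\<^bsub>fobj M T\<^esub>})"

definition indices where
  "indices = (SIGMA A:{A. finite A \<and> A \<subseteq> gens}. {B. finite B \<and> B \<subseteq> rels A})"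

definition order where
  "order = {(i, j). i \<in> indices \<and> j \<in> indices \<and> fst i \<subseteq> fst j \<and> snd i \<subseteq> snd j}"

abbreviation "fam i X \<equiv> families R fst (fst i) X"
abbreviation "E i X \<equiv> family_group R fst (fst i) X"
abbreviation "F i \<equiv> cokernel_functor R fst (fst i) fst (snd i) snd"
abbreviation "q i X \<equiv> snd (cokernel R fst (fst i) fst (snd i) snd X)"
abbreviation "ev i X \<equiv> evaluation M fst snd (fst i) X"

text \<open>The two maps are induced by the inclusion of families and by the evaluation of
  families.\<close>

definition transition where
  "transition i j X = factor_map (E i X) (q i X) (fobj (F i) X) (q j X)"

definition cocone where
  "cocone i X = factor_map (E i X) (q i X) (fobj (F i) X) (ev i X)"

lemma gensD: "g \<in> gens \<Longrightarrow> fst g \<in> \<G> \<and> snd g \<in> carrier (fobj M (fst g))"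
  by (auto simp: gens_def)

lemma \<G>_ob: "S \<in> \<G> \<Longrightarrow> S \<in> lmod_ob R"
  using fp finitely_presented_ob by blast

lemma indicesD:
  assumes "i \<in> indices"
  shows "finite (fst i)" "fst i \<subseteq> gens" "finite (snd i)" "snd i \<subseteq> rels (fst i)"
  using assms by (auto simp: indices_def)

context
  fixes A
  assumes A: "finite A" "A \<subseteq> gens"
begin

lemma gens_ob: "g \<in> A \<Longrightarrow> fst g \<in> lmod_ob R"
  using A gensD \<G>_ob by blast

lemma gens_fp: "g \<in> A \<Longrightarrow> finitely_presented R (fst g)"
  using A gensD fp by blast

lemma gens_elem: "g \<in> A \<Longrightarrow> snd g \<in> carrier (fobj M (fst g))"
  using A gensD by blast

lemma ev_hom:
  assumes "X \<in> lmod_ob R"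
  shows "evaluation M fst snd A X \<in> hom (family_group R fst A X) (fobj M X)"
  by (rule evaluation_hom[OF M A(1) gens_ob gens_elem assms])

lemma ev_closed:
  assumes "X \<in> lmod_ob R" "x \<in> families R fst A X"
  shows "evaluation M fst snd A X x \<in> carrier (fobj M X)"
  by (rule evaluation_closed[OF M A(1) gens_ob gens_elem assms])

lemma ev_natural:
  assumes "f \<in> lmod_mor R X Y" "X \<in> lmod_ob R" "Y \<in> lmod_ob R" "x \<in> families R fst A X"
  shows "fmor M X Y f (evaluation M fst snd A X x) = evaluation M fst snd A Y (push fst f x)"
  by (rule evaluation_natural[OF M A(1) gens_ob gens_elem assms])

lemma ev_superset:
  assumes "C \<subseteq> A" "X \<in> lmod_ob R" "x \<in> families R fst C X"
  shows "evaluation M fst snd A X x = evaluation M fst snd C X x"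
  by (rule evaluation_superset[OF M A(1) gens_ob gens_elem assms])

lemma fam_mono:
  assumes "C \<subseteq> A" "X \<in> lmod_ob R" "x \<in> families R fst C X"
  shows "x \<in> families R fst A X"
  by (rule families_mono[OF M A(1) gens_ob gens_elem assms])

lemma small_rels: "small TYPE('u) (rels A)"
proof (rule small_mono)
  show "small TYPE('u) (SIGMA T:\<G>. families R fst A T)"
    using small_families[where S = fst and A = A, OF gens_ob universe A(1) gens_fp \<G>_ob]
    by (intro small_Sigma[OF universe small_\<G>])
qed (auto simp: rels_def)

lemma rels_mono:
  assumes "C \<subseteq> A"
  shows "rels C \<subseteq> rels A"
  using ev_superset[OF assms \<G>_ob] fam_mono[OF assms \<G>_ob] by (auto simp: rels_def)

end

lemma presentation:
  assumes "i \<in> indices"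
  shows "functor_presentation R fst (fst i) fst (snd i) snd"
proof
  note i = indicesD[OF assms]
  show "universe_type TYPE('u)" by (rule universe)
  show "finitely_presented R (fst g)" if "g \<in> fst i" for g
    using gens_fp[OF i(1,2) that] .
  show "finitely_presented R (fst b)" "snd b \<in> families R fst (fst i) (fst b)" if "b \<in> snd i" for b
    using i(4) that fp by (auto simp: rels_def)
qed (use indicesD[OF assms] in auto)

lemma small_indices: "small TYPE('u) indices"
proof -
  have "small TYPE('u) gens"
    unfolding gens_def
  proof (rule small_Sigma[OF universe small_\<G>])
    show "small TYPE('u) (carrier (fobj M S))" if "S \<in> \<G>" for S
      using M \<G>_ob[OF that] unfolding additive_functor_def ab_ob_def by blast
  qed
  then show ?thesis
    unfolding indices_def
    using small_rels
    by (intro small_Sigma[OF universe] small_finite_subsets[OF universe]) auto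
qed

lemma directed: "directed_set indices order"
  unfolding directed_set_def
proof (intro conjI ballI)
  have "({}, {}) \<in> indices" by (simp add: indices_def)
  then show "indices \<noteq> {}" by blast
  show "partial_order_on indices order"
    unfolding partial_order_on_def preorder_on_def refl_on_def trans_def antisym_def order_def
    by (auto simp: prod_eq_iff)
  fix i j assume ij: "i \<in> indices" "j \<in> indices"
  note i = indicesD[OF ij(1)] and j = indicesD[OF ij(2)]
  let ?k = "(fst i \<union> fst j, snd i \<union> snd j)"
  have A: "finite (fst i \<union> fst j)" "fst i \<union> fst j \<subseteq> gens"
    using i j by auto
  have "snd i \<union> snd j \<subseteq> rels (fst i \<union> fst j)"
    using i(4) j(4) rels_mono[OF A Un_upper1] rels_mono[OF A Un_upper2] by blast
  then have "?k \<in> indices"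
    using i j A by (simp add: indices_def)
  then show "\<exists>k\<in>indices. (i, k) \<in> order \<and> (j, k) \<in> order"
    using ij by (intro bexI[of _ ?k]) (auto simp: order_def)
qed

lemma orderD:
  assumes "(i, j) \<in> order"
  shows "i \<in> indices" "j \<in> indices" "fst i \<subseteq> fst j" "snd i \<subseteq> snd j"
  using assms by (auto simp: order_def)

context
  fixes i j and X :: "('r, 'u) module"
  assumes ij: "(i, j) \<in> order" and X: "X \<in> lmod_ob R"
begin

interpretation i: functor_presentation R fst "fst i" fst "snd i" snd
  using presentation[OF orderD(1)[OF ij]] .

interpretation j: functor_presentation R fst "fst j" fst "snd j" snd
  using presentation[OF orderD(2)[OF ij]] .

lemma fam_order: "x \<in> fam i X \<Longrightarrow> x \<in> fam j X"
  using fam_mono[OF indicesD(1,2)[OF orderD(2)[OF ij]] orderD(3)[OF ij] X] .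

lemma q_transition_hom: "q j X \<in> hom (E i X) (fobj (F j) X)"
proof -
  have "(\<lambda>x. x) \<in> hom (E i X) (E j X)"
    using fam_order by (auto simp: hom_def family_group_def)
  from hom_compose[OF this j.q_hom[OF X]] show ?thesis
    by (simp add: comp_def)
qed

lemma q_transition_kills:
  assumes "x \<in> i.D X"
  shows "q j X x = \<one>\<^bsub>fobj (F j) X\<^esub>"
proof -
  obtain k where k: "k \<in> families R fst (snd i) X" "x = i.d X k" using assms by blast
  have "k \<in> families R fst (snd j) X"
    using k(1) zero_mor[OF j.T_ob X] orderD(4)[OF ij] by (fastforce simp: families_def)
  moreover have "x = j.d X k"
    using relation_map_superset[OF i.functor_presentation_axioms j.functor_presentation_axioms
        orderD(3,4)[OF ij] X k(1)] k(2) by simp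
  ultimately have "x \<in> j.D X" by blast
  moreover have "x \<in> fam j X"
    using fam_order[OF i.d_closed[OF X k(1)]] k(2) by simp
  ultimately show ?thesis
    using j.q_eq_one_iff[OF X] by blast
qed

lemma transition_apply:
  assumes "x \<in> fam i X"
  shows "transition i j X (q i X x) = q j X x"
  unfolding transition_def
  using factor_map_apply[OF i.quotient(2)[OF X] comm_group.axioms(2)[OF j.F_comm_group[OF X]]
      q_transition_hom q_transition_kills] assms by simp

lemma transition_ab_mor: "transition i j X \<in> ab_mor (fobj (F i) X) (fobj (F j) X)"
  unfolding transition_def
  using factor_map_ab_mor[OF i.quotient(2)[OF X] j.F_comm_group[OF X] q_transition_hom q_transition_kills] .

end

context
  fixes i and X :: "('r, 'u) module"
  assumes i: "i \<in> indices" and X: "X \<in> lmod_ob R"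
begin

interpretation i: functor_presentation R fst "fst i" fst "snd i" snd
  using presentation[OF i] .

lemma ev_kills:
  assumes "x \<in> i.D X"
  shows "ev i X x = \<one>\<^bsub>fobj M X\<^esub>"
proof (rule i.evaluation_kills_relations[OF M gens_elem[OF indicesD(1,2)[OF i]] _ X assms])
  show "ev i (fst b) (snd b) = \<one>\<^bsub>fobj M (fst b)\<^esub>" if "b \<in> snd i" for b
    using indicesD(4)[OF i] that by (auto simp: rels_def)
qed

lemma cocone_apply:
  assumes "x \<in> fam i X"
  shows "cocone i X (q i X x) = ev i X x"
  unfolding cocone_def
  using factor_map_apply[OF i.quotient(2)[OF X] functor_group[OF M X] ev_hom[OF indicesD(1,2)[OF i] X] ev_kills]
    assms by simp

lemma cocone_ab_mor: "cocone i X \<in> ab_mor (fobj (F i) X) (fobj M X)"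
  unfolding cocone_def
  using factor_map_ab_mor[OF i.quotient(2)[OF X] functor_ob[OF M X] ev_hom[OF indicesD(1,2)[OF i] X] ev_kills] .

lemma F_eqI:
  assumes "u \<in> extensional (carrier (fobj (F i) X))" "v \<in> extensional (carrier (fobj (F i) X))"
    and "\<And>x. x \<in> fam i X \<Longrightarrow> u (q i X x) = v (q i X x)"
  shows "u = v"
proof (rule extensionalityI[OF assms(1,2)])
  fix y assume "y \<in> carrier (fobj (F i) X)"
  then obtain x where "x \<in> fam i X" "y = q i X x" using i.q_surj[OF X] by blast
  then show "u y = v y" using assms(3) by simp
qed

end

lemma transition_nat_trans:
  assumes ij: "(i, j) \<in> order"
  shows "transition i j \<in> nat_trans R (F i) (F j)"
proof -
  note i = orderD(1)[OF ij] and j = orderD(2)[OF ij]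
  interpret i: functor_presentation R fst "fst i" fst "snd i" snd using presentation[OF i] .
  interpret j: functor_presentation R fst "fst j" fst "snd j" snd using presentation[OF j] .
  show ?thesis
    unfolding nat_trans_def
  proof (intro CollectI conjI ballI)
    show "transition i j X \<in> ab_mor (fobj (F i) X) (fobj (F j) X)" if "X \<in> lmod_ob R" for X
      using transition_ab_mor[OF ij that] .
    fix X Y :: "('r, 'u) module" and f assume X: "X \<in> lmod_ob R" and Y: "Y \<in> lmod_ob R" and f: "f \<in> lmod_mor R X Y"
    show "compose (carrier (fobj (F i) X)) (transition i j Y) (fmor (F i) X Y f) =
        compose (carrier (fobj (F i) X)) (fmor (F j) X Y f) (transition i j X)"
    proof (rule F_eqI[OF i X])
      fix x assume x: "x \<in> fam i X"
      show "compose (carrier (fobj (F i) X)) (transition i j Y) (fmor (F i) X Y f) (q i X x) =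
        compose (carrier (fobj (F i) X)) (fmor (F j) X Y f) (transition i j X) (q i X x)"
        using i.q_closed[OF X x] i.F_apply[OF f X Y x] transition_apply[OF ij X x]
          transition_apply[OF ij Y i.E_push_closed[OF f X Y x]] j.F_apply[OF f X Y fam_order[OF ij X x]]
        by (simp add: compose_def)
    qed (simp_all add: compose_def)
  qed
qed

lemma cocone_nat_trans:
  assumes i: "i \<in> indices"
  shows "cocone i \<in> nat_trans R (F i) M"
proof -
  interpret i: functor_presentation R fst "fst i" fst "snd i" snd using presentation[OF i] .
  show ?thesis
    unfolding nat_trans_def
  proof (intro CollectI conjI ballI)
    show "cocone i X \<in> ab_mor (fobj (F i) X) (fobj M X)" if "X \<in> lmod_ob R" for X
      using cocone_ab_mor[OF i that] .
    fix X Y :: "('r, 'u) module" and f assume X: "X \<in> lmod_ob R" and Y: "Y \<in> lmod_ob R" and f: "f \<in> lmod_mor R X Y"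
    show "compose (carrier (fobj (F i) X)) (cocone i Y) (fmor (F i) X Y f) =
        compose (carrier (fobj (F i) X)) (fmor M X Y f) (cocone i X)"
    proof (rule F_eqI[OF i X])
      fix x assume x: "x \<in> fam i X"
      show "compose (carrier (fobj (F i) X)) (cocone i Y) (fmor (F i) X Y f) (q i X x) =
        compose (carrier (fobj (F i) X)) (fmor M X Y f) (cocone i X) (q i X x)"
        using i.q_closed[OF X x] i.F_apply[OF f X Y x] cocone_apply[OF i X x]
          cocone_apply[OF i Y i.E_push_closed[OF f X Y x]] ev_natural[OF indicesD(1,2)[OF i] f X Y x]
        by (simp add: compose_def)
    qed (simp_all add: compose_def)
  qed
qed

lemma transition_extensional: "transition i j X \<in> extensional (carrier (fobj (F i) X))"
  by (simp add: transition_def factor_map_def)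

lemma direct_system: "direct_system_functor R indices order F transition"
  unfolding direct_system_functor_def
proof (intro conjI ballI allI impI)
  note rel = directed_set_rel[OF directed]
  show "additive_functor R (F i)" if "i \<in> indices" for i
    using functor_presentation.F_additive[OF presentation[OF that]] .
  show "case p of (i, j) \<Rightarrow> transition i j \<in> nat_trans R (F i) (F j)" if "p \<in> order" for p
    using transition_nat_trans[of "fst p" "snd p"] that by (simp add: case_prod_beta)
  fix X :: "('r, 'u) module" assume X: "X \<in> lmod_ob R"
  show "transition i i X = (\<lambda>x\<in>carrier (fobj (F i) X). x)" if i: "i \<in> indices" for i
  proof (rule F_eqI[OF i X transition_extensional])
    fix x assume x: "x \<in> fam i X"
    show "transition i i X (q i X x) = (\<lambda>x\<in>carrier (fobj (F i) X). x) (q i X x)"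
      using transition_apply[OF rel(2)[OF i] X x] functor_presentation.q_closed[OF presentation[OF i] X x]
      by simp
  qed simp
  fix i j k assume ij: "(i, j) \<in> order" and jk: "(j, k) \<in> order"
  note ik = rel(3)[OF ij jk] and i = orderD(1)[OF ij]
  show "transition i k X = compose (carrier (fobj (F i) X)) (transition j k X) (transition i j X)"
  proof (rule F_eqI[OF i X transition_extensional])
    fix x assume x: "x \<in> fam i X"
    show "transition i k X (q i X x) =
        compose (carrier (fobj (F i) X)) (transition j k X) (transition i j X) (q i X x)"
      using transition_apply[OF ik X x] transition_apply[OF ij X x]
        transition_apply[OF jk X fam_order[OF ij X x]]
        functor_presentation.q_closed[OF presentation[OF i] X x]
      by (simp add: compose_def)
  qed (simp add: compose_def)
qed

lemma cocone_compatible: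
  assumes X: "X \<in> lmod_ob R" and ij: "(i, j) \<in> order"
  shows "cocone i X = compose (carrier (fobj (F i) X)) (cocone j X) (transition i j X)"
proof (rule F_eqI[OF orderD(1)[OF ij] X])
  note i = orderD(1)[OF ij] and j = orderD(2)[OF ij]
  fix x assume x: "x \<in> fam i X"
  show "cocone i X (q i X x) = compose (carrier (fobj (F i) X)) (cocone j X) (transition i j X) (q i X x)"
    using cocone_apply[OF i X x] transition_apply[OF ij X x] cocone_apply[OF j X fam_order[OF ij X x]]
      ev_superset[OF indicesD(1,2)[OF j] orderD(3)[OF ij] X x]
      functor_presentation.q_closed[OF presentation[OF i] X x]
    by (simp add: compose_def)
qed (simp_all add: cocone_def factor_map_def compose_def)

text \<open>Write \<open>X\<close> as a direct limit of modules in \<open>\<G>\<close>. An element of \<open>M X\<close> comes from one of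
  these modules, which makes it the image of a generator. If a family \<open>x\<close> evaluates to zero in
  \<open>M X\<close>, then it factors through one of these modules in such a way that it evaluates to zero
  there already, and this is a relation that kills \<open>x\<close>.\<close>

lemma cocone_limit:
  assumes X: "X \<in> lmod_ob R"
  shows "limit_cocone indices order (\<lambda>i. fobj (F i) X) (\<lambda>i j. transition i j X) (fobj M X)
    (\<lambda>i. cocone i X)"
proof -
  obtain I :: "'i set" and r S f l where I: "small TYPE('u) I" and lim: "lmod_limit R I r S f X l"
    and S: "\<And>a. a \<in> I \<Longrightarrow> S a \<in> \<G>"
    using approximation[OF X] by blast
  note L = lmod_limitD[OF lim]
  note Ds = direct_system_lmodD[OF L(2)]
  note lim_M = preserves_direct_limitsD[OF M preserves I lim]
  show ?thesis
    unfolding limit_cocone_def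
  proof (intro conjI ballI impI)
    fix y assume y: "y \<in> carrier (fobj M X)"
    obtain a n where a: "a \<in> I" "n \<in> carrier (fobj M (S a))" "y = fmor M (S a) X (l a) n"
      using limit_cocone_surj[OF lim_M y] .
    define g where "g = (S a, n)"
    have g: "g \<in> gens" using a S by (simp add: g_def gens_def)
    define i where "i = ({g}, {} :: (('r, 'u) module \<times> (('r, 'u) module \<times> 'u \<Rightarrow> 'u \<Rightarrow> 'u)) set)"
    have i: "i \<in> indices" using g by (simp add: i_def indices_def)
    interpret i: functor_presentation R fst "fst i" fst "snd i" snd using presentation[OF i] .
    define x where "x g' = (if g' = g then l a else zero_mor (fst g') X)" for g' :: "('r, 'u) module \<times> 'u"
    have x: "x \<in> fam i X"
      using L(4)[OF a(1)] by (simp add: families_def x_def g_def i_def)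
    interpret MX: comm_group "fobj M X" using functor_ob[OF M X] .
    have "ev i X x = y"
      using a functor_closed[OF M Ds(1)[OF a(1)] X L(4)[OF a(1)] a(2)]
      by (simp add: evaluation_def x_def g_def i_def)
    then have "y = cocone i X (q i X x)"
      using cocone_apply[OF i X x] by simp
    then show "\<exists>i\<in>indices. \<exists>z\<in>carrier (fobj (F i) X). y = cocone i X z"
      using i i.q_closed[OF X x] by blast
  next
    fix i z assume i: "i \<in> indices" and z: "z \<in> carrier (fobj (F i) X)"
      and dies: "cocone i X z = \<one>\<^bsub>fobj M X\<^esub>"
    note A = indicesD(1,2)[OF i]
    interpret i: functor_presentation R fst "fst i" fst "snd i" snd using presentation[OF i] .
    obtain x where x: "x \<in> fam i X" "z = q i X x" using i.q_surj[OF X z] .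
    have evx: "ev i X x = \<one>\<^bsub>fobj M X\<^esub>"
      using dies cocone_apply[OF i X x(1)] x(2) by simp
    note EL = families_limit_cocone[where S = fst and A = "fst i", OF i.S_ob A(1) i.S lim]
    obtain a x' where x': "a \<in> I" "x' \<in> fam i (S a)" "x = push fst (l a) x'"
      using limit_cocone_surj[OF EL, of x] x(1) by auto
    note Sa = Ds(1)[OF x'(1)]
    have "fmor M (S a) X (l a) (ev i (S a) x') = \<one>\<^bsub>fobj M X\<^esub>"
      using ev_natural[OF A L(4)[OF x'(1)] Sa X x'(2)] x'(3) evx by simp
    then obtain b where b: "b \<in> I" "(a, b) \<in> r"
      "fmor M (S a) (S b) (f a b) (ev i (S a) x') = \<one>\<^bsub>fobj M (S b)\<^esub>"
      using limit_cocone_kernel[OF lim_M x'(1) ev_closed[OF A Sa x'(2)]] by blast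
    note Sb = Ds(1)[OF b(1)] and fab = Ds(2)[OF b(2)]
    define h where "h = push fst (f a b) x'"
    have h: "h \<in> fam i (S b)"
      unfolding h_def using i.E_push_closed[OF fab Sa Sb x'(2)] .
    have "ev i (S b) h = \<one>\<^bsub>fobj M (S b)\<^esub>"
      using ev_natural[OF A fab Sa Sb x'(2)] b(3) by (simp add: h_def)
    then have rel: "(S b, h) \<in> rels (fst i)"
      using S[OF b(1)] h by (simp add: rels_def)
    have xh: "x = push fst (l b) h"
      using push_compose[where S = fst and A = "fst i", OF i.S_ob Sa x'(2), of "l b" "f a b"]
        L(5)[OF b(2)] x'(3) by (simp add: h_def)
    define j where "j = (fst i, insert (S b, h) (snd i))"
    have j: "j \<in> indices"
      using indicesD[OF i] rel by (simp add: j_def indices_def)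
    have ij: "(i, j) \<in> order"
      using i j by (auto simp: order_def j_def)
    interpret j: functor_presentation R fst "fst j" fst "snd j" snd using presentation[OF j] .
    have xj: "x \<in> fam j X" using x(1) by (simp add: j_def)
    \<comment> \<open>The new relation \<open>(S b, h)\<close> with coefficient \<open>l b\<close> exhibits \<open>x = l b \<circ> h\<close> as an element of
      the image of \<open>d\<close>.\<close>
    define k where "k b' = (if b' = (S b, h) then l b else zero_mor (fst b') X)"
      for b' :: "('r, 'u) module \<times> (('r, 'u) module \<times> 'u \<Rightarrow> 'u \<Rightarrow> 'u)"
    have k: "k \<in> families R fst (snd j) X"
      using L(4)[OF b(1)] zero_mor[OF j.T_ob X] by (auto simp: families_def k_def j_def)
    interpret Ej: comm_group "E j X" using j.E_group[OF X] .
    have push_k: "push fst (k b') (snd b') = (if (S b, h) = b' then x else \<one>\<^bsub>E j X\<^esub>)" if "b' \<in> snd j" for b'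
      using push_zero_mor[where S = fst and A = "fst j", OF j.S_ob j.T_ob[OF that] j.h[OF that]] xh
      by (auto simp: k_def)
    have "j.d X k = finprod (E j X) (\<lambda>b'. if (S b, h) = b' then x else \<one>\<^bsub>E j X\<^esub>) (snd j)"
      unfolding relation_map_def using push_k xj Ej.one_closed
      by (intro Ej.finprod_cong') auto
    also have "\<dots> = x"
      using Ej.finprod_singleton[of "(S b, h)" "snd j" "\<lambda>_. x"] j.B xj by (simp add: j_def)
    finally have "x \<in> j.D X" using k by blast
    then have "transition i j X z = \<one>\<^bsub>fobj (F j) X\<^esub>"
      using transition_apply[OF ij X x(1)] x(2) j.q_eq_one_iff[OF X xj] by simp
    then show "\<exists>j\<in>indices. (i, j) \<in> order \<and> transition i j X z = \<one>\<^bsub>fobj (F j) X\<^esub>"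
      using j ij by blast
  qed
qed

lemma direct_limit_of_FP: "is_direct_limit_of_FP R M"
  using is_direct_limit_of_FPI[OF small_indices directed direct_system
      functor_presentation.F_FP[OF presentation] M cocone_nat_trans cocone_compatible cocone_limit] .

end

theorem theorem4p22:
  fixes R :: "('r, 's) ring_scheme"
    and M :: "('r, 'u) lmod_functor"
  assumes "universe_type TYPE('u)"
    and "ring R" and "small TYPE('u) (carrier R)"
    and "additive_functor R M"
  shows "preserves_direct_limits R M \<longleftrightarrow> is_direct_limit_of_FP R M"
proof
  assume preserves: "preserves_direct_limits R M"
  obtain \<G> :: "('r, 'u) module set" where \<G>: "small TYPE('u) \<G>"
    "\<And>S. S \<in> \<G> \<Longrightarrow> finitely_presented R S"
    "\<And>(A :: 'u set) B. finite A \<Longrightarrow> finite B \<Longrightarrow> B \<subseteq> vectors R A \<Longrightarrow> \<exists>S\<in>\<G>. \<exists>e. presents R S e A B"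
    by (rule finitely_presented_catalogue[OF assms(1-3), where ?'k = 'u])
      (rule that, assumption, blast+)
  have "\<exists>(I :: ('u set \<times> ('u \<Rightarrow> 'r) set) set) r S f l.
      small TYPE('u) I \<and> lmod_limit R I r S f X l \<and> (\<forall>i\<in>I. S i \<in> \<G>)" if "X \<in> lmod_ob R" for X
    by (rule lmod_limit_finitely_presented[OF assms(1-3) \<G>(3) that]) blast+
  then interpret limit_preserving R M \<G> "TYPE('u set \<times> ('u \<Rightarrow> 'r) set)"
    using assms(1,4) preserves \<G>(1,2) by unfold_locales
  show "is_direct_limit_of_FP R M" by (rule direct_limit_of_FP)
next
  assume "is_direct_limit_of_FP R M"
  then obtain I :: "'u set" and r F \<phi> \<psi> where "directed_set I r" "direct_system_functor R I r F \<phi>"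
    "\<And>i. i \<in> I \<Longrightarrow> FP_module R (F i)" "direct_limit_functor R I r F \<phi> M \<psi>"
    unfolding is_direct_limit_of_FP_def by blast
  then show "preserves_direct_limits R M"
    using preserves_direct_limits_colimit unfolding FP_module_def by blast
qed

end
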